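(* Let $f$ be a DC aura on a Riemannian manifold $M$ of dimension $d$, and let $\varepsilon>0$. Then $\mathrm{nor}_\varepsilon f\subset S^*M$ has locally finite $(d-1)$-content.
   Context: For $f:M\to\mathbb{R}$ locally Lipschitz, the Clarke differential $\partial f(x)\subset T^*_xM$ is the convex hull of all limits $\lim_i df(x_i)$ with $x_i\to x$ and $f$ differentiable at each $x_i$. A number $c$ is a weakly regular value of $f$ if whenever $x_i\to x_0$ in $M$ with $f(x_i)>f(x_0)=c$ and $\xi_i\in\partial f(x_i)$, then $\xi_i\not\to0$. A function on an open $U\subset\mathbb{R}^d$ is DC if every point of $U$ has a convex neighborhood on which it is a difference of two convex functions; $\mathrm{DC}(M)$ is the set of functions on $M$ that are DC in every $C^{1,1}$ coordinate patch. A DC aura on $M$ is an $f\in\mathrm{DC}(M)$ with $f\ge0$ for which $0$ is a weakly regular value; it is an aura for the set $A=f^{-1}(0)$. Let $\ell:T^*M\to[0,\infty)$ be a $C^1$ fiberwise $1$-homogeneous length function, positive off the zero section (e.g. the Riemannian norm), let $S^*M$ be the cosphere bundle and $\nu:T^*M\setminus(\text{zero section})\to S^*M$ the canonical projection $\xi\mapsto\xi/\ell(\xi)$. Put $$\mathrm{nor}_\varepsilon f:=\nu(\{v\in T^*M:\ \ell(v)\ge\varepsilon\text{ and } v\in\partial f(x)\text{ for some }x\in\mathrm{bdry}\,A\}),$$ where $\mathrm{bdry}\,A$ is the topological boundary of $A$. For $S\subset\mathbb{R}^n$, $\mathcal{M}^{*m}(S)=\limsup_{\epsilon\downarrow0}(2\epsilon)^{m-n}\operatorname{Vol}(S_\epsilon)$,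 where $S_\epsilon$ is the $\epsilon$-neighborhood of $S$; $S$ has finite $m$-content if $\mathcal{M}^{*m}(S)<\infty$. A subset of a manifold has locally finite $m$-content if every point of the manifold has a neighborhood $V$, with compact closure in the domain of a coordinate chart, such that the chart image of the intersection of the subset with $V$ has finite $m$-content. *)

theory Defs
  imports "HOL-Analysis.Analysis"
begin

section \<open>Differentiability classes of maps between Euclidean spaces\<close>

text \<open>Only used on open sets.\<close>

primrec Ck_on :: "nat \<Rightarrow> ('a::euclidean_space \<Rightarrow> 'b::real_normed_vector) \<Rightarrow> 'a set \<Rightarrow> bool" where
  "Ck_on 0 h S \<longleftrightarrow> continuous_on S h"
| "Ck_on (Suc k) h S \<longleftrightarrow>
     (\<forall>x\<in>S. h differentiable (at x)) \<and> (\<forall>v. Ck_on k (\<lambda>x. frechet_derivative h (at x) v) S)"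

definition smooth_on :: "('a::euclidean_space \<Rightarrow> 'b::real_normed_vector) \<Rightarrow> 'a set \<Rightarrow> bool" where
  "smooth_on h S \<longleftrightarrow> (\<forall>k. Ck_on k h S)"

definition locally_lipschitz_on ::
    "('a::metric_space \<Rightarrow> 'b::metric_space) \<Rightarrow> 'a set \<Rightarrow> bool" where
  "locally_lipschitz_on h S \<longleftrightarrow> (\<forall>x\<in>S. \<exists>r>0. \<exists>L. L-lipschitz_on (ball x r \<inter> S) h)"

definition C11_on :: "('a::euclidean_space \<Rightarrow> 'b::real_normed_vector) \<Rightarrow> 'a set \<Rightarrow> bool" where
  "C11_on h S \<longleftrightarrow> (\<forall>x\<in>S. h differentiable (at x)) \<and>
     (\<forall>v. locally_lipschitz_on (\<lambda>x. frechet_derivative h (at x) v) S)"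

definition DC_on :: "('a::euclidean_space \<Rightarrow> real) \<Rightarrow> 'a set \<Rightarrow> bool" where
  "DC_on h S \<longleftrightarrow> (\<forall>x\<in>S. \<exists>N. x \<in> interior N \<and> N \<subseteq> S \<and> convex N \<and>
     (\<exists>p q. convex_on N p \<and> convex_on N q \<and> (\<forall>y\<in>N. h y = p y - q y)))"


section \<open>Smooth and Riemannian manifolds\<close>

text \<open>A chart is a pair of its domain and its coordinate map; the values of the map outside the
  domain are irrelevant. A manifold is an abstract topology together with an atlas
  of charts into a Euclidean space whose dimension is the dimension of the manifold.\<close>

type_synonym ('m, 'e) chart = "'m set \<times> ('m \<Rightarrow> 'e)"

definition chart_of :: "'m topology \<Rightarrow> ('m, 'e::euclidean_space) chart \<Rightarrow> bool" where
  "chart_of X c \<longleftrightarrow> openin X (fst c) \<and> open (snd c ` fst c) \<and>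
     homeomorphic_map (subtopology X (fst c)) (top_of_set (snd c ` fst c)) (snd c)"

definition chart_inv :: "('m, 'e) chart \<Rightarrow> 'e \<Rightarrow> 'm" where
  "chart_inv c = inv_into (fst c) (snd c)"

definition transition :: "('m, 'e) chart \<Rightarrow> ('m, 'e') chart \<Rightarrow> 'e \<Rightarrow> 'e'" where
  "transition c c' = snd c' \<circ> chart_inv c"

definition overlap :: "('m, 'e) chart \<Rightarrow> ('m, 'e') chart \<Rightarrow> 'e set" where
  "overlap c c' = snd c ` (fst c \<inter> fst c')"

definition smooth_manifold :: "'m topology \<Rightarrow> ('m, 'e::euclidean_space) chart set \<Rightarrow> bool" where
  "smooth_manifold M \<A> \<longleftrightarrow>
     Hausdorff_space M \<and> second_countable M \<and>
     (\<forall>c\<in>\<A>. chart_of M c) \<and> (\<Union>c\<in>\<A>. fst c) = topspace M \<and>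
     (\<forall>c\<in>\<A>. \<forall>c'\<in>\<A>. smooth_on (transition c c') (overlap c c'))"

text \<open>A Riemannian metric is given by its components: \<open>g c x\<close> is the matrix, as a bilinear form on
  the model space, of the metric at the point \<open>x\<close> with respect to the chart \<open>c\<close>.\<close>

definition riemannian_metric ::
    "('m, 'e::euclidean_space) chart set \<Rightarrow> (('m, 'e) chart \<Rightarrow> 'm \<Rightarrow> 'e \<Rightarrow> 'e \<Rightarrow> real) \<Rightarrow> bool" where
  "riemannian_metric \<A> g \<longleftrightarrow>
     (\<forall>c\<in>\<A>. \<forall>x\<in>fst c. bilinear (g c x) \<and> (\<forall>v w. g c x v w = g c x w v) \<and>
        (\<forall>v. v \<noteq> 0 \<longrightarrow> g c x v v > 0)) \<and>
     (\<forall>c\<in>\<A>. \<forall>v w. smooth_on (\<lambda>p. g c (chart_inv c p) v w) (snd c ` fst c)) \<and>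
     (\<forall>c\<in>\<A>. \<forall>c'\<in>\<A>. \<forall>x\<in>fst c \<inter> fst c'. \<forall>v w.
        g c x v w = g c' x (frechet_derivative (transition c c') (at (snd c x)) v)
                           (frechet_derivative (transition c c') (at (snd c x)) w))"

definition riemannian_manifold ::
    "'m topology \<Rightarrow> ('m, 'e::euclidean_space) chart set \<Rightarrow>
     (('m, 'e) chart \<Rightarrow> 'm \<Rightarrow> 'e \<Rightarrow> 'e \<Rightarrow> real) \<Rightarrow> bool" where
  "riemannian_manifold M \<A> g \<longleftrightarrow> smooth_manifold M \<A> \<and> riemannian_metric \<A> g"

definition C11_charts ::
    "'m topology \<Rightarrow> ('m, 'e::euclidean_space) chart set \<Rightarrow> ('m, 'e) chart set" where
  "C11_charts M \<A> = {c. chart_of M c \<and>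
     (\<forall>c'\<in>\<A>. C11_on (transition c c') (overlap c c') \<and> C11_on (transition c' c) (overlap c' c))}"

definition DC_functions ::
    "'m topology \<Rightarrow> ('m, 'e::euclidean_space) chart set \<Rightarrow> ('m \<Rightarrow> real) set" where
  "DC_functions M \<A> = {f. \<forall>c\<in>C11_charts M \<A>. DC_on (f \<circ> chart_inv c) (snd c ` fst c)}"

text \<open>Functions that are $C^k$ on an open subset \<open>S\<close> of a manifold.\<close>

definition Ck_function ::
    "nat \<Rightarrow> ('m, 'e::euclidean_space) chart set \<Rightarrow> ('m \<Rightarrow> real) \<Rightarrow> 'm set \<Rightarrow> bool" where
  "Ck_function k \<A> h S \<longleftrightarrow> (\<forall>c\<in>\<A>. Ck_on k (h \<circ> chart_inv c) (snd c ` (fst c \<inter> S)))"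


section \<open>The cotangent bundle\<close>

text \<open>A covector at \<open>x\<close> is the family of its coordinate vectors with respect to all charts of the
  atlas around \<open>x\<close>, these being related by the usual transformation law (and, to have a unique
  representative, vanishing for all other pairs). The vector \<open>\<xi> c\<close> represents the linear
  form \<open>v \<mapsto> \<xi> c \<bullet> v\<close> on the model space.\<close>

type_synonym ('m, 'e) covector = "('m, 'e) chart \<Rightarrow> 'e"

definition cotangent_space ::
    "('m, 'e::euclidean_space) chart set \<Rightarrow> 'm \<Rightarrow> ('m, 'e) covector set" where
  "cotangent_space \<A> x = {\<xi>.
     (\<forall>c\<in>\<A>. \<forall>c'\<in>\<A>. x \<in> fst c \<longrightarrow> x \<in> fst c' \<longrightarrow>
        (\<forall>v. \<xi> c \<bullet> v = \<xi> c' \<bullet> frechet_derivative (transition c c') (at (snd c x)) v)) \<and>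
     (\<forall>c. c \<notin> \<A> \<or> x \<notin> fst c \<longrightarrow> \<xi> c = 0)}"

definition zero_covector :: "('m, 'e::euclidean_space) covector" where
  "zero_covector = (\<lambda>c. 0)"

definition cotangent_bundle ::
    "'m topology \<Rightarrow> ('m, 'e::euclidean_space) chart set \<Rightarrow> ('m \<times> ('m, 'e) covector) set" where
  "cotangent_bundle M \<A> = Sigma (topspace M) (cotangent_space \<A>)"

definition zero_section :: "'m topology \<Rightarrow> ('m \<times> ('m, 'e::euclidean_space) covector) set" where
  "zero_section M = topspace M \<times> {zero_covector}"

definition cotangent_chart ::
    "('m, 'e::euclidean_space) chart set \<Rightarrow> ('m, 'e) chart \<Rightarrow>
     ('m \<times> ('m, 'e) covector, 'e \<times> 'e) chart" where
  "cotangent_chart \<A> c = (Sigma (fst c) (cotangent_space \<A>), \<lambda>(x, \<xi>). (snd c x, \<xi> c))"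

definition cotangent_atlas ::
    "('m, 'e::euclidean_space) chart set \<Rightarrow> ('m \<times> ('m, 'e) covector, 'e \<times> 'e) chart set" where
  "cotangent_atlas \<A> = cotangent_chart \<A> ` \<A>"

text \<open>The topology for which all the charts of the cotangent bundle are homeomorphisms between open
  sets. Its underlying set is the cotangent bundle as soon as \<open>\<A>\<close> covers \<open>M\<close>.\<close>

definition cotangent_topology ::
    "('m, 'e::euclidean_space) chart set \<Rightarrow> ('m \<times> ('m, 'e) covector) topology" where
  "cotangent_topology \<A> =
     topology_generated_by {{z \<in> fst C. snd C z \<in> W} | C W. C \<in> cotangent_atlas \<A> \<and> open W}"


section \<open>Clarke differential and DC auras\<close>

text \<open>\<open>f\<close> is differentiable at \<open>x\<close> with $df(x) = \xi$.\<close>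

definition has_differential ::
    "'m topology \<Rightarrow> ('m, 'e::euclidean_space) chart set \<Rightarrow> ('m \<Rightarrow> real) \<Rightarrow> 'm \<Rightarrow>
     ('m, 'e) covector \<Rightarrow> bool" where
  "has_differential M \<A> f x \<xi> \<longleftrightarrow> (x, \<xi>) \<in> cotangent_bundle M \<A> \<and>
     (\<forall>c\<in>\<A>. x \<in> fst c \<longrightarrow> GDERIV (f \<circ> chart_inv c) (snd c x) :> \<xi> c)"

text \<open>The function type of covectors is not an instance of \<^class>\<open>real_vector\<close>, so
  that \<^const>\<open>convex\<close> is written out for the pointwise operations.\<close>

definition convex_covectors :: "('m, 'e::euclidean_space) covector set \<Rightarrow> bool" where
  "convex_covectors C \<longleftrightarrow> (\<forall>\<xi>\<in>C. \<forall>\<zeta>\<in>C. \<forall>u\<ge>0. \<forall>v\<ge>0. u + v = 1 \<longrightarrow>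
     (\<lambda>c. u *\<^sub>R \<xi> c + v *\<^sub>R \<zeta> c) \<in> C)"

definition clarke_differential ::
    "'m topology \<Rightarrow> ('m, 'e::euclidean_space) chart set \<Rightarrow> ('m \<Rightarrow> real) \<Rightarrow> 'm \<Rightarrow>
     ('m, 'e) covector set" where
  "clarke_differential M \<A> f x = convex_covectors hull
     {\<xi> \<in> cotangent_space \<A> x. \<exists>xs \<xi>s. limitin M xs x sequentially \<and>
        (\<forall>i. has_differential M \<A> f (xs i) (\<xi>s i)) \<and>
        limitin (cotangent_topology \<A>) (\<lambda>i. (xs i, \<xi>s i)) (x, \<xi>) sequentially}"

definition weakly_regular_value ::
    "'m topology \<Rightarrow> ('m, 'e::euclidean_space) chart set \<Rightarrow> ('m \<Rightarrow> real) \<Rightarrow> real \<Rightarrow> bool" where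
  "weakly_regular_value M \<A> f a \<longleftrightarrow>
     (\<forall>x0 xs \<xi>s. x0 \<in> topspace M \<longrightarrow> f x0 = a \<longrightarrow>
        (\<forall>i. xs i \<in> topspace M \<and> f (xs i) > a) \<longrightarrow> limitin M xs x0 sequentially \<longrightarrow>
        (\<forall>i. \<xi>s i \<in> clarke_differential M \<A> f (xs i)) \<longrightarrow>
        \<not> limitin (cotangent_topology \<A>) (\<lambda>i. (xs i, \<xi>s i)) (x0, zero_covector) sequentially)"

definition DC_aura ::
    "'m topology \<Rightarrow> ('m, 'e::euclidean_space) chart set \<Rightarrow> ('m \<Rightarrow> real) \<Rightarrow> bool" where
  "DC_aura M \<A> f \<longleftrightarrow> f \<in> DC_functions M \<A> \<and> (\<forall>x\<in>topspace M. f x \<ge> 0) \<and>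
     weakly_regular_value M \<A> f 0"


section \<open>The cosphere bundle and the set of normals\<close>

text \<open>Homogeneity is positive homogeneity, and (as for a norm) \<open>len\<close> is only required to be $C^1$ off
  the zero section.\<close>

definition length_function ::
    "'m topology \<Rightarrow> ('m, 'e::euclidean_space) chart set \<Rightarrow>
     ('m \<times> ('m, 'e) covector \<Rightarrow> real) \<Rightarrow> bool" where
  "length_function M \<A> len \<longleftrightarrow>
     (\<forall>z\<in>cotangent_bundle M \<A>. len z \<ge> 0) \<and>
     (\<forall>(x, \<xi>)\<in>cotangent_bundle M \<A>. \<forall>t\<ge>0. len (x, \<lambda>c. t *\<^sub>R \<xi> c) = t * len (x, \<xi>)) \<and>
     (\<forall>z\<in>cotangent_bundle M \<A> - zero_section M. len z > 0) \<and>
     Ck_function 1 (cotangent_atlas \<A>) len (cotangent_bundle M \<A> - zero_section M)"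

definition cosphere_bundle ::
    "'m topology \<Rightarrow> ('m, 'e::euclidean_space) chart set \<Rightarrow>
     ('m \<times> ('m, 'e) covector \<Rightarrow> real) \<Rightarrow> ('m \<times> ('m, 'e) covector) set" where
  "cosphere_bundle M \<A> len = {z \<in> cotangent_bundle M \<A>. len z = 1}"

definition cosphere_projection ::
    "('m \<times> ('m, 'e::euclidean_space) covector \<Rightarrow> real) \<Rightarrow>
     'm \<times> ('m, 'e) covector \<Rightarrow> 'm \<times> ('m, 'e) covector" where
  "cosphere_projection len = (\<lambda>(x, \<xi>). (x, \<lambda>c. \<xi> c /\<^sub>R len (x, \<xi>)))"

definition nor ::
    "'m topology \<Rightarrow> ('m, 'e::euclidean_space) chart set \<Rightarrow>
     ('m \<times> ('m, 'e) covector \<Rightarrow> real) \<Rightarrow> real \<Rightarrow> ('m \<Rightarrow> real) \<Rightarrow>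
     ('m \<times> ('m, 'e) covector) set" where
  "nor M \<A> len \<epsilon> f = cosphere_projection len `
     {(x, \<xi>). len (x, \<xi>) \<ge> \<epsilon> \<and> \<xi> \<in> clarke_differential M \<A> f x \<and>
        x \<in> M frontier_of {y \<in> topspace M. f y = 0}}"

text \<open>The charts of a subset \<open>N\<close> of a manifold as an embedded $C^1$ submanifold: the charts of the
  subspace topology whose inverses are $C^1$ immersions into the ambient manifold.\<close>

definition C1_submanifold_charts ::
    "'p topology \<Rightarrow> ('p, 'a::euclidean_space) chart set \<Rightarrow> 'p set \<Rightarrow>
     ('p, 'b::euclidean_space) chart set" where
  "C1_submanifold_charts X \<B> N = {k. chart_of (subtopology X N) k \<and>
     (\<forall>c\<in>\<B>. Ck_on 1 (transition k c) (overlap k c) \<and>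
        (\<forall>y\<in>overlap k c. inj (frechet_derivative (transition k c) (at y))))}"


section \<open>Minkowski content\<close>

definition upper_content :: "nat \<Rightarrow> 'a::euclidean_space set \<Rightarrow> ennreal" where
  "upper_content m S = Limsup (at_right 0)
     (\<lambda>r. ennreal ((2 * r) powr (real m - real DIM('a))) * emeasure lborel (\<Union>x\<in>S. ball x r))"

definition locally_finite_content ::
    "'p topology \<Rightarrow> ('p, 'b::euclidean_space) chart set \<Rightarrow> nat \<Rightarrow> 'p set \<Rightarrow> bool" where
  "locally_finite_content X \<K> m S \<longleftrightarrow>
     (\<forall>z\<in>topspace X. \<exists>V k. k \<in> \<K> \<and> z \<in> X interior_of V \<and>
        compactin X (X closure_of V) \<and> X closure_of V \<subseteq> fst k \<and>
        upper_content m (snd k ` (S \<inter> V)) < \<infinity>)"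

end

theory Submission
  imports Defs
begin

text \<open>Work in a chart and write $f = p - q$ with $p, q$ convex. At a boundary point $x$ of $A$ we have
  $f(x) = 0$ and $f \ge 0$ nearby, so $q \le p$ with equality at $x$; hence
  $\partial q(x) \subset \partial p(x)$. Since $\partial f(x) \subset \partial p(x) - \partial q(x)$,
  every covector $\xi \in \partial f(x)$ is a difference $u - v$ of two points of the one convex
  set $\partial p(x)$. A point of $\mathrm{nor}_\varepsilon f$ is therefore a pair of a point $x$ and
  the direction of a segment, of length bounded below, contained in $\partial p(x)$. The theorem
  becomes a quantitative version of the theorem of Ewald, Larman and Rogers on the directions of
  segments in the boundary of a convex body, and the proof is in their spirit, by caps.

  The quantitative statement is \<open>subdiff_directions_tube_bound\<close>: the $r$-neighbourhood of the set
  of such pairs has volume $O(r^d)$ in a $(2d-1)$-dimensional space. Put $P = p + |\cdot|^2/2$ and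
  attach to each pair the cap $E = \{z : P(x) + z\cdot(y - x) \le P(y) + r^2/2$ for all $y\}$, an
  approximate subdifferential of $P$ at $x$. It contains the $r$-neighbourhood of the translated
  segment (\<open>subdiff_translate_approx\<close>). Let $m$ be the midpoint of the segment and $K$ the largest
  set that is symmetric about $0$ and satisfies $m + K \subset E$. If the half-sized bodies
  $m_i + K_i/2$ and $m_j + K_j/2$ of two pairs meet,
  then $|x_i - x_j| \le 2r$ and $K_j \subset 16 K_i$ (\<open>macbeath_overlap\<close>). So one chooses a maximal
  family of pairs with disjoint half-sized bodies, and every pair of the set then lies near one
  of the chosen ones: its point is within $2r$ of $x_i$ and its direction, normalized to have component 1
  along a fixed basis vector, is in a fixed multiple of $K_i$. Such directions form a set of $(d-1)$-dimensional measure
  at most a constant times the volume of $K_i$, because by convexity and symmetry a multiple of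
  $K_i$ contains a sheared slab over them (\<open>emeasure_le_sheared_slab\<close>). The contribution of the chosen
  pair is thus $O(r^d |K_i|)$, and the sum of the $|K_i|$ is bounded because the half-sized bodies are disjoint and lie in a fixed ball.

  The rest of the proof transports this estimate to the manifold. Around a given point the cosphere
  bundle is parametrized by $(x, \xi) \mapsto (x, \xi/(\xi\cdot b) - b)$ for a basis vector $b$ with
  $\xi\cdot b \ne 0$. In this chart the length function enters only through an upper bound on
  compact sets, which turns the condition $\ell \ge \varepsilon$ into a lower bound for the length
  of the segments.\<close>

section \<open>Approximate subdifferentials and their Macbeath regions\<close>

text \<open>The approximate subdifferential of convex analysis, relative to a set \<open>B\<close> of test points. As a set
  of slopes it is a cap: the conjugate function exceeds a supporting affine function by at most \<open>h\<close>.\<close>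

definition approx_subdiff :: "'a::euclidean_space set \<Rightarrow> ('a \<Rightarrow> real) \<Rightarrow> real \<Rightarrow> 'a \<Rightarrow> 'a set" where
  "approx_subdiff B p h x = {u. \<forall>y\<in>B. p x + u \<bullet> (y - x) \<le> p y + h}"

abbreviation "subdiff B p x \<equiv> approx_subdiff B p 0 x"

text \<open>The Macbeath region of \<open>E\<close> at \<open>m\<close>, translated to the origin.\<close>

definition macbeath_body :: "'a::euclidean_space set \<Rightarrow> 'a \<Rightarrow> 'a set" where
  "macbeath_body E m = {w. m + w \<in> E \<and> m - w \<in> E}"

lemma approx_subdiff_eq_Inter:
  "approx_subdiff B p h x = (\<Inter>y\<in>B. {u. (y - x) \<bullet> u \<le> p y - p x + h})"
  by (auto simp: approx_subdiff_def inner_commute algebra_simps)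

lemma closed_approx_subdiff: "closed (approx_subdiff B p h x)"
  unfolding approx_subdiff_eq_Inter by (intro closed_INT ballI closed_halfspace_le)

lemma convex_approx_subdiff: "convex (approx_subdiff B p h x)"
  unfolding approx_subdiff_eq_Inter by (intro convex_INT convex_halfspace_le)

lemma closed_macbeath_body: "closed E \<Longrightarrow> closed (macbeath_body E m)"
proof -
  assume E: "closed E"
  have "macbeath_body E m = (\<lambda>w. m + w) -` E \<inter> (\<lambda>w. m - w) -` E"
    by (auto simp: macbeath_body_def)
  moreover have "closed ((\<lambda>w. m + w) -` E)" "closed ((\<lambda>w. m - w) -` E)"
    by (intro continuous_closed_vimage E continuous_intros)+
  ultimately show ?thesis by auto
qed

lemma convex_macbeath_body:
  assumes "convex E" shows "convex (macbeath_body E m)"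
proof (rule convexI)
  fix a b and u v :: real
  assume a: "a \<in> macbeath_body E m" and b: "b \<in> macbeath_body E m" and uv: "0 \<le> u" "0 \<le> v" "u + v = 1"
  have m: "u *\<^sub>R m + v *\<^sub>R m = m" using uv by (metis scaleR_add_left scaleR_one)
  have "u *\<^sub>R (m + a) + v *\<^sub>R (m + b) \<in> E" "u *\<^sub>R (m - a) + v *\<^sub>R (m - b) \<in> E"
    using a b uv assms by (auto simp: macbeath_body_def intro!: convexD)
  moreover have "u *\<^sub>R (m + a) + v *\<^sub>R (m + b) = m + (u *\<^sub>R a + v *\<^sub>R b)"
    "u *\<^sub>R (m - a) + v *\<^sub>R (m - b) = m - (u *\<^sub>R a + v *\<^sub>R b)"
    using m by (simp_all add: algebra_simps)
  ultimately show "u *\<^sub>R a + v *\<^sub>R b \<in> macbeath_body E m" by (simp add: macbeath_body_def)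
qed

lemma macbeath_body_uminus: "w \<in> macbeath_body E m \<Longrightarrow> - w \<in> macbeath_body E m"
  by (simp add: macbeath_body_def)

text \<open>The body is convex and symmetric, hence balanced.\<close>

lemma macbeath_body_scale:
  assumes "convex E" "w \<in> macbeath_body E m" "\<bar>t\<bar> \<le> 1"
  shows "t *\<^sub>R w \<in> macbeath_body E m"
proof -
  have "((1 + t) / 2) *\<^sub>R w + ((1 - t) / 2) *\<^sub>R (- w) \<in> macbeath_body E m"
    using assms by (intro convexD convex_macbeath_body macbeath_body_uminus) (auto simp: field_simps abs_le_iff)
  moreover have "((1 + t) / 2) *\<^sub>R w + ((1 - t) / 2) *\<^sub>R (- w) = ((1 + t) / 2 - (1 - t) / 2) *\<^sub>R w"
    by (simp add: scaleR_left_diff_distrib)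
  moreover have "(1 + t) / 2 - (1 - t) / 2 = t" by (simp add: field_simps)
  ultimately show ?thesis by simp
qed

lemma macbeath_body_add:
  assumes "convex E" "v \<in> macbeath_body E m" "w \<in> macbeath_body E m" "0 \<le> a" "0 \<le> b" "a + b \<le> 1"
  shows "a *\<^sub>R v + b *\<^sub>R w \<in> macbeath_body E m"
proof (cases "b = 1")
  case True
  then show ?thesis using assms by (cases "a = 0") auto
next
  case False
  have 1: "(a / (1 - b)) *\<^sub>R v \<in> macbeath_body E m"
    using assms False by (intro macbeath_body_scale) (auto simp: field_simps)
  have "(1 - b) *\<^sub>R ((a / (1 - b)) *\<^sub>R v) + b *\<^sub>R w \<in> macbeath_body E m"
    using assms 1 by (intro convexD convex_macbeath_body) auto
  then show ?thesis using False by simp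
qed

text \<open>The quadratic term gives room around the subdifferential: by $2\,d\cdot(y-x) \le |d|^2 + |y-x|^2$
  a perturbation of the slope by $d$ costs at most $|d|^2/2$. This is why caps of height $r^2/2$ are
  the right ones at scale $r$.\<close>

lemma subdiff_translate_approx:
  assumes u: "u \<in> subdiff B p x" and d: "norm d \<le> r"
  shows "x + u + d \<in> approx_subdiff B (\<lambda>y. p y + (norm y)\<^sup>2 / 2) (r\<^sup>2 / 2) x"
  unfolding approx_subdiff_def
proof (clarify)
  fix y assume y: "y \<in> B"
  have 1: "p x + u \<bullet> (y - x) \<le> p y" using u y by (auto simp: approx_subdiff_def)
  have "0 \<le> (norm (d - (y - x)))\<^sup>2" by simp
  then have "2 * (d \<bullet> (y - x)) \<le> (norm d)\<^sup>2 + (norm (y - x))\<^sup>2"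
    unfolding power2_norm_eq_inner by (simp add: algebra_simps inner_commute)
  moreover have "(norm d)\<^sup>2 \<le> r\<^sup>2" using d by (intro power_mono) auto
  moreover have "(norm y)\<^sup>2 = (norm x)\<^sup>2 + 2 * (x \<bullet> (y - x)) + (norm (y - x))\<^sup>2"
    unfolding power2_norm_eq_inner by (simp add: algebra_simps inner_commute)
  ultimately show "p x + (norm x)\<^sup>2 / 2 + (x + u + d) \<bullet> (y - x) \<le> p y + (norm y)\<^sup>2 / 2 + r\<^sup>2 / 2"
    using 1 unfolding inner_add_left by argo
qed

text \<open>A long slope would make \<open>P\<close> grow too much between \<open>x\<close> and the point at distance \<open>\<rho>\<close> in its
  direction.\<close>

lemma approx_subdiff_bounded:
  assumes "cball x \<rho> \<subseteq> B" "\<rho> > 0" "\<And>y. y \<in> B \<Longrightarrow> \<bar>P y\<bar> \<le> c" "z \<in> approx_subdiff B P h x"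
  shows "norm z \<le> (2 * c + h) / \<rho>"
proof (cases "z = 0")
  case True
  have x: "x \<in> B" using assms(1,2) by auto
  have "0 \<le> c" using assms(3)[OF x] by simp
  moreover have "0 \<le> h" using x assms(4) by (force simp: approx_subdiff_def)
  ultimately show ?thesis using True assms(2) by simp
next
  case False
  define y where "y = x + (\<rho> / norm z) *\<^sub>R z"
  have y: "y \<in> B" using assms(1,2) False by (auto simp: y_def dist_norm)
  have "z \<bullet> (y - x) = \<rho> * norm z" using False by (simp add: y_def power2_norm_eq_inner[symmetric] power2_eq_square)
  moreover have "P x + z \<bullet> (y - x) \<le> P y + h" using assms(4) y by (auto simp: approx_subdiff_def)
  moreover have "x \<in> B" using assms(1,2) by auto
  then have "\<bar>P x\<bar> \<le> c" "\<bar>P y\<bar> \<le> c" using assms(3) y by blast+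
  ultimately have "\<rho> * norm z \<le> 2 * c + h" by linarith
  then show ?thesis using assms(2) by (simp add: field_simps)
qed

text \<open>The engulfing property. Write $\varphi_i(z) \ge 0$ for the least height of a cap at $x_i$ containing
  $z$. The difference $\varphi_2 - \varphi_1$ is an affine function with linear part $x_1 - x_2$; it is
  at least $-h$ on the first cap and at most $h$ on the second. Around the common point $z$ there is
  room for half of either symmetric body, so the linear part is $O(h)$ on the first body, and on half of
  the second the function $\varphi_1$ is at most $4h$. Contracting towards $m_1$, where
  $\varphi_1 = 0$, by convexity and using the symmetry of both bodies brings the second body, scaled by
  $1/16$, into the first.\<close>

lemma macbeath_overlap:
  fixes x1 x2 m1 m2 :: "'a::euclidean_space"
  assumes x: "x1 \<in> B" "x2 \<in> B" and h: "h \<ge> 0"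
    and m1: "m1 \<in> subdiff B P x1"
    and z1: "2 *\<^sub>R (z - m1) \<in> macbeath_body (approx_subdiff B P h x1) m1"
    and z2: "2 *\<^sub>R (z - m2) \<in> macbeath_body (approx_subdiff B P h x2) m2"
  shows "\<And>w. w \<in> macbeath_body (approx_subdiff B P h x1) m1 \<Longrightarrow> \<bar>(x1 - x2) \<bullet> w\<bar> \<le> 4 * h"
    and "\<And>w. w \<in> macbeath_body (approx_subdiff B P h x2) m2 \<Longrightarrow>
      (1/16) *\<^sub>R w \<in> macbeath_body (approx_subdiff B P h x1) m1"
proof -
  let ?K1 = "macbeath_body (approx_subdiff B P h x1) m1"
  let ?K2 = "macbeath_body (approx_subdiff B P h x2) m2"
  \<comment> \<open>the affine function $\varphi_2 - \varphi_1$\<close>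
  define l where "l y = (x1 - x2) \<bullet> y - (P x1 - P x2)" for y
  have cv: "convex (approx_subdiff B P h x)" for x by (rule convex_approx_subdiff)
  have in1: "z + (1/2) *\<^sub>R w \<in> approx_subdiff B P h x1" if w: "w \<in> ?K1" for w
  proof -
    have "(1/2) *\<^sub>R (2 *\<^sub>R (z - m1)) + (1/2) *\<^sub>R w \<in> ?K1"
      using w z1 by (intro macbeath_body_add cv) auto
    then show ?thesis by (simp add: macbeath_body_def algebra_simps)
  qed
  have in2: "z + (1/2) *\<^sub>R w \<in> approx_subdiff B P h x2" if w: "w \<in> ?K2" for w
  proof -
    have "(1/2) *\<^sub>R (2 *\<^sub>R (z - m2)) + (1/2) *\<^sub>R w \<in> ?K2"
      using w z2 by (intro macbeath_body_add cv) auto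
    then show ?thesis by (simp add: macbeath_body_def algebra_simps)
  qed
  have l1: "- h \<le> l y" if "y \<in> approx_subdiff B P h x1" for y
    using that x by (force simp: approx_subdiff_def l_def algebra_simps inner_commute)
  have l2: "l y \<le> h" if "y \<in> approx_subdiff B P h x2" for y
    using that x by (force simp: approx_subdiff_def l_def algebra_simps inner_commute)
  have zero: "0 \<in> ?K1" "0 \<in> ?K2" using macbeath_body_scale[OF cv z1, of 0] macbeath_body_scale[OF cv z2, of 0] by auto
  have lz: "- h \<le> l z" "l z \<le> h" using l1[OF in1[OF zero(1)]] l2[OF in2[OF zero(2)]] by auto
  have ladd: "l (z + (1/2) *\<^sub>R w) = l z + ((x1 - x2) \<bullet> w) / 2" for w
    by (simp add: l_def inner_add_right)
  have b1: "- (4 * h) \<le> (x1 - x2) \<bullet> w" if "w \<in> ?K1" for w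
    using l1[OF in1[OF that]] lz unfolding ladd by linarith
  show "\<bar>(x1 - x2) \<bullet> w\<bar> \<le> 4 * h" if "w \<in> ?K1" for w
    using b1[OF that] b1[OF macbeath_body_uminus[OF that]] by (auto simp: abs_le_iff)
  have b2: "(x1 - x2) \<bullet> w \<le> 4 * h" if "w \<in> ?K2" for w
    using l2[OF in2[OF that]] lz unfolding ladd by linarith
  have E4: "z + (1/2) *\<^sub>R w \<in> approx_subdiff B P (4 * h) x1" if "w \<in> ?K2" for w
    unfolding approx_subdiff_def
  proof clarify
    fix y assume y: "y \<in> B"
    let ?y = "z + (1/2) *\<^sub>R w"
    have "P x2 + ?y \<bullet> (y - x2) \<le> P y + h" using in2[OF that] y by (auto simp: approx_subdiff_def)
    moreover have "l ?y \<ge> - (3 * h)"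
      using b2[OF macbeath_body_uminus[OF that]] lz unfolding ladd by (simp add: inner_minus_right)
    ultimately show "P x1 + ?y \<bullet> (y - x1) \<le> P y + 4 * h"
      by (simp add: l_def algebra_simps inner_commute)
  qed
  define E where "E = {v. m1 + v \<in> approx_subdiff B P h x1}"
  have cE: "convex E"
  proof (rule convexI)
    fix a b and u v :: real
    assume a: "a \<in> E" and b: "b \<in> E" and uv: "0 \<le> u" "0 \<le> v" "u + v = 1"
    have "u *\<^sub>R (m1 + a) + v *\<^sub>R (m1 + b) \<in> approx_subdiff B P h x1"
      using a b uv cv by (auto simp: E_def intro!: convexD)
    moreover have "u *\<^sub>R (m1 + a) + v *\<^sub>R (m1 + b) = (u + v) *\<^sub>R m1 + (u *\<^sub>R a + v *\<^sub>R b)"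
      by (simp add: algebra_simps)
    ultimately show "u *\<^sub>R a + v *\<^sub>R b \<in> E" using uv by (simp add: E_def)
  qed
  \<comment> \<open>contraction towards $m_1$ by the factor $1/4$ lowers the height from $4h$ to $h$\<close>
  have quarter: "(1/4) *\<^sub>R (z - m1 + (1/2) *\<^sub>R w) \<in> E" if "w \<in> ?K2" for w
    unfolding E_def approx_subdiff_def
  proof clarify
    fix y assume y: "y \<in> B"
    have "P x1 + (z + (1/2) *\<^sub>R w) \<bullet> (y - x1) \<le> P y + 4 * h"
      using E4[OF that] y by (auto simp: approx_subdiff_def)
    moreover have "P x1 + m1 \<bullet> (y - x1) \<le> P y" using m1 y by (auto simp: approx_subdiff_def)
    moreover have "(m1 + (1/4) *\<^sub>R (z - m1 + (1/2) *\<^sub>R w)) \<bullet> (y - x1)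
        = (3/4) * (m1 \<bullet> (y - x1)) + (1/4) * ((z + (1/2) *\<^sub>R w) \<bullet> (y - x1))"
      by (simp add: inner_add_left inner_diff_left field_simps)
    ultimately show "P x1 + (m1 + (1/4) *\<^sub>R (z - m1 + (1/2) *\<^sub>R w)) \<bullet> (y - x1) \<le> P y + h"
      by argo
  qed
  \<comment> \<open>averaging with this point removes the offset of $z$ from $m_1$\<close>
  have neg: "- ((1/4) *\<^sub>R (z - m1)) \<in> E"
  proof -
    have "(- 1/8) *\<^sub>R (2 *\<^sub>R (z - m1)) \<in> ?K1" by (intro macbeath_body_scale z1 cv) auto
    then show ?thesis by (simp add: macbeath_body_def E_def)
  qed
  have eighth: "(1/16) *\<^sub>R w \<in> E" if "w \<in> ?K2" for w
  proof -
    have "(1/2) *\<^sub>R ((1/4) *\<^sub>R (z - m1 + (1/2) *\<^sub>R w)) + (1/2) *\<^sub>R (- ((1/4) *\<^sub>R (z - m1))) \<in> E"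
      using quarter[OF that] neg by (intro convexD cE) auto
    then show ?thesis by (simp add: algebra_simps)
  qed
  show "(1/16) *\<^sub>R w \<in> ?K1" if "w \<in> ?K2" for w
    using eighth[OF that] eighth[OF macbeath_body_uminus[OF that]] by (simp add: macbeath_body_def E_def)
qed

section \<open>Lebesgue measure\<close>

text \<open>A linear map that matches the standard bases pulls boxes back to boxes of the same volume; this
  determines the image of Lebesgue measure.\<close>

lemma basis_bijection_isometry:
  fixes \<pi> :: "'a::euclidean_space \<Rightarrow> 'b::euclidean_space"
  assumes \<pi>: "bij_betw \<pi> Basis Basis"
  defines "L \<equiv> \<lambda>x. \<Sum>i\<in>Basis. (x \<bullet> i) *\<^sub>R \<pi> i"
  shows "linear L" "\<And>x. norm (L x) = norm x" "surj L"
    "\<And>x i. i \<in> Basis \<Longrightarrow> L x \<bullet> \<pi> i = x \<bullet> i"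
    "distr lborel borel L = lborel"
proof -
  show lin: "linear L" unfolding L_def
    by (rule linearI) (simp_all add: inner_add_left scaleR_add_left sum.distrib scaleR_sum_right)
  show comp: "L x \<bullet> \<pi> i = x \<bullet> i" if i: "i \<in> Basis" for x i
  proof -
    have "\<pi> j \<bullet> \<pi> i = (if j = i then 1 else 0)" if "j \<in> Basis" for j
    proof -
      have "\<pi> j \<in> Basis" "\<pi> i \<in> Basis" "\<pi> j = \<pi> i \<longleftrightarrow> j = i" using \<pi> i that
        by (auto simp: bij_betw_def inj_on_def)
      then show ?thesis by (simp add: inner_Basis)
    qed
    then have "L x \<bullet> \<pi> i = (\<Sum>j\<in>Basis. (x \<bullet> j) * (if j = i then 1 else 0))"
      unfolding L_def by (simp add: inner_sum_left)
    then show ?thesis using i by (simp add: if_distrib cong: if_cong)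
  qed
  show nrm: "norm (L x) = norm x" for x
  proof -
    have "L x \<bullet> L x = (\<Sum>b\<in>Basis. (L x \<bullet> b) * (L x \<bullet> b))" by (rule euclidean_inner)
    also have "\<dots> = (\<Sum>i\<in>Basis. (L x \<bullet> \<pi> i) * (L x \<bullet> \<pi> i))"
      using sum.reindex_bij_betw[OF \<pi>, of "\<lambda>b. (L x \<bullet> b) * (L x \<bullet> b)"] by simp
    also have "\<dots> = x \<bullet> x" by (simp add: comp euclidean_inner[of x x])
    finally show ?thesis by (simp add: norm_eq_sqrt_inner)
  qed
  show "surj L"
  proof (rule surjI)
    fix y :: 'b
    define x where "x = (\<Sum>i\<in>Basis. (y \<bullet> \<pi> i) *\<^sub>R i)"
    have "L x = (\<Sum>i\<in>Basis. (y \<bullet> \<pi> i) *\<^sub>R \<pi> i)"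
      unfolding L_def x_def by (intro sum.cong refl) (simp add: inner_sum_left inner_Basis if_distrib cong: if_cong)
    also have "\<dots> = (\<Sum>b\<in>Basis. (y \<bullet> b) *\<^sub>R b)"
      using sum.reindex_bij_betw[OF \<pi>, of "\<lambda>b. (y \<bullet> b) *\<^sub>R b"] by simp
    finally show "L ((\<Sum>i\<in>Basis. (y \<bullet> \<pi> i) *\<^sub>R i)) = y" by (simp add: euclidean_representation x_def)
  qed
  show "distr lborel borel L = lborel"
  proof (rule lborel_eqI[symmetric])
    fix l u :: 'b assume le: "\<And>b. b \<in> Basis \<Longrightarrow> l \<bullet> b \<le> u \<bullet> b"
    define l' where "l' = (\<Sum>i\<in>Basis. (l \<bullet> \<pi> i) *\<^sub>R i)"
    define u' where "u' = (\<Sum>i\<in>Basis. (u \<bullet> \<pi> i) *\<^sub>R i)"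
    have l'[simp]: "l' \<bullet> i = l \<bullet> \<pi> i" "u' \<bullet> i = u \<bullet> \<pi> i" if "i \<in> Basis" for i
      using that unfolding l'_def u'_def by (simp_all add: inner_sum_left inner_Basis if_distrib cong: if_cong)
    have im: "\<pi> ` Basis = Basis" using \<pi> by (simp add: bij_betw_def)
    have "L -` box l u = box l' u'"
      unfolding box_def im[symmetric] by (auto simp: comp)
    then have "emeasure (distr lborel borel L) (box l u) = emeasure lborel (box l' u')"
      using linear_continuous_on[of L UNIV] lin
      by (subst emeasure_distr) (auto intro!: borel_measurable_continuous_onI simp: linear_conv_bounded_linear)
    also have "\<dots> = ennreal (\<Prod>i\<in>Basis. (u' - l') \<bullet> i)"
      using le im by (subst emeasure_lborel_box) (auto simp: inner_diff_left)
    also have "(\<Prod>i\<in>Basis. (u' - l') \<bullet> i) = (\<Prod>i\<in>Basis. (u - l) \<bullet> \<pi> i)"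
      by (intro prod.cong) (auto simp: inner_diff_left)
    also have "\<dots> = (\<Prod>b\<in>Basis. (u - l) \<bullet> b)"
      using prod.reindex_bij_betw[OF \<pi>, of "\<lambda>b. (u - l) \<bullet> b"] by simp
    finally show "emeasure (distr lborel borel L) (box l u) = ennreal (\<Prod>b\<in>Basis. (u - l) \<bullet> b)" .
  qed simp
qed

text \<open>The model space of the cosphere bundle, of dimension $2d - 1$, becomes the hyperplane of $\mathbb{R}^d\times\mathbb{R}^d$
  on which the second factor is orthogonal to \<open>b\<close>. Adding one real coordinate, rather than
  splitting off a factor of dimension $d - 1$, also covers the case $d = 1$.\<close>

lemma codimension_one_isometry:
  fixes b :: "'e::euclidean_space"
  assumes dim: "DIM('s::euclidean_space) = 2 * DIM('e) - 1" and b: "b \<in> Basis"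
  obtains T :: "'s::euclidean_space \<Rightarrow> 'e \<times> 'e" where "linear T" "\<And>s. norm (T s) = norm s"
    "range T = {z. snd z \<bullet> b = 0}"
    "distr lborel borel (\<lambda>(s, t). T s + (0, t *\<^sub>R b)) = lborel"
proof -
  let ?e = "(0, 1) :: 's \<times> real" and ?f = "(0, b) :: 'e \<times> 'e"
  have e: "?e \<in> Basis" "?f \<in> Basis" using b by (auto simp: Basis_prod_def)
  have "DIM('s) + 1 = 2 * DIM('e)" using dim DIM_positive[where 'a='e] by linarith
  then have "card (Basis - {?e}) = card (Basis - {?f})" using e by (simp add: card_Diff_singleton)
  then obtain \<pi>0 where \<pi>0: "bij_betw \<pi>0 (Basis - {?e}) (Basis - {?f})"
    using finite_same_card_bij[of "Basis - {?e}" "Basis - {?f}"] by auto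
  define \<pi> where "\<pi> = \<pi>0(?e := ?f)"
  have "bij_betw \<pi> (Basis - {?e}) (Basis - {?f})"
    using \<pi>0 by (rule bij_betw_cong[THEN iffD1, rotated]) (auto simp: \<pi>_def)
  moreover have "bij_betw \<pi> {?e} {?f}" by (simp add: \<pi>_def bij_betw_def)
  ultimately have "bij_betw \<pi> ((Basis - {?e}) \<union> {?e}) ((Basis - {?f}) \<union> {?f})"
    by (intro bij_betw_combine) auto
  then have \<pi>: "bij_betw \<pi> Basis Basis" using e by (simp add: insert_absorb)
  define L where "L x = (\<Sum>i\<in>Basis. (x \<bullet> i) *\<^sub>R \<pi> i)" for x
  note L = basis_bijection_isometry[OF \<pi>, folded L_def]
  define T where "T s = L (s, 0)" for s
  have L01: "L (0, 1) = ?f"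
  proof -
    have "L ?e = (\<Sum>i\<in>Basis. if i = ?e then \<pi> i else 0)"
      unfolding L_def using e by (intro sum.cong refl) (auto simp: inner_Basis)
    then show ?thesis using e(1) by (simp add: \<pi>_def)
  qed
  have Lst: "L (s, t) = T s + (0, t *\<^sub>R b)" for s t
  proof -
    have "L (s, t) = L ((s, 0) + t *\<^sub>R (0, 1))" by simp
    also have "\<dots> = T s + t *\<^sub>R ?f" unfolding T_def by (simp only: linear_add[OF L(1)] linear_scale[OF L(1)] L01)
    finally show ?thesis by simp
  qed
  have orth: "snd (T s) \<bullet> b = 0" for s
  proof -
    have "L (s, 0) \<bullet> \<pi> ?e = 0" using L(4)[OF e(1), of "(s, 0)"] by simp
    then show ?thesis by (simp add: T_def \<pi>_def inner_prod_def)
  qed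
  show ?thesis
  proof
    show "linear T" unfolding T_def
      using linear_compose[OF _ L(1), of "\<lambda>s. (s, 0)"] by (simp add: o_def linear_iff)
    show "norm (T s) = norm s" for s by (simp add: T_def L(2))
    have "(x, y) \<in> range T" if xy: "y \<bullet> b = 0" for x y
    proof -
      obtain st where st: "L st = (x, y)" using L(3) by (metis surjD)
      obtain s t where "st = (s, t)" by (cases st)
      then have *: "T s + (0, t *\<^sub>R b) = (x, y)" using st Lst by metis
      then have "y = snd (T s) + t *\<^sub>R b" by (metis snd_add snd_conv)
      then have "t * (b \<bullet> b) = 0" using xy orth[of s] by (simp add: inner_add_left)
      then have "t = 0" using b by (simp add: inner_Basis)
      then show "(x, y) \<in> range T" using * by (metis add.right_neutral scaleR_zero_left rangeI zero_prod_def)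
    qed
    then show "range T = {z. snd z \<bullet> b = 0}" using orth by auto
    have "(\<lambda>(s, t). T s + (0, t *\<^sub>R b)) = L" by (auto simp: Lst)
    then show "distr lborel borel (\<lambda>(s, t). T s + (0, t *\<^sub>R b)) = lborel" using L(5) by simp
  qed
qed

lemma emeasure_lborel_affine:
  fixes K :: "'a::euclidean_space set"
  assumes "closed K"
  shows "emeasure lborel ((\<lambda>w. a + c *\<^sub>R w) ` K) = ennreal (\<bar>c\<bar> ^ DIM('a)) * emeasure lborel K"
proof -
  have "closed ((\<lambda>w. a + c *\<^sub>R w) ` K)"
    using closed_translation[OF closed_scaling[OF assms, of c], of a] by (simp add: image_image)
  then have m: "(\<lambda>w. a + c *\<^sub>R w) ` K \<in> sets lborel" by simp
  have "emeasure lebesgue ((\<lambda>w. c *\<^sub>R w + a) ` K) = ennreal (\<bar>c\<bar> ^ DIM('a)) * emeasure lebesgue K"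
    using emeasure_lebesgue_affine[of c a K] by simp
  then show ?thesis using m assms by (simp add: add.commute)
qed

text \<open>Fubini: the slices of \<open>Z\<close> at heights between 1 and 2 contain translates of \<open>W\<close>.\<close>

lemma emeasure_le_sheared_slab:
  fixes W :: "'s::euclidean_space set" and Z :: "('s \<times> real) set"
  assumes Z: "closed Z" and W: "closed W"
    and sub: "\<And>s t. s \<in> W \<Longrightarrow> t \<in> {1..2} \<Longrightarrow> (s + (t - 1) *\<^sub>R a, t) \<in> Z"
  shows "emeasure lborel W \<le> emeasure lborel Z"
proof -
  have Zm: "Z \<in> sets (lborel \<Otimes>\<^sub>M lborel)" using Z unfolding lborel_prod by simp
  have "emeasure lborel W = (\<integral>\<^sup>+ t. emeasure lborel W * indicator {1..2::real} t \<partial>lborel)"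
    by (simp add: nn_integral_cmult_indicator)
  also have "\<dots> \<le> (\<integral>\<^sup>+ t. emeasure lborel ((\<lambda>s. (s, t)) -` Z) \<partial>lborel)"
  proof (rule nn_integral_mono)
    fix t :: real
    show "emeasure lborel W * indicator {1..2} t \<le> emeasure lborel ((\<lambda>s. (s, t)) -` Z)"
    proof (cases "t \<in> {1..2}")
      case True
      have "emeasure lborel W = emeasure lborel ((\<lambda>w. (t - 1) *\<^sub>R a + 1 *\<^sub>R w) ` W)"
        using emeasure_lborel_affine[OF W, of "(t - 1) *\<^sub>R a" 1] by simp
      also have "\<dots> \<le> emeasure lborel ((\<lambda>s. (s, t)) -` Z)"
      proof (rule emeasure_mono)
        show "(\<lambda>w. (t - 1) *\<^sub>R a + 1 *\<^sub>R w) ` W \<subseteq> (\<lambda>s. (s, t)) -` Z"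
          using sub True by (auto simp: add.commute)
        have "closed ((\<lambda>s. (s, t)) -` Z)" by (intro continuous_closed_vimage Z continuous_intros)
        then show "(\<lambda>s. (s, t)) -` Z \<in> sets lborel" by simp
      qed
      finally show ?thesis using True by simp
    qed simp
  qed
  also have "\<dots> = emeasure (lborel \<Otimes>\<^sub>M lborel) Z"
    using lborel_pair.emeasure_pair_measure_alt2[OF Zm] by simp
  finally show ?thesis by (simp add: lborel_prod)
qed

text \<open>The cardinality of a disjoint subfamily is at most the measure of \<open>D\<close> divided by \<open>\<mu>\<close>, so there is a
  disjoint subfamily of largest cardinality; nothing can be added to it.\<close>

lemma maximal_disjoint_subfamily:
  fixes M :: "'i \<Rightarrow> 'a set"
  assumes M: "\<And>i. i \<in> I \<Longrightarrow> M i \<in> sets N" "\<And>i. i \<in> I \<Longrightarrow> M i \<subseteq> D"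
    and D: "D \<in> sets N" "emeasure N D < \<infinity>"
    and \<mu>: "\<mu> > 0" "\<And>i. i \<in> I \<Longrightarrow> \<mu> \<le> emeasure N (M i)"
  obtains F where "finite F" "F \<subseteq> I" "disjoint_family_on M F" "\<And>i. i \<in> I \<Longrightarrow> \<exists>j\<in>F. M i \<inter> M j \<noteq> {}"
proof -
  define \<F> where "\<F> = {F. finite F \<and> F \<subseteq> I \<and> disjoint_family_on M F}"
  have bound: "of_nat (card F) * \<mu> \<le> emeasure N D" if "F \<in> \<F>" for F
  proof -
    have "of_nat (card F) * \<mu> = (\<Sum>i\<in>F. \<mu>)" by simp
    also have "\<dots> \<le> (\<Sum>i\<in>F. emeasure N (M i))" using that \<mu> by (intro sum_mono) (auto simp: \<F>_def)
    also have "\<dots> = emeasure N (\<Union>i\<in>F. M i)" using that M by (intro sum_emeasure) (auto simp: \<F>_def)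
    also have "\<dots> \<le> emeasure N D" using that M D by (intro emeasure_mono) (auto simp: \<F>_def)
    finally show ?thesis .
  qed
  obtain k :: nat where k: "emeasure N D / \<mu> < of_nat k"
  proof -
    have "emeasure N D / \<mu> \<noteq> top" using D \<mu>(1) by (auto simp: ennreal_divide_eq_top_iff)
    then show ?thesis using ennreal_Ex_less_of_nat[of "emeasure N D / \<mu>"] that by (auto simp: less_top)
  qed
  have card: "card F < k" if "F \<in> \<F>" for F
  proof (rule ccontr)
    assume "\<not> card F < k"
    then have kF: "(of_nat k :: ennreal) \<le> of_nat (card F)" by simp
    have "F \<noteq> {}" using k kF by auto
    then obtain i where "i \<in> I" using \<open>F \<in> \<F>\<close> by (auto simp: \<F>_def)
    then have "\<mu> \<le> emeasure N D" using \<mu>(2) M D by (meson emeasure_mono order_trans)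
    then have "\<mu> < top" using D by (auto intro: le_less_trans)
    then have "emeasure N D < of_nat k * \<mu>" using k \<mu>(1) by (subst (asm) divide_less_ennreal) auto
    also have "\<dots> \<le> of_nat (card F) * \<mu>" using kF by (intro mult_right_mono) auto
    finally show False using bound[OF that] by simp
  qed
  have "{} \<in> \<F>" by (simp add: \<F>_def disjoint_family_on_def)
  then obtain F where F: "F \<in> \<F>" and mx: "\<And>F'. F' \<in> \<F> \<Longrightarrow> card F' \<le> card F"
    using ex_has_greatest_nat[of "\<lambda>F. F \<in> \<F>" "{}" card k] card by (metis less_imp_le)
  show ?thesis
  proof
    show "finite F" "F \<subseteq> I" "disjoint_family_on M F" using F by (auto simp: \<F>_def)
    fix i assume i: "i \<in> I"
    show "\<exists>j\<in>F. M i \<inter> M j \<noteq> {}"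
    proof (rule ccontr)
      assume none: "\<not> (\<exists>j\<in>F. M i \<inter> M j \<noteq> {})"
      have "M i \<noteq> {}" using \<mu> i by force
      then have "i \<notin> F" using none by blast
      moreover have "insert i F \<in> \<F>"
        using F i none by (auto simp: \<F>_def disjoint_family_on_def)
      ultimately show False using mx[of "insert i F"] F by (auto simp: \<F>_def)
    qed
  qed
qed

lemma emeasure_cball_scale:
  fixes x :: "'a::euclidean_space"
  assumes "r \<ge> 0"
  shows "emeasure lborel (cball x r) = ennreal (r ^ DIM('a)) * emeasure lborel (cball (0::'a) 1)"
  using assms by (simp add: emeasure_cball mult.commute flip: ennreal_mult)

text \<open>The exponent in the definition of the content is $(d-1) - (2d-1) = -d$.\<close>

lemma upper_content_finiteI:
  fixes S :: "'s::euclidean_space set"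
  assumes dim: "DIM('s) = 2 * d - 1" "d > 0"
    and bound: "\<And>r. 0 < r \<Longrightarrow> r \<le> 1 \<Longrightarrow> emeasure lborel (\<Union>s\<in>S. ball s r) \<le> ennreal (r ^ d) * C"
    and C: "C < \<infinity>"
  shows "upper_content (d - 1) S < \<infinity>"
proof -
  have eq: "ennreal ((2 * r) powr (real (d - 1) - real DIM('s))) * (ennreal (r ^ d) * C) = ennreal (1 / 2 ^ d) * C"
    if r: "0 < r" for r :: real
  proof -
    have "real (d - 1) - real DIM('s) = - real d" using dim by (simp add: of_nat_diff)
    then have "(2 * r) powr (real (d - 1) - real DIM('s)) = 1 / (2 * r) ^ d"
      using r by (simp only:) (simp add: powr_minus powr_realpow field_simps)
    then have "(2 * r) powr (real (d - 1) - real DIM('s)) * r ^ d = 1 / 2 ^ d"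
      using r by (simp add: power_mult_distrib)
    then show ?thesis using r
      by (simp flip: ennreal_mult mult.assoc)
  qed
  have "upper_content (d - 1) S \<le> Limsup (at_right (0::real)) (\<lambda>r. ennreal (1 / 2 ^ d) * C)"
    unfolding upper_content_def
  proof (rule Limsup_mono)
    have "eventually (\<lambda>r::real. r \<in> {0<..<1}) (at_right 0)" by (rule eventually_at_right_real) simp
    then show "\<forall>\<^sub>F r in at_right 0. ennreal ((2 * r) powr (real (d - 1) - real DIM('s))) * emeasure lborel (\<Union>s\<in>S. ball s r)
        \<le> ennreal (1 / 2 ^ d) * C"
    proof eventually_elim
      case (elim r)
      then show ?case using mult_left_mono[OF bound[of r], of "ennreal ((2 * r) powr (real (d - 1) - real DIM('s)))"] eq[of r] by simp
    qed
  qed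
  also have "\<dots> = ennreal (1 / 2 ^ d) * C" by (rule Limsup_const) (simp add: trivial_limit_at_right_real)
  also have "\<dots> < \<infinity>" using C by (simp add: ennreal_mult_less_top)
  finally show ?thesis .
qed

section \<open>Directions of segments in subdifferentials\<close>

text \<open>The affine coordinates $(x, y)$ with $y \perp b$ stand for the point $x$ and the direction $b + y$;
  the set \<open>S\<close> consists of pairs for which $\partial p(x)$ contains a segment equal to $\tau (b + y)$ as a
  vector. Steep directions belong to long segments, which are paid for by the volume of their bodies.\<close>

lemma subdiff_directions_tube_bound:
  fixes T :: "'s::euclidean_space \<Rightarrow> 'e::euclidean_space \<times> 'e" and b :: 'e
  assumes T: "linear T" "\<And>s. norm (T s) = norm s"
    and rng: "range T = {z. snd z \<bullet> b = 0}"
    and L: "distr lborel borel (\<lambda>(s, t). T s + (0, t *\<^sub>R b)) = (lborel :: ('e \<times> 'e) measure)"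
    and \<rho>: "\<rho> > 0" and B: "\<And>x. x \<in> X \<Longrightarrow> cball x \<rho> \<subseteq> B" "bounded B" "\<And>y. y \<in> B \<Longrightarrow> \<bar>p y\<bar> \<le> c"
    and \<tau>: "\<tau> > 0"
    and S: "\<And>s. s \<in> S \<Longrightarrow> fst (T s) \<in> X"
       "\<And>s. s \<in> S \<Longrightarrow> \<exists>u\<in>subdiff B p (fst (T s)). \<exists>v\<in>subdiff B p (fst (T s)). u - v = \<tau> *\<^sub>R (b + snd (T s))"
  obtains C where "C < \<infinity>"
    "\<And>r. 0 < r \<Longrightarrow> r \<le> 1 \<Longrightarrow> emeasure lborel (\<Union>s\<in>S. ball s r) \<le> ennreal (r ^ DIM('e)) * C"
proof -
  define P where "P y = p y + (norm y)\<^sup>2 / 2" for y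
  obtain c1 where c1: "\<And>y. y \<in> B \<Longrightarrow> norm y \<le> c1" using B(2) by (auto simp: bounded_iff)
  define c2 where "c2 = c + c1\<^sup>2 / 2"
  have Pb: "\<bar>P y\<bar> \<le> c2" if "y \<in> B" for y
  proof -
    have "(norm y)\<^sup>2 \<le> c1\<^sup>2" using c1[OF that] by (intro power_mono) auto
    moreover have "0 \<le> (norm y)\<^sup>2" by simp
    ultimately show ?thesis using B(3)[OF that] unfolding P_def c2_def abs_le_iff by linarith
  qed
  \<comment> \<open>all caps of height at most 1 at points of \<open>X\<close> lie in the ball of this radius\<close>
  define R where "R = (2 * c2 + 1) / \<rho>"
  \<comment> \<open>the body of the chosen pair contains $\frac{1}{16}\cdot\frac{\tau}{2}(b + y)$ and the ball of radius $r$;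
    this is the factor for which their convex combination contains the scaled direction of a perturbed pair\<close>
  define \<beta> where "\<beta> = \<tau> / (32 + \<tau>)"
  have \<beta>: "\<beta> > 0" "\<beta> < 1" using \<tau> by (auto simp: \<beta>_def)
  define D where "D = emeasure lborel (cball (0::'e) R)"
  define \<omega> where "\<omega> = emeasure lborel (cball (0::'e) 1)"
  have D: "D < \<infinity>" "\<omega> < \<infinity>" unfolding D_def \<omega>_def
    by (auto intro!: emeasure_bounded_finite simp flip: infinity_ennreal_def)
  define C where "C = ennreal (3 ^ DIM('e)) * \<omega> * ennreal ((4 / \<beta>) ^ DIM('e)) * D"
  have contT: "continuous_on UNIV T" using T(1) by (intro linear_continuous_on) (simp add: linear_conv_bounded_linear)
  have Td: "norm (fst (T s') - fst (T s)) \<le> norm (s' - s)" "norm (snd (T s') - snd (T s)) \<le> norm (s' - s)" for s s'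
  proof -
    have "norm (fst z) \<le> norm z" "norm (snd z) \<le> norm z" for z :: "'e \<times> 'e"
      using norm_fst_le[of "fst z" "snd z"] norm_snd_le[of "snd z" "fst z"] by simp_all
    from this[of "T s' - T s"] show "norm (fst (T s') - fst (T s)) \<le> norm (s' - s)"
      "norm (snd (T s') - snd (T s)) \<le> norm (s' - s)"
      using T(2)[of "s' - s"] by (simp_all add: linear_diff[OF T(1)])
  qed
  have "\<exists>u v. u \<in> subdiff B p (fst (T s)) \<and> v \<in> subdiff B p (fst (T s)) \<and> u - v = \<tau> *\<^sub>R (b + snd (T s))" if "s \<in> S" for s
    using S(2)[OF that] by blast
  then obtain u v where uv: "\<And>s. s \<in> S \<Longrightarrow> u s \<in> subdiff B p (fst (T s))"
      "\<And>s. s \<in> S \<Longrightarrow> v s \<in> subdiff B p (fst (T s))"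
      "\<And>s. s \<in> S \<Longrightarrow> u s - v s = \<tau> *\<^sub>R (b + snd (T s))" by metis
  define x where "x s = fst (T s)" for s
  define m where "m s = x s + (1/2) *\<^sub>R (u s + v s)" for s
  have xB: "x s \<in> B" if "s \<in> S" for s using S(1)[OF that] B(1) \<rho> by (force simp: x_def)
  have E_mid: "m s + w \<in> approx_subdiff B P (r\<^sup>2 / 2) (x s)"
    if s: "s \<in> S" and w: "norm w \<le> r" for s w r
  proof -
    have "x s + u s + w \<in> approx_subdiff B P (r\<^sup>2 / 2) (x s)"
      "x s + v s + w \<in> approx_subdiff B P (r\<^sup>2 / 2) (x s)"
      unfolding P_def using uv[OF s] w by (auto intro!: subdiff_translate_approx simp: x_def)
    from convexD[OF convex_approx_subdiff this, of "1/2" "1/2"]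
    have "(1/2) *\<^sub>R (x s + u s + w) + (1/2) *\<^sub>R (x s + v s + w) \<in> approx_subdiff B P (r\<^sup>2 / 2) (x s)" by simp
    moreover have "(1/2) *\<^sub>R (x s + u s + w) + (1/2) *\<^sub>R (x s + v s + w) = m s + w"
      by (rule euclidean_eqI) (simp add: m_def inner_add_left field_simps)
    ultimately show ?thesis by simp
  qed
  show ?thesis
  proof
    show "C < \<infinity>" using D by (simp add: C_def ennreal_mult_less_top)
    fix r :: real assume r: "0 < r" "r \<le> 1"
    define E where "E s = approx_subdiff B P (r\<^sup>2 / 2) (x s)" for s
    define K where "K s = macbeath_body (E s) (m s)" for s
    define M where "M s = (\<lambda>w. m s + (1/2) *\<^sub>R w) ` K s" for s
    have cE: "convex (E s)" "closed (E s)" for s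
      by (simp_all add: E_def convex_approx_subdiff closed_approx_subdiff)
    have clK: "closed (K s)" for s unfolding K_def by (intro closed_macbeath_body cE)
    have M_iff: "z \<in> M s \<longleftrightarrow> 2 *\<^sub>R (z - m s) \<in> K s" for z s
    proof
      assume "2 *\<^sub>R (z - m s) \<in> K s"
      then show "z \<in> M s" unfolding M_def by (rule rev_image_eqI) simp
    qed (auto simp: M_def)
    have msub: "m s \<in> subdiff B P (x s)" if "s \<in> S" for s
      using E_mid[OF that, of 0 0] by simp
    have ballK: "w \<in> K s" if "s \<in> S" "norm w \<le> r" for s w
      using E_mid[OF that] E_mid[of s "- w" r] that by (simp add: K_def macbeath_body_def E_def)
    have segK: "(\<tau>/2) *\<^sub>R (b + snd (T s)) \<in> K s" if s: "s \<in> S" for s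
    proof -
      have "x s + u s + 0 \<in> E s" "x s + v s + 0 \<in> E s"
        unfolding E_def P_def x_def using uv[OF s] r
        by (auto intro!: subdiff_translate_approx simp del: add_0_right)
      moreover have "m s + (1/2) *\<^sub>R (u s - v s) = x s + u s" "m s - (1/2) *\<^sub>R (u s - v s) = x s + v s"
        by (rule euclidean_eqI; simp add: m_def inner_add_left inner_diff_left field_simps)+
      moreover have "(\<tau>/2) *\<^sub>R (b + snd (T s)) = (1/2) *\<^sub>R (u s - v s)" using uv(3)[OF s] by simp
      ultimately show ?thesis by (simp only: K_def macbeath_body_def mem_Collect_eq add_0_right)
    qed
    have EB: "norm z \<le> R" if s: "s \<in> S" and z: "z \<in> E s" for s z
    proof -
      have "norm z \<le> (2 * c2 + r\<^sup>2 / 2) / \<rho>"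
        using z S(1)[OF s] unfolding E_def x_def by (intro approx_subdiff_bounded[OF B(1)]) (auto intro: \<rho> Pb)
      also have "\<dots> \<le> R" unfolding R_def using \<rho> r power_le_one[of r 2] by (intro divide_right_mono) auto
      finally show ?thesis .
    qed
    have MD: "M s \<subseteq> cball 0 R" if s: "s \<in> S" for s
    proof
      fix z assume "z \<in> M s"
      then obtain w where w: "w \<in> K s" "z = m s + (1/2) *\<^sub>R w" by (auto simp: M_def)
      have "(1/2) *\<^sub>R w \<in> K s" using w unfolding K_def by (intro macbeath_body_scale cE) auto
      then have "z \<in> E s" using w by (simp add: K_def macbeath_body_def)
      then show "z \<in> cball 0 R" using EB[OF s] by simp
    qed
    have clM: "closed (M s)" for s
      using closed_translation[OF closed_scaling[OF clK[of s], of "1/2"], of "m s"] by (simp add: M_def image_image)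
    have eM: "emeasure lborel (M s) = ennreal ((1/2) ^ DIM('e)) * emeasure lborel (K s)" for s
      unfolding M_def using emeasure_lborel_affine[OF clK, of "m s" "1/2" s] by simp
    define \<mu> where "\<mu> = ennreal ((1/2) ^ DIM('e)) * emeasure lborel (cball (0::'e) r)"
    have \<mu>: "\<mu> > 0" "\<mu> \<le> emeasure lborel (M s)" if "s \<in> S" for s
    proof -
      have "emeasure lborel (cball (0::'e) r) \<noteq> 0"
        using r unit_ball_vol_pos[of "real DIM('e)"] by (simp add: emeasure_cball less_imp_neq[THEN not_sym])
      then show "\<mu> > 0" by (simp add: \<mu>_def ennreal_zero_less_mult_iff zero_less_iff_neq_zero)
      show "\<mu> \<le> emeasure lborel (M s)" unfolding \<mu>_def eM
        using ballK[OF that] clK by (intro mult_left_mono emeasure_mono) auto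
    qed
    show "emeasure lborel (\<Union>s\<in>S. ball s r) \<le> ennreal (r ^ DIM('e)) * C"
    proof (cases "S = {}")
      case False
      then have \<mu>0: "\<mu> > 0" using \<mu> by blast
      obtain F where F: "finite F" "F \<subseteq> S" "disjoint_family_on M F"
        and Fmax: "\<And>s. s \<in> S \<Longrightarrow> \<exists>i\<in>F. M s \<inter> M i \<noteq> {}"
        by (rule maximal_disjoint_subfamily[of S M lborel "cball 0 R" \<mu>])
          (use MD clM \<mu> \<mu>0 D in \<open>auto simp: D_def\<close>)
      \<comment> \<open>a product of a ball around the base point with a hyperplane section of a multiple of the body\<close>
      define W where "W i = {s. fst (T s) \<in> cball (x i) (3 * r) \<and> \<beta> *\<^sub>R (b + snd (T s)) \<in> K i}" for i
      have clW: "closed (W i)" for i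
      proof -
        have "W i = (\<lambda>s. fst (T s)) -` cball (x i) (3 * r) \<inter> (\<lambda>s. \<beta> *\<^sub>R (b + snd (T s))) -` K i"
          by (auto simp: W_def)
        then show ?thesis using clK
          by (simp, intro closed_Int continuous_closed_vimage continuous_intros)
            (use contT in \<open>auto intro!: continuous_intros simp: continuous_on_eq_continuous_at\<close>)
      qed
      have cover: "(\<Union>s\<in>S. ball s r) \<subseteq> (\<Union>i\<in>F. W i)"
      proof clarify
        fix s s' assume s: "s \<in> S" and s': "s' \<in> ball s r"
        obtain i where i: "i \<in> F" "M s \<inter> M i \<noteq> {}" using Fmax[OF s] by blast
        then have iS: "i \<in> S" using F by auto
        obtain z where z: "z \<in> M s" "z \<in> M i" using i by auto
        have h: "0 \<le> r\<^sup>2 / 2" by simp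
        note ov = macbeath_overlap[OF xB[OF iS] xB[OF s] h msub[OF iS], where z = z and ?m2.0 = "m s",
            folded E_def, folded K_def, OF z(2)[unfolded M_iff] z(1)[unfolded M_iff]]
        have near: "norm (x i - x s) \<le> 2 * r"
        proof (cases "x i = x s")
          case False
          define a where "a = x i - x s"
          have a: "norm a > 0" using False by (simp add: a_def)
          have "\<bar>a \<bullet> ((r / norm a) *\<^sub>R a)\<bar> \<le> 4 * (r\<^sup>2 / 2)"
            unfolding a_def by (rule ov(1), rule ballK[OF iS]) (use r in simp)
          moreover have e: "a \<bullet> ((r / norm a) *\<^sub>R a) = r * norm a"
            using a by (simp add: power2_norm_eq_inner[symmetric] power2_eq_square)
          ultimately have "\<bar>r * norm a\<bar> \<le> 4 * (r\<^sup>2 / 2)" by (simp only: e)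
          then have "r * norm a \<le> r * (2 * r)" using r by (simp add: power2_eq_square)
          then show ?thesis using r by (simp add: a_def)
        qed (use r in simp)
        have ss: "norm (s' - s) < r" using s' by (simp add: dist_norm norm_minus_commute)
        have "norm (x i - fst (T s')) \<le> norm (x i - x s) + norm (fst (T s') - fst (T s))"
          unfolding x_def by (metis dist_commute dist_norm dist_triangle)
        then have 1: "fst (T s') \<in> cball (x i) (3 * r)" using near Td(1)[of s' s] ss by (simp add: dist_norm)
        have A: "(1/16) *\<^sub>R ((\<tau>/2) *\<^sub>R (b + snd (T s))) \<in> K i" by (rule ov(2)[OF segK[OF s]])
        have Bk: "snd (T s') - snd (T s) \<in> K i" using Td(2)[of s' s] ss by (intro ballK iS) simp
        have "(32 / (32 + \<tau>)) *\<^sub>R ((1/16) *\<^sub>R ((\<tau>/2) *\<^sub>R (b + snd (T s)))) + \<beta> *\<^sub>R (snd (T s') - snd (T s)) \<in> K i"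
          using \<tau> \<beta> A Bk unfolding K_def
          by (intro macbeath_body_add cE) (auto simp: \<beta>_def simp flip: add_divide_distrib)
        moreover have "(32 / (32 + \<tau>)) *\<^sub>R ((1/16) *\<^sub>R ((\<tau>/2) *\<^sub>R (b + snd (T s)))) + \<beta> *\<^sub>R (snd (T s') - snd (T s))
            = \<beta> *\<^sub>R (b + snd (T s'))"
        proof -
          have "32 / (32 + \<tau>) * (1/16 * (\<tau>/2)) = \<beta>" using \<tau> by (simp add: \<beta>_def frac_eq_eq)
          then show ?thesis by (simp only: scaleR_scaleR) (simp add: algebra_simps)
        qed
        ultimately show "s' \<in> (\<Union>i\<in>F. W i)" using 1 i by (auto simp: W_def)
      qed
      have measW: "emeasure lborel (W i) \<le> ennreal (r ^ DIM('e)) * (ennreal (3 ^ DIM('e)) * \<omega> * ennreal ((4 / \<beta>) ^ DIM('e))) * emeasure lborel (M i)"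
        if i: "i \<in> F" for i
      proof (cases "W i = {}")
        case False
        then obtain a where a: "a \<in> W i" by auto
        define L where "L = (\<lambda>(s, t). T s + (0, t *\<^sub>R b))"
        have contL: "continuous_on UNIV L" unfolding L_def split_def
          by (intro continuous_intros continuous_on_compose2[OF contT]) auto
        define Q where "Q = (\<lambda>w. 0 + (2 / \<beta>) *\<^sub>R w) ` K i"
        have clQ: "closed Q" unfolding Q_def using closed_scaling[OF clK, of "2/\<beta>"] by simp
        have Q: "y \<in> Q" if "(\<beta>/2) *\<^sub>R y \<in> K i" for y
          unfolding Q_def using that \<beta> by (auto intro!: rev_image_eqI)
        obtain a' where a': "T a' = (0, snd (T a))"
        proof -
          have "(0, snd (T a)) \<in> range T" using rangeI[of T a] unfolding rng by simp
          then show ?thesis using that by auto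
        qed
        \<comment> \<open>for $y$ and a fixed $a$ in the section, the body contains the average of $\beta(b + y)$ and
          $(t-1)\beta(b + a)$: the slice at height $t$ contains the section translated by $(t-1)a$\<close>
        have "emeasure lborel (W i) \<le> emeasure lborel (L -` (cball (x i) (3 * r) \<times> Q))"
        proof (rule emeasure_le_sheared_slab[OF _ clW])
          show "closed (L -` (cball (x i) (3 * r) \<times> Q))"
            by (intro continuous_closed_vimage closed_Times clQ closed_cball)
              (use contL in \<open>auto simp: continuous_on_eq_continuous_at\<close>)
          fix s and t :: real assume s: "s \<in> W i" and t: "t \<in> {1..2}"
          have Ts: "T (s + (t - 1) *\<^sub>R a') = T s + (t - 1) *\<^sub>R (0, snd (T a))"
            by (simp only: linear_add[OF T(1)] linear_scale[OF T(1)] a')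
          have t1: "1/2 + (t - 1)/2 \<le> 1" using t by (simp add: field_simps)
          have "(1/2) *\<^sub>R (\<beta> *\<^sub>R (b + snd (T s))) + ((t - 1)/2) *\<^sub>R (\<beta> *\<^sub>R (b + snd (T a))) \<in> K i"
            using s a t t1 unfolding K_def by (intro macbeath_body_add cE) (auto simp: W_def K_def)
          moreover have "(1/2) *\<^sub>R (\<beta> *\<^sub>R (b + snd (T s))) + ((t - 1)/2) *\<^sub>R (\<beta> *\<^sub>R (b + snd (T a)))
              = (\<beta>/2) *\<^sub>R (snd (T s) + (t - 1) *\<^sub>R snd (T a) + t *\<^sub>R b)"
            by (rule euclidean_eqI, simp only: inner_add_left inner_scaleR_left, simp add: field_simps)
          ultimately have "snd (T s) + (t - 1) *\<^sub>R snd (T a) + t *\<^sub>R b \<in> Q" by (intro Q) simp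
          then show "(s + (t - 1) *\<^sub>R a', t) \<in> L -` (cball (x i) (3 * r) \<times> Q)"
            using s by (simp add: L_def Ts mem_Times_iff W_def)
        qed
        also have "\<dots> = emeasure (distr lborel borel L) (cball (x i) (3 * r) \<times> Q)"
          using contL clQ by (subst emeasure_distr) (auto intro!: borel_measurable_continuous_onI borel_closed closed_Times)
        also have "\<dots> = emeasure lborel (cball (x i) (3 * r)) * emeasure lborel Q"
        proof -
          have "emeasure (distr lborel borel L) (cball (x i) (3 * r) \<times> Q)
              = emeasure (lborel \<Otimes>\<^sub>M lborel) (cball (x i) (3 * r) \<times> Q)"
            unfolding lborel_prod L_def L ..
          then show ?thesis using clQ by (simp only:) (subst lborel.emeasure_pair_measure_Times, auto)
        qed
        also have "\<dots> = ennreal ((3 * r) ^ DIM('e)) * \<omega> * (ennreal ((2 / \<beta>) ^ DIM('e)) * (ennreal (2 ^ DIM('e)) * emeasure lborel (M i)))"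
        proof -
          have "ennreal (2 ^ DIM('e)) * ennreal ((1/2) ^ DIM('e)) = 1"
            by (simp flip: ennreal_mult power_mult_distrib)
          then have "ennreal (2 ^ DIM('e)) * emeasure lborel (M i) = emeasure lborel (K i)"
            unfolding eM by (simp flip: mult.assoc)
          then show ?thesis unfolding Q_def emeasure_lborel_affine[OF clK] \<omega>_def
            using r \<beta> by (subst emeasure_cball_scale) auto
        qed
        also have "\<dots> = ennreal (r ^ DIM('e)) * (ennreal (3 ^ DIM('e)) * \<omega> * ennreal ((4 / \<beta>) ^ DIM('e))) * emeasure lborel (M i)"
        proof -
          have "ennreal ((4 / \<beta>) ^ DIM('e)) = ennreal ((2 / \<beta>) ^ DIM('e)) * ennreal (2 ^ DIM('e))"
            using \<beta> by (simp flip: ennreal_mult power_mult_distrib)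
          moreover have "ennreal ((3 * r) ^ DIM('e)) = ennreal (3 ^ DIM('e)) * ennreal (r ^ DIM('e))"
            using r by (simp add: power_mult_distrib flip: ennreal_mult)
          ultimately show ?thesis by (simp only: mult.assoc mult.commute mult.left_commute)
        qed
        finally show ?thesis .
      qed simp
      have "emeasure lborel (\<Union>s\<in>S. ball s r) \<le> emeasure lborel (\<Union>i\<in>F. W i)"
        using cover clW F by (intro emeasure_mono) auto
      also have "\<dots> \<le> (\<Sum>i\<in>F. emeasure lborel (W i))"
        using clW F by (intro emeasure_subadditive_finite) auto
      also have "\<dots> \<le> (\<Sum>i\<in>F. ennreal (r ^ DIM('e)) * (ennreal (3 ^ DIM('e)) * \<omega> * ennreal ((4 / \<beta>) ^ DIM('e))) * emeasure lborel (M i))"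
        by (intro sum_mono measW)
      also have "\<dots> = ennreal (r ^ DIM('e)) * (ennreal (3 ^ DIM('e)) * \<omega> * ennreal ((4 / \<beta>) ^ DIM('e))) * emeasure lborel (\<Union>i\<in>F. M i)"
        using F clM by (subst sum_emeasure[symmetric]) (auto simp: sum_distrib_left)
      also have "\<dots> \<le> ennreal (r ^ DIM('e)) * (ennreal (3 ^ DIM('e)) * \<omega> * ennreal ((4 / \<beta>) ^ DIM('e))) * D"
        unfolding D_def using F MD by (intro mult_left_mono emeasure_mono) auto
      finally show ?thesis by (simp add: C_def mult.assoc)
    qed simp
  qed
qed

section \<open>Subdifferentials of differences of convex functions\<close>

lemma compact_continuous_abs_bound:
  fixes h :: "'a::topological_space \<Rightarrow> real"
  assumes "continuous_on S h" "compact S"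
  obtains c where "\<And>x. x \<in> S \<Longrightarrow> \<bar>h x\<bar> \<le> c"
proof -
  have "bounded (h ` S)" by (intro compact_imp_bounded compact_continuous_image assms)
  then obtain c where c: "\<forall>y\<in>h ` S. norm y \<le> c" unfolding bounded_iff by blast
  then have "\<bar>h x\<bar> \<le> c" if "x \<in> S" for x using that by force
  then show ?thesis by (rule that)
qed

text \<open>Separate the epigraph from the ray below the point of the graph over \<open>x\<close>. The separating functional is not
  horizontal because \<open>x\<close> is an interior point.\<close>

lemma subdiff_nonempty:
  fixes q :: "'e::euclidean_space \<Rightarrow> real"
  assumes q: "convex_on N q" and x: "x \<in> interior N"
  shows "subdiff N q x \<noteq> {}"
proof -
  let ?T = "{x} \<times> {..<q x}"
  have xN: "x \<in> N" using x interior_subset by blast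
  have "convex (epigraph N q)" using q by (rule convex_epigraphI)
  moreover have "convex ?T" by (intro convex_Times) auto
  moreover have "(x, q x) \<in> epigraph N q" "(x, q x - 1) \<in> ?T" using xN by (auto simp: epigraph_def)
  moreover have "?T \<inter> epigraph N q = {}" by (auto simp: epigraph_def)
  ultimately obtain a \<beta> where a: "a \<noteq> 0" "\<And>z. z \<in> ?T \<Longrightarrow> a \<bullet> z \<le> \<beta>" "\<And>z. z \<in> epigraph N q \<Longrightarrow> a \<bullet> z \<ge> \<beta>"
    using separating_hyperplane_sets[of ?T "epigraph N q"] by (metis empty_iff)
  obtain a1 a2 where a12: "a = (a1, a2)" by (cases a)
  have T: "a1 \<bullet> x + a2 * t \<le> \<beta>" if "t < q x" for t using a(2)[of "(x, t)"] that by (simp add: a12 inner_prod_def)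
  have Ep: "\<beta> \<le> a1 \<bullet> y + a2 * q y" if "y \<in> N" for y
    using a(3)[of "(y, q y)"] that by (simp add: a12 inner_prod_def epigraph_def)
  have a2: "a2 \<ge> 0" using T[of "q x - 1"] Ep[OF xN] by (simp add: algebra_simps)
  have \<beta>: "a1 \<bullet> x + a2 * q x \<le> \<beta>"
  proof (rule field_le_epsilon)
    fix e :: real assume e: "e > 0"
    have "a1 \<bullet> x + a2 * (q x - e / (a2 + 1)) \<le> \<beta>" using a2 e by (intro T) simp
    moreover have "a2 * (e / (a2 + 1)) \<le> e" using a2 e by (simp add: field_simps)
    ultimately show "a1 \<bullet> x + a2 * q x \<le> \<beta> + e" by (simp add: right_diff_distrib)
  qed
  have "a2 \<noteq> 0"
  proof
    assume 0: "a2 = 0"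
    then have a1: "a1 \<noteq> 0" using a(1) a12 by (auto simp: zero_prod_def)
    obtain r where r: "r > 0" "cball x r \<subseteq> N" using x mem_interior_cball by blast
    have "x - (r / norm a1) *\<^sub>R a1 \<in> N" using r a1 by (auto simp: dist_norm)
    then have "\<beta> \<le> a1 \<bullet> (x - (r / norm a1) *\<^sub>R a1)" using Ep 0 by force
    then have "(r / norm a1) * (a1 \<bullet> a1) \<le> 0" using \<beta> 0 by (simp add: inner_diff_right)
    moreover have "(r / norm a1) * (a1 \<bullet> a1) > 0" using r a1 by simp
    ultimately show False by simp
  qed
  then have a2: "a2 > 0" using a2 by simp
  have "(- 1 / a2) *\<^sub>R a1 \<in> subdiff N q x"
    unfolding approx_subdiff_def
  proof clarify
    fix y assume "y \<in> N"
    then have "a1 \<bullet> x + a2 * q x \<le> a1 \<bullet> y + a2 * q y" using Ep \<beta> by force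
    then show "q x + ((- 1 / a2) *\<^sub>R a1) \<bullet> (y - x) \<le> q y + 0"
      using a2 by (simp add: field_simps inner_diff_right)
  qed
  then show ?thesis by blast
qed

text \<open>Here \<open>p\<close> need not be differentiable at \<open>x\<close>. Along a segment from \<open>x\<close> to \<open>y\<close> the difference
  quotients of $p = f + q$ are at most $p(y) - p(x)$ by convexity, and in the limit at least the value of $g + v$ on $y - x$.\<close>

lemma gderiv_add_subgradient:
  fixes p q :: "'e::euclidean_space \<Rightarrow> real"
  assumes p: "convex_on N p" and v: "v \<in> subdiff N q x" and x: "x \<in> N"
    and f: "\<And>y. y \<in> N \<Longrightarrow> f y = p y - q y" and g: "GDERIV f x :> g"
  shows "g + v \<in> subdiff N p x"
  unfolding approx_subdiff_def
proof clarify
  fix y assume y: "y \<in> N"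
  define d where "d = y - x"
  have line: "x + t *\<^sub>R d \<in> N" "p (x + t *\<^sub>R d) \<le> p x + t * (p y - p x)" if "0 < t" "t < 1" for t
  proof -
    have eq: "x + t *\<^sub>R d = (1 - t) *\<^sub>R x + t *\<^sub>R y" by (simp add: d_def algebra_simps)
    have cN: "convex N" using p by (rule convex_on_imp_convex)
    show "x + t *\<^sub>R d \<in> N" unfolding eq using that x y by (intro convexD[OF cN]) auto
    have "p ((1 - t) *\<^sub>R x + t *\<^sub>R y) \<le> (1 - t) * p x + t * p y"
      using convex_onD[OF p, of t x y] that x y by simp
    then show "p (x + t *\<^sub>R d) \<le> p x + t * (p y - p x)" unfolding eq by (simp add: algebra_simps)
  qed
  have "((\<lambda>t. x + t *\<^sub>R d) has_derivative (\<lambda>t. t *\<^sub>R d)) (at 0)"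
    by (auto intro!: derivative_eq_intros)
  moreover have "(f has_derivative (\<lambda>h. h \<bullet> g)) (at (x + 0 *\<^sub>R d))" using g by (simp add: gderiv_def)
  ultimately have "((\<lambda>t. f (x + t *\<^sub>R d)) has_derivative (\<lambda>t. (t *\<^sub>R d) \<bullet> g)) (at 0)"
    by (rule has_derivative_compose)
  then have "((\<lambda>t. f (x + t *\<^sub>R d)) has_real_derivative (d \<bullet> g)) (at 0)"
    by (simp add: has_field_derivative_def mult.commute[of _ "d \<bullet> g"])
  then have "((\<lambda>t. (f (x + t *\<^sub>R d) - f x) / t) \<longlongrightarrow> d \<bullet> g) (at 0)"
    by (simp add: DERIV_def)
  then have lim: "((\<lambda>t. (f (x + t *\<^sub>R d) - f x) / t) \<longlongrightarrow> d \<bullet> g) (at_right 0)"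
    by (rule filterlim_mono) (auto simp: at_le)
  have "eventually (\<lambda>t::real. t \<in> {0<..<1}) (at_right 0)" by (rule eventually_at_right_real) simp
  then have "\<forall>\<^sub>F t in at_right 0. (f (x + t *\<^sub>R d) - f x) / t \<le> p y - p x - v \<bullet> d"
  proof eventually_elim
    case (elim t)
    have "q x + v \<bullet> (t *\<^sub>R d) \<le> q (x + t *\<^sub>R d)"
      using v line(1)[of t] elim by (force simp: approx_subdiff_def)
    then have "f (x + t *\<^sub>R d) - f x \<le> t * (p y - p x) - t * (v \<bullet> d)"
      using f[of "x + t *\<^sub>R d"] f[OF x] line[of t] elim by simp
    then show ?case using elim by (simp add: field_simps)
  qed
  from tendsto_upperbound[OF lim this] have "d \<bullet> g \<le> p y - p x - v \<bullet> d" by simp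
  then show "p x + (g + v) \<bullet> (y - x) \<le> p y + 0"
    by (simp add: inner_add_left inner_commute[of g] d_def)
qed

lemma subdiff_mono: "B \<subseteq> N \<Longrightarrow> subdiff N p x \<subseteq> subdiff B p x"
  by (auto simp: approx_subdiff_def)

lemma subdiff_closed_graph:
  assumes "\<And>i. u i \<in> subdiff N p (x i)" "u \<longlonglongrightarrow> u'" "x \<longlonglongrightarrow> x'" "isCont p x'"
  shows "u' \<in> subdiff N p x'"
  unfolding approx_subdiff_def
proof clarify
  fix y assume y: "y \<in> N"
  have "(\<lambda>i. p (x i) + u i \<bullet> (y - x i)) \<longlonglongrightarrow> p x' + u' \<bullet> (y - x')"
    by (intro tendsto_intros assms isCont_tendsto_compose[OF assms(4)])
  moreover have "p (x i) + u i \<bullet> (y - x i) \<le> p y + 0" for i using assms(1)[of i] y by (auto simp: approx_subdiff_def)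
  ultimately show "p x' + u' \<bullet> (y - x') \<le> p y + 0" by (intro LIMSEQ_le_const2) auto
qed

lemma convex_isCont_interior:
  fixes p :: "'e::euclidean_space \<Rightarrow> real"
  assumes "convex_on N p"
  shows "continuous_on (interior N) p" "x \<in> interior N \<Longrightarrow> isCont p x"
proof -
  have "convex_on (interior N) p" using assms interior_subset convex_interior convex_on_imp_convex
    by (metis convex_on_subset)
  then show "continuous_on (interior N) p" by (intro convex_on_continuous) auto
  then show "x \<in> interior N \<Longrightarrow> isCont p x" by (simp add: continuous_on_eq_continuous_at)
qed

text \<open>Near an interior point the subgradients of \<open>q\<close> are bounded, so a subsequence of chosen ones converges;
  adding them to the gradients of \<open>f\<close> gives a convergent sequence of subgradients of \<open>p\<close>.\<close>

lemma gderiv_limit_subgradients: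
  fixes p q :: "'e::euclidean_space \<Rightarrow> real"
  assumes p: "convex_on N p" and q: "convex_on N q" and x: "x \<in> interior N"
    and f: "\<And>y. y \<in> N \<Longrightarrow> f y = p y - q y"
    and xs: "xs \<longlonglongrightarrow> x" and g: "\<And>i. GDERIV f (xs i) :> gs i" "gs \<longlonglongrightarrow> g"
  shows "\<exists>u\<in>subdiff N p x. \<exists>v\<in>subdiff N q x. g = u - v"
proof -
  obtain r0 where r0: "r0 > 0" "cball x r0 \<subseteq> interior N" using x open_contains_cball open_interior by metis
  define \<rho> where "\<rho> = r0 / 2"
  have \<rho>: "\<rho> > 0" "cball x (2 * \<rho>) \<subseteq> interior N" using r0 by (auto simp: \<rho>_def)
  have sub: "cball x (2 * \<rho>) \<subseteq> N" using \<rho> interior_subset by blast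
  have "\<forall>\<^sub>F i in sequentially. xs i \<in> ball x \<rho>" using xs \<rho> by (auto simp: tendsto_iff dist_commute)
  then obtain k where k: "\<And>i. i \<ge> k \<Longrightarrow> xs i \<in> ball x \<rho>" by (auto simp: eventually_sequentially)
  define ys where "ys i = xs (i + k)" for i
  have ys: "ys i \<in> ball x \<rho>" for i using k by (simp add: ys_def)
  have ysN: "ys i \<in> interior N" for i using ys[of i] \<rho> by (auto simp: subset_iff)
  have "\<exists>v. v \<in> subdiff N q (ys i)" for i using subdiff_nonempty[OF q ysN] by blast
  then obtain vs where vs: "\<And>i. vs i \<in> subdiff N q (ys i)" by metis
  obtain c where c: "\<And>y. y \<in> cball x (2 * \<rho>) \<Longrightarrow> \<bar>q y\<bar> \<le> c"
    by (rule compact_continuous_abs_bound[OF continuous_on_subset[OF convex_isCont_interior(1)[OF q] \<rho>(2)] compact_cball])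
      (rule that, assumption)
  have "norm (vs i) \<le> (2 * c + 0) / \<rho>" for i
  proof (rule approx_subdiff_bounded)
    show "cball (ys i) \<rho> \<subseteq> cball x (2 * \<rho>)" using ys[of i] by (intro cball_subset_cball_iff[THEN iffD2]) (auto simp: dist_commute)
    show "vs i \<in> subdiff (cball x (2 * \<rho>)) q (ys i)" using vs subdiff_mono[OF sub] by blast
  qed (use \<rho> c in auto)
  then have "bounded (range vs)" by (auto simp: bounded_iff)
  then obtain v \<phi> where \<phi>: "strict_mono \<phi>" "(vs \<circ> \<phi>) \<longlonglongrightarrow> v" using bounded_imp_convergent_subsequence by metis
  have yl: "(ys \<circ> \<phi>) \<longlonglongrightarrow> x" unfolding ys_def o_def
    using LIMSEQ_subseq_LIMSEQ[OF LIMSEQ_ignore_initial_segment[OF xs] \<phi>(1)] by (simp add: o_def)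
  have gl: "(\<lambda>i. gs (\<phi> i + k)) \<longlonglongrightarrow> g"
    using LIMSEQ_subseq_LIMSEQ[OF LIMSEQ_ignore_initial_segment[OF g(2)] \<phi>(1)] by (simp add: o_def)
  have "v \<in> subdiff N q x"
    using subdiff_closed_graph[of "vs \<circ> \<phi>" N q "ys \<circ> \<phi>"] vs \<phi> yl convex_isCont_interior(2)[OF q x] by (simp add: o_def)
  moreover have "g + v \<in> subdiff N p x"
  proof (rule subdiff_closed_graph)
    show "gs (\<phi> i + k) + (vs \<circ> \<phi>) i \<in> subdiff N p ((ys \<circ> \<phi>) i)" for i
      unfolding o_def using ysN interior_subset g(1)
      by (intro gderiv_add_subgradient[OF p vs _ f]) (auto simp: ys_def)
    show "(\<lambda>i. gs (\<phi> i + k) + (vs \<circ> \<phi>) i) \<longlonglongrightarrow> g + v" by (intro tendsto_add gl \<phi>)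
  qed (use yl convex_isCont_interior(2)[OF p x] in \<open>auto simp: o_def\<close>)
  ultimately show ?thesis by (metis add_diff_cancel_right')
qed

text \<open>An affine function that supports the smaller function at a contact point also supports the larger one.\<close>

lemma subdiff_le_at_contact:
  assumes "\<And>y. y \<in> N \<Longrightarrow> q y \<le> p y" "q x = p x"
  shows "subdiff N q x \<subseteq> subdiff N p x"
  using assms by (fastforce simp: approx_subdiff_def intro: order_trans)

section \<open>Continuously differentiable maps\<close>

lemma has_derivative_imp_C1:
  assumes "\<And>x. x \<in> S \<Longrightarrow> (h has_derivative D x) (at x)" "\<And>v. continuous_on S (\<lambda>x. D x v)"
  shows "Ck_on 1 h S"
  unfolding One_nat_def Ck_on.simps
proof (intro conjI ballI allI)
  fix x assume "x \<in> S" then show "h differentiable at x" using assms(1) differentiable_def by blast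
next
  fix v
  have "frechet_derivative h (at x) v = D x v" if "x \<in> S" for x
    using frechet_derivative_at[OF assms(1)[OF that]] by simp
  then show "continuous_on S (\<lambda>x. frechet_derivative h (at x) v)"
    using assms(2)[of v] by (simp cong: continuous_on_cong)
qed

lemma C1_has_derivative:
  "Ck_on 1 h S \<Longrightarrow> x \<in> S \<Longrightarrow> (h has_derivative frechet_derivative h (at x)) (at x)"
  by (simp add: frechet_derivative_works)

lemma C1_frechet_continuous: "Ck_on 1 h S \<Longrightarrow> continuous_on S (\<lambda>x. frechet_derivative h (at x) v)"
  by simp

lemma C1_continuous_on: "Ck_on 1 h S \<Longrightarrow> continuous_on S h"
  by (intro continuous_at_imp_continuous_on ballI differentiable_imp_continuous_within) simp

lemma C1_cong:
  assumes "Ck_on 1 h S" "open S" "\<And>x. x \<in> S \<Longrightarrow> h x = k x"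
  shows "Ck_on 1 k S"
  by (rule has_derivative_imp_C1[OF has_derivative_transform_within_open[OF C1_has_derivative[OF assms(1)] assms(2)]
      C1_frechet_continuous[OF assms(1)]]) (use assms(3) in auto)

lemma C1_subset: "Ck_on 1 h S \<Longrightarrow> U \<subseteq> S \<Longrightarrow> Ck_on 1 h U"
  by (auto intro: continuous_on_subset)

lemma linear_eq_sum_Basis:
  fixes h :: "'a::euclidean_space \<Rightarrow> 'b::real_vector"
  assumes "linear h" shows "h w = (\<Sum>i\<in>Basis. (w \<bullet> i) *\<^sub>R h i)"
proof -
  have "h w = h (\<Sum>i\<in>Basis. (w \<bullet> i) *\<^sub>R i)" by (simp add: euclidean_representation)
  then show ?thesis using assms by (simp add: linear_sum linear_scale)
qed

lemma C1_compose:
  fixes h :: "'a::euclidean_space \<Rightarrow> 'b::euclidean_space"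
  assumes h: "Ck_on 1 h S" and k: "Ck_on 1 k U" and sub: "\<And>x. x \<in> S \<Longrightarrow> h x \<in> U"
  shows "Ck_on 1 (\<lambda>x. k (h x)) S"
proof (rule has_derivative_imp_C1)
  fix x assume x: "x \<in> S"
  show "((\<lambda>x. k (h x)) has_derivative (\<lambda>v. frechet_derivative k (at (h x)) (frechet_derivative h (at x) v))) (at x)"
    using diff_chain_at[OF C1_has_derivative[OF h x] C1_has_derivative[OF k sub[OF x]]] by (simp add: o_def)
next
  fix v
  have lin: "linear (frechet_derivative k (at y))" if "y \<in> U" for y
    using C1_has_derivative[OF k that] by (rule has_derivative_linear)
  have "continuous_on S (\<lambda>x. \<Sum>i\<in>Basis. (frechet_derivative h (at x) v \<bullet> i) *\<^sub>R frechet_derivative k (at (h x)) i)"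
    using sub by (intro continuous_intros C1_frechet_continuous[OF h]
      continuous_on_compose2[OF C1_frechet_continuous[OF k] C1_continuous_on[OF h]]) auto
  then show "continuous_on S (\<lambda>x. frechet_derivative k (at (h x)) (frechet_derivative h (at x) v))"
    using linear_eq_sum_Basis[OF lin] sub by (simp cong: continuous_on_cong)
qed

lemma C1_linear: "linear h \<Longrightarrow> Ck_on 1 h S"
  for h :: "'a::euclidean_space \<Rightarrow> 'b::real_normed_vector"
  by (rule has_derivative_imp_C1[where D = "\<lambda>_. h"])
    (auto intro: bounded_linear_imp_has_derivative simp: linear_conv_bounded_linear)

lemma C1_const: "Ck_on 1 (\<lambda>x. c) S"
  by (rule has_derivative_imp_C1[where D = "\<lambda>_ _. 0"]) auto

lemma C1_fst: "Ck_on 1 fst S" and C1_snd: "Ck_on 1 snd S"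
  by (intro C1_linear bounded_linear.linear bounded_linear_fst bounded_linear_snd)+

lemma C1_Pair: "Ck_on 1 h S \<Longrightarrow> Ck_on 1 k S \<Longrightarrow> Ck_on 1 (\<lambda>x. (h x, k x)) S"
  by (rule has_derivative_imp_C1[where D = "\<lambda>x v. (frechet_derivative h (at x) v, frechet_derivative k (at x) v)"])
    (auto intro!: has_derivative_Pair C1_has_derivative continuous_intros C1_frechet_continuous simp del: Ck_on.simps One_nat_def)

lemma C1_add: "Ck_on 1 h S \<Longrightarrow> Ck_on 1 k S \<Longrightarrow> Ck_on 1 (\<lambda>x. h x + k x) S"
  by (rule has_derivative_imp_C1[where D = "\<lambda>x v. frechet_derivative h (at x) v + frechet_derivative k (at x) v"])
    (auto intro!: has_derivative_add C1_has_derivative continuous_intros C1_frechet_continuous simp del: Ck_on.simps One_nat_def)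

lemma C1_sum:
  assumes "finite I" "\<And>i. i \<in> I \<Longrightarrow> Ck_on 1 (h i) S"
  shows "Ck_on 1 (\<lambda>x. \<Sum>i\<in>I. h i x) S"
  using assms by (induction I rule: finite_induct) (auto intro!: C1_add C1_const simp del: Ck_on.simps One_nat_def)

lemma C1_scaleR:
  fixes h :: "'a::euclidean_space \<Rightarrow> real"
  assumes h: "Ck_on 1 h S" and k: "Ck_on 1 k S"
  shows "Ck_on 1 (\<lambda>x. h x *\<^sub>R k x) S"
  by (rule has_derivative_imp_C1[OF has_derivative_scaleR[OF C1_has_derivative[OF h] C1_has_derivative[OF k]]])
    (auto intro!: continuous_intros C1_frechet_continuous[OF h] C1_frechet_continuous[OF k] C1_continuous_on[OF h] C1_continuous_on[OF k] simp del: Ck_on.simps One_nat_def)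

lemma C1_inner:
  fixes h k :: "'a::euclidean_space \<Rightarrow> 'b::real_inner"
  assumes h: "Ck_on 1 h S" and k: "Ck_on 1 k S"
  shows "Ck_on 1 (\<lambda>x. h x \<bullet> k x) S"
  by (rule has_derivative_imp_C1[OF has_derivative_inner[OF C1_has_derivative[OF h] C1_has_derivative[OF k]]])
    (auto intro!: continuous_intros C1_frechet_continuous[OF h] C1_frechet_continuous[OF k] C1_continuous_on[OF h] C1_continuous_on[OF k] simp del: Ck_on.simps One_nat_def)

lemma C1_inverse:
  fixes h :: "'a::euclidean_space \<Rightarrow> real"
  assumes h: "Ck_on 1 h S" and nz: "\<And>x. x \<in> S \<Longrightarrow> h x \<noteq> 0"
  shows "Ck_on 1 (\<lambda>x. inverse (h x)) S"
  by (rule has_derivative_imp_C1[OF Deriv.has_derivative_inverse[OF nz C1_has_derivative[OF h]]])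
    (auto intro!: continuous_intros C1_frechet_continuous[OF h] nz C1_continuous_on[OF h] simp del: Ck_on.simps One_nat_def)

lemma smooth_imp_C1: "smooth_on h S \<Longrightarrow> Ck_on 1 h S"
  by (simp add: smooth_on_def)

lemma smooth_frechet_C1: "smooth_on h S \<Longrightarrow> Ck_on 1 (\<lambda>x. frechet_derivative h (at x) v) S"
  unfolding smooth_on_def by (metis Ck_on.simps(2))

text \<open>On a compact ball the partial derivatives are bounded, hence so is the operator norm of the derivative.\<close>

lemma C1_locally_lipschitz:
  fixes h :: "'a::euclidean_space \<Rightarrow> 'b::real_normed_vector"
  assumes "open S" and h: "Ck_on 1 h S"
  shows "locally_lipschitz_on h S"
  unfolding locally_lipschitz_on_def
proof
  fix x assume "x \<in> S"
  then obtain r where r: "r > 0" "cball x r \<subseteq> S" using assms(1) open_contains_cball by blast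
  have "\<exists>c. \<forall>y\<in>cball x r. norm (frechet_derivative h (at y) i) \<le> c" for i
  proof -
    have "compact ((\<lambda>y. frechet_derivative h (at y) i) ` cball x r)"
      using r C1_frechet_continuous[OF h] by (intro compact_continuous_image) (auto intro: continuous_on_subset)
    then have "bounded ((\<lambda>y. frechet_derivative h (at y) i) ` cball x r)" by (rule compact_imp_bounded)
    then show ?thesis by (auto simp: bounded_iff simp del: mem_cball)
  qed
  then obtain c where c: "\<And>i y. y \<in> cball x r \<Longrightarrow> norm (frechet_derivative h (at y) i) \<le> c i" by metis
  define L where "L = (\<Sum>i\<in>Basis. c i)"
  have L: "onorm (frechet_derivative h (at y)) \<le> L" if y: "y \<in> cball x r" for y
  proof -
    have "y \<in> S" using r y by blast
    then have "bounded_linear (frechet_derivative h (at y))"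
      using C1_has_derivative[OF h] has_derivative_bounded_linear by blast
    then have "onorm (frechet_derivative h (at y)) \<le> (\<Sum>i\<in>Basis. norm (frechet_derivative h (at y) i))"
      by (rule onorm_componentwise)
    also have "\<dots> \<le> L" unfolding L_def by (intro sum_mono c y)
    finally show ?thesis .
  qed
  have "L-lipschitz_on (ball x r \<inter> S) h"
  proof (rule lipschitz_onI)
    have "norm (frechet_derivative h (at x) 0) \<le> c i" for i using c[of x i] r
      by (metis C1_has_derivative \<open>x \<in> S\<close> h has_derivative_bounded_linear linear_simps(3) norm_ge_zero norm_zero centre_in_cball less_imp_le order_trans)
    then have "0 \<le> c i" for i by (meson norm_ge_zero order_trans)
    then show "0 \<le> L" by (simp add: L_def sum_nonneg)
    fix y z assume "y \<in> ball x r \<inter> S" "z \<in> ball x r \<inter> S"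
    then have "norm (h y - h z) \<le> L * norm (y - z)"
      using r by (intro differentiable_bound[OF convex_cball[of x r] _ L])
        (auto intro!: has_derivative_at_withinI C1_has_derivative[OF h] simp del: Ck_on.simps One_nat_def)
    then show "dist (h y) (h z) \<le> L * dist y z" by (simp add: dist_norm)
  qed
  then show "\<exists>r>0. \<exists>L. L-lipschitz_on (ball x r \<inter> S) h" using r by blast
qed

lemma smooth_imp_C11: "open S \<Longrightarrow> smooth_on h S \<Longrightarrow> C11_on h S"
  unfolding C11_on_def using smooth_imp_C1[of h S] smooth_frechet_C1[of h S]
  by (auto intro!: C1_locally_lipschitz)

section \<open>Charts\<close>

lemma chart_of_facts:
  assumes "chart_of X c"
  shows chart_inj: "inj_on (snd c) (fst c)"
    and chart_subset: "fst c \<subseteq> topspace X"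
    and chart_inv_left: "x \<in> fst c \<Longrightarrow> chart_inv c (snd c x) = x"
    and chart_inv_in: "p \<in> snd c ` fst c \<Longrightarrow> chart_inv c p \<in> fst c"
    and chart_inv_right: "p \<in> snd c ` fst c \<Longrightarrow> snd c (chart_inv c p) = p"
    and chart_open_range: "open (snd c ` fst c)"
    and chart_open_preimage: "open W \<Longrightarrow> openin X {x \<in> fst c. snd c x \<in> W}"
    and chart_open_image: "openin X V \<Longrightarrow> open (snd c ` (fst c \<inter> V))"
    and chart_compact_preimage: "compact K \<Longrightarrow> K \<subseteq> snd c ` fst c \<Longrightarrow> compactin X {x \<in> fst c. snd c x \<in> K}"
proof -
  have op: "openin X (fst c)" and hom: "homeomorphic_map (subtopology X (fst c)) (top_of_set (snd c ` fst c)) (snd c)"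
    using assms by (auto simp: chart_of_def)
  show opr: "open (snd c ` fst c)" using assms by (simp add: chart_of_def)
  show sub: "fst c \<subseteq> topspace X" using op by (rule openin_subset)
  show inj: "inj_on (snd c) (fst c)"
    using homeomorphic_imp_injective_map[OF hom] sub by (simp add: topspace_subtopology Int_absorb1)
  show "x \<in> fst c \<Longrightarrow> chart_inv c (snd c x) = x" using inj by (simp add: chart_inv_def)
  show "p \<in> snd c ` fst c \<Longrightarrow> chart_inv c p \<in> fst c" by (simp add: chart_inv_def inv_into_into)
  show "p \<in> snd c ` fst c \<Longrightarrow> snd c (chart_inv c p) = p" by (simp add: chart_inv_def f_inv_into_f)
  show "openin X {x \<in> fst c. snd c x \<in> W}" if W: "open W"
  proof -
    have "openin (top_of_set (snd c ` fst c)) (snd c ` fst c \<inter> W)" using W by (simp add: openin_open_Int)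
    then have "openin (subtopology X (fst c)) {x \<in> topspace (subtopology X (fst c)). snd c x \<in> snd c ` fst c \<inter> W}"
      using homeomorphic_imp_continuous_map[OF hom] openin_continuous_map_preimage by blast
    moreover have "{x \<in> topspace (subtopology X (fst c)). snd c x \<in> snd c ` fst c \<inter> W} = {x \<in> fst c. snd c x \<in> W}"
      using sub by auto
    ultimately show ?thesis using op openin_trans_full by fastforce
  qed
  show "open (snd c ` (fst c \<inter> V))" if V: "openin X V"
  proof -
    have "openin (subtopology X (fst c)) (fst c \<inter> V)" using V openin_subtopology_Int2 by blast
    then have "openin (top_of_set (snd c ` fst c)) (snd c ` (fst c \<inter> V))"
      using homeomorphic_imp_open_map[OF hom] by (simp add: open_map_def)
    then show ?thesis using opr openin_open_trans by blast
  qed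
  show "compactin X {x \<in> fst c. snd c x \<in> K}" if K: "compact K" "K \<subseteq> snd c ` fst c"
  proof -
    have "snd c ` {x \<in> fst c. snd c x \<in> K} = K" using K by auto
    moreover have "compactin (top_of_set (snd c ` fst c)) K" using K by (simp add: compactin_subtopology)
    ultimately have "compactin (subtopology X (fst c)) {x \<in> fst c. snd c x \<in> K}"
      using homeomorphic_map_compactness[OF hom, of "{x \<in> fst c. snd c x \<in> K}"] sub by auto
    then show ?thesis by (simp add: compactin_subtopology)
  qed
qed

lemma chart_ofI:
  assumes op: "\<And>W. open W \<Longrightarrow> openin X {x \<in> U. \<phi> x \<in> W}"
    and inj: "inj_on \<phi> U" and opim: "\<And>V. openin X V \<Longrightarrow> V \<subseteq> U \<Longrightarrow> open (\<phi> ` V)"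
  shows "chart_of X (U, \<phi>)"
proof -
  have U: "openin X U" using op[of UNIV] by simp
  then have sub: "U \<subseteq> topspace X" by (rule openin_subset)
  then have top: "topspace (subtopology X U) = U" by auto
  have opr: "open (\<phi> ` U)" by (rule opim[OF U]) simp
  have "homeomorphic_map (subtopology X U) (top_of_set (\<phi> ` U)) \<phi>"
  proof (rule bijective_open_imp_homeomorphic_map)
    have "openin (subtopology X U) {x \<in> U. \<phi> x \<in> W}" if "openin (top_of_set (\<phi> ` U)) W" for W
    proof -
      have "open W" using that opr openin_open_trans by blast
      then show ?thesis using op[of W] by (auto simp: openin_open_subtopology U)
    qed
    then show "continuous_map (subtopology X U) (top_of_set (\<phi> ` U)) \<phi>"
      unfolding continuous_map_def top by auto
    show "open_map (subtopology X U) (top_of_set (\<phi> ` U)) \<phi>"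
      unfolding open_map_def
    proof clarify
      fix V assume "openin (subtopology X U) V"
      then have "openin X V" "V \<subseteq> U" using U by (auto simp: openin_open_subtopology)
      then have "open (\<phi> ` V)" "\<phi> ` V \<subseteq> \<phi> ` U" using opim by auto
      then show "openin (top_of_set (\<phi> ` U)) (\<phi> ` V)" by (simp add: openin_open_eq opr)
    qed
  qed (use sub inj in \<open>auto simp: Int_absorb1 image_Int_subset\<close>)
  then show ?thesis using U opr by (simp add: chart_of_def)
qed

section \<open>The cotangent bundle of a smooth manifold\<close>

text \<open>The covector at \<open>x\<close> whose coordinate vector in the chart \<open>c\<close> is \<open>w\<close>: its other coordinate vectors
  are the images of \<open>w\<close> under the adjoints of the derivatives of the transitions into \<open>c\<close>.\<close>

definition covector_of :: "('m, 'e::euclidean_space) chart set \<Rightarrow> ('m, 'e) chart \<Rightarrow> 'm \<Rightarrow> 'e \<Rightarrow> ('m, 'e) covector" where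
  "covector_of \<A> c x w = (\<lambda>c'. if c' \<in> \<A> \<and> x \<in> fst c'
     then \<Sum>b\<in>Basis. (w \<bullet> frechet_derivative (transition c' c) (at (snd c' x)) b) *\<^sub>R b else 0)"

text \<open>The transition from \<open>c\<close> to \<open>c'\<close> of the charts induced on the cotangent bundle.\<close>

definition cotangent_transition :: "('m, 'e::euclidean_space) chart \<Rightarrow> ('m, 'e) chart \<Rightarrow> 'e \<times> 'e \<Rightarrow> 'e \<times> 'e" where
  "cotangent_transition c c' = (\<lambda>z. (transition c c' (fst z),
     \<Sum>b\<in>Basis. (snd z \<bullet> frechet_derivative (transition c' c) (at (transition c c' (fst z))) b) *\<^sub>R b))"

lemma fst_cotangent_chart: "z \<in> fst (cotangent_chart \<A> c) \<longleftrightarrow> fst z \<in> fst c \<and> snd z \<in> cotangent_space \<A> (fst z)"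
  by (cases z) (simp add: cotangent_chart_def)

lemma snd_cotangent_chart: "snd (cotangent_chart \<A> c) z = (snd c (fst z), snd z c)"
  by (cases z) (simp add: cotangent_chart_def)

context
  fixes M :: "'m topology" and \<A> :: "('m, 'e::euclidean_space) chart set"
  assumes mfd: "smooth_manifold M \<A>"
begin

lemma atlas_chart_of: "c \<in> \<A> \<Longrightarrow> chart_of M c"
  using mfd by (simp add: smooth_manifold_def)

lemma atlas_openin: "c \<in> \<A> \<Longrightarrow> openin M (fst c)"
  using atlas_chart_of by (auto simp: chart_of_def)

lemma atlas_cover: "x \<in> topspace M \<Longrightarrow> \<exists>c\<in>\<A>. x \<in> fst c"
  using mfd unfolding smooth_manifold_def by blast

lemma open_overlap: "c \<in> \<A> \<Longrightarrow> c' \<in> \<A> \<Longrightarrow> open (overlap c c')"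
  unfolding overlap_def by (intro chart_open_image[OF atlas_chart_of] atlas_openin)

lemma transition_smooth: "c \<in> \<A> \<Longrightarrow> c' \<in> \<A> \<Longrightarrow> smooth_on (transition c c') (overlap c c')"
  using mfd by (simp add: smooth_manifold_def)

lemma atlas_subset_C11_charts: "\<A> \<subseteq> C11_charts M \<A>"
  by (auto simp: C11_charts_def intro!: atlas_chart_of smooth_imp_C11 open_overlap transition_smooth)

lemma transition_apply: "c \<in> \<A> \<Longrightarrow> x \<in> fst c \<Longrightarrow> transition c c' (snd c x) = snd c' x"
  by (simp add: transition_def chart_inv_left[OF atlas_chart_of])

lemma transition_in_overlap: "c \<in> \<A> \<Longrightarrow> p \<in> overlap c c' \<Longrightarrow> transition c c' p \<in> overlap c' c"
  by (auto simp: overlap_def transition_apply)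

lemma transition_has_derivative:
  "c \<in> \<A> \<Longrightarrow> c' \<in> \<A> \<Longrightarrow> x \<in> fst c \<Longrightarrow> x \<in> fst c' \<Longrightarrow>
    (transition c c' has_derivative frechet_derivative (transition c c') (at (snd c x))) (at (snd c x))"
  by (rule C1_has_derivative[OF smooth_imp_C1[OF transition_smooth]]) (auto simp: overlap_def)

lemma transition_derivative_self:
  assumes c: "c \<in> \<A>" "x \<in> fst c"
  shows "frechet_derivative (transition c c) (at (snd c x)) = (\<lambda>v. v)"
proof -
  have "(transition c c has_derivative (\<lambda>v. v)) (at (snd c x))"
    by (rule has_derivative_transform_within_open[OF has_derivative_ident chart_open_range[OF atlas_chart_of[OF c(1)]]])
      (use c in \<open>auto simp: transition_apply\<close>)
  then show ?thesis using frechet_derivative_at by metis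
qed

text \<open>The cocycle identity, which makes \<open>covector_of\<close> satisfy the transformation law.\<close>

lemma transition_derivative_comp:
  assumes c: "c \<in> \<A>" "c' \<in> \<A>" "c'' \<in> \<A>" and x: "x \<in> fst c" "x \<in> fst c'" "x \<in> fst c''"
  shows "frechet_derivative (transition c' c'') (at (snd c' x)) (frechet_derivative (transition c c') (at (snd c x)) v)
    = frechet_derivative (transition c c'') (at (snd c x)) v"
proof -
  let ?D = "\<lambda>c c'. frechet_derivative (transition c c') (at (snd c x))"
  have "(transition c' c'' \<circ> transition c c' has_derivative ?D c' c'' \<circ> ?D c c') (at (snd c x))"
    using diff_chain_at[OF transition_has_derivative[OF c(1,2) x(1,2)]] transition_has_derivative[OF c(2,3) x(2,3)]
    by (simp add: transition_apply c x)
  then have "(transition c c'' has_derivative ?D c' c'' \<circ> ?D c c') (at (snd c x))"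
  proof (rule has_derivative_transform_within_open)
    show "open (snd c ` (fst c \<inter> (fst c' \<inter> fst c'')))"
      by (intro chart_open_image[OF atlas_chart_of] openin_Int atlas_openin c)
  qed (use c x in \<open>auto simp: transition_apply\<close>)
  then show ?thesis using frechet_derivative_at by (metis o_apply)
qed

lemma inner_covector_of:
  assumes "c \<in> \<A>" "x \<in> fst c" "c' \<in> \<A>" "x \<in> fst c'"
  shows "covector_of \<A> c x w c' \<bullet> v = w \<bullet> frechet_derivative (transition c' c) (at (snd c' x)) v"
proof -
  let ?D = "frechet_derivative (transition c' c) (at (snd c' x))"
  have "linear ?D" using transition_has_derivative[OF assms(3,1,4,2)] by (rule has_derivative_linear)
  then have "?D v = (\<Sum>b\<in>Basis. (v \<bullet> b) *\<^sub>R ?D b)" by (rule linear_eq_sum_Basis)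
  then show ?thesis using assms
    by (simp add: covector_of_def inner_sum_left inner_sum_right mult.commute inner_commute[of _ v])
qed

lemma covector_of_in_cotangent_space:
  assumes "c \<in> \<A>" "x \<in> fst c" shows "covector_of \<A> c x w \<in> cotangent_space \<A> x"
  unfolding cotangent_space_def using assms
  by (auto simp: inner_covector_of transition_derivative_comp) (auto simp: covector_of_def)

lemma covector_of_self: "c \<in> \<A> \<Longrightarrow> x \<in> fst c \<Longrightarrow> covector_of \<A> c x w c = w"
  by (rule euclidean_eqI) (simp add: inner_covector_of transition_derivative_self)

lemma cotangent_spaceD:
  assumes "\<xi> \<in> cotangent_space \<A> x" "c \<in> \<A>" "c' \<in> \<A>" "x \<in> fst c" "x \<in> fst c'"
  shows "\<xi> c \<bullet> v = \<xi> c' \<bullet> frechet_derivative (transition c c') (at (snd c x)) v"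
  using assms unfolding cotangent_space_def by blast

lemma cotangent_space_zero: "\<xi> \<in> cotangent_space \<A> x \<Longrightarrow> \<not> (c \<in> \<A> \<and> x \<in> fst c) \<Longrightarrow> \<xi> c = 0"
  unfolding cotangent_space_def by blast

lemma covector_of_eq:
  assumes "\<xi> \<in> cotangent_space \<A> x" "c \<in> \<A>" "x \<in> fst c"
  shows "covector_of \<A> c x (\<xi> c) = \<xi>"
proof
  fix c'
  show "covector_of \<A> c x (\<xi> c) c' = \<xi> c'"
  proof (cases "c' \<in> \<A> \<and> x \<in> fst c'")
    case True
    have "covector_of \<A> c x (\<xi> c) c' \<bullet> v = \<xi> c' \<bullet> v" for v
      using cotangent_spaceD[OF assms(1), of c' c v] inner_covector_of[of c x c' "\<xi> c" v] assms True by metis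
    then show ?thesis by (metis vector_eq_rdot)
  next
    case False
    then show ?thesis using cotangent_space_zero[OF assms(1) False] by (simp only: covector_of_def if_False)
  qed
qed

lemma cotangent_chart_inj: "c \<in> \<A> \<Longrightarrow> inj_on (snd (cotangent_chart \<A> c)) (fst (cotangent_chart \<A> c))"
proof (rule inj_onI)
  fix z z' assume c: "c \<in> \<A>" and z: "z \<in> fst (cotangent_chart \<A> c)" "z' \<in> fst (cotangent_chart \<A> c)"
    and eq: "snd (cotangent_chart \<A> c) z = snd (cotangent_chart \<A> c) z'"
  have "snd c (fst z) = snd c (fst z')" and w: "snd z c = snd z' c"
    using eq by (simp_all add: snd_cotangent_chart)
  then have f: "fst z = fst z'"
    using z inj_onD[OF chart_inj[OF atlas_chart_of[OF c]]] by (simp only: fst_cotangent_chart)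
  have "snd z = covector_of \<A> c (fst z) (snd z c)" "snd z' = covector_of \<A> c (fst z') (snd z' c)"
    using z c by (simp_all only: fst_cotangent_chart covector_of_eq)
  then have "snd z = snd z'" using f w by metis
  then show "z = z'" using f by (simp add: prod_eq_iff)
qed

lemma cotangent_chart_range:
  "c \<in> \<A> \<Longrightarrow> snd (cotangent_chart \<A> c) ` fst (cotangent_chart \<A> c) = (snd c ` fst c) \<times> UNIV"
proof (intro equalityI subsetI)
  fix q assume c: "c \<in> \<A>" and "q \<in> (snd c ` fst c) \<times> (UNIV :: 'e set)"
  then obtain x where x: "x \<in> fst c" "fst q = snd c x" by (auto simp: mem_Times_iff)
  define w where "w = snd q"
  have q: "q = (snd c x, w)" "x \<in> fst c" using x by (simp_all add: w_def prod_eq_iff)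
  then have "q = snd (cotangent_chart \<A> c) (x, covector_of \<A> c x w)"
    "(x, covector_of \<A> c x w) \<in> fst (cotangent_chart \<A> c)"
    using c by (auto simp: fst_cotangent_chart snd_cotangent_chart covector_of_self covector_of_in_cotangent_space)
  then show "q \<in> snd (cotangent_chart \<A> c) ` fst (cotangent_chart \<A> c)" by blast
qed (auto simp: fst_cotangent_chart snd_cotangent_chart)

lemma cotangent_transition_apply:
  assumes "c \<in> \<A>" "c' \<in> \<A>" "z \<in> fst (cotangent_chart \<A> c)" "fst z \<in> fst c'"
  shows "cotangent_transition c c' (snd (cotangent_chart \<A> c) z) = snd (cotangent_chart \<A> c') z"
proof -
  have "covector_of \<A> c (fst z) (snd z c) c' = snd z c'"
    using assms by (simp add: fst_cotangent_chart covector_of_eq)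
  then show ?thesis using assms
    by (simp add: cotangent_transition_def snd_cotangent_chart fst_cotangent_chart transition_apply covector_of_def)
qed

text \<open>The map contains the first derivative of a transition, so this uses its derivatives of order two.\<close>

lemma cotangent_transition_C1:
  assumes c: "c \<in> \<A>" "c' \<in> \<A>"
  shows "Ck_on 1 (cotangent_transition c c') (overlap c c' \<times> UNIV)"
proof -
  have t: "Ck_on 1 (\<lambda>z. transition c c' (fst z)) (overlap c c' \<times> (UNIV :: 'e set))"
    by (rule C1_compose[OF C1_fst smooth_imp_C1[OF transition_smooth[OF c]]]) auto
  have d: "Ck_on 1 (\<lambda>z. frechet_derivative (transition c' c) (at (transition c c' (fst z))) b)
      (overlap c c' \<times> (UNIV :: 'e set))" for b
    by (rule C1_compose[OF t smooth_frechet_C1[OF transition_smooth[OF c(2,1)]]])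
      (auto intro: transition_in_overlap c)
  show ?thesis unfolding cotangent_transition_def
    by (intro C1_Pair t C1_sum finite_Basis C1_scaleR C1_inner C1_snd d C1_const)
qed

lemma chart_mem_image_iff:
  "c \<in> \<A> \<Longrightarrow> x \<in> fst c \<Longrightarrow> snd c x \<in> snd c ` (fst c \<inter> V) \<longleftrightarrow> x \<in> V"
  by (simp add: inj_on_image_mem_iff[OF chart_inj[OF atlas_chart_of]])

lemma overlap_cotangent:
  assumes "c \<in> \<A>" "c' \<in> \<A>" "z \<in> fst (cotangent_chart \<A> c)"
  shows "snd (cotangent_chart \<A> c) z \<in> overlap c c' \<times> UNIV \<longleftrightarrow> fst z \<in> fst c'"
  using assms by (simp add: snd_cotangent_chart fst_cotangent_chart overlap_def chart_mem_image_iff)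

lemma openin_cotangentI:
  "c \<in> \<A> \<Longrightarrow> open W \<Longrightarrow> openin (cotangent_topology \<A>) {z \<in> fst (cotangent_chart \<A> c). snd (cotangent_chart \<A> c) z \<in> W}"
  unfolding cotangent_topology_def
  by (rule topology_generated_by_Basis) (unfold cotangent_atlas_def, blast)

text \<open>In terms of generating sets this is the continuity of the transitions between cotangent charts.\<close>

lemma open_cotangent_image:
  assumes c: "c \<in> \<A>" and V: "openin (cotangent_topology \<A>) V"
  shows "open (snd (cotangent_chart \<A> c) ` (fst (cotangent_chart \<A> c) \<inter> V))"
proof -
  let ?C = "cotangent_chart \<A> c"
  have "generate_topology_on {{z \<in> fst C. snd C z \<in> W} | C W. C \<in> cotangent_atlas \<A> \<and> open W} V"
    using V by (simp add: cotangent_topology_def openin_topology_generated_by_iff)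
  then show ?thesis
  proof induction
    case Empty then show ?case by simp
  next
    case (Int a b)
    have "snd ?C ` (fst ?C \<inter> (a \<inter> b)) = snd ?C ` (fst ?C \<inter> a) \<inter> snd ?C ` (fst ?C \<inter> b)"
      using inj_on_image_Int[OF cotangent_chart_inj[OF c], of "fst ?C \<inter> a" "fst ?C \<inter> b"]
      by (simp add: Int_ac)
    then show ?case using Int by (simp add: open_Int)
  next
    case (UN K)
    have "snd ?C ` (fst ?C \<inter> \<Union> K) = (\<Union>k\<in>K. snd ?C ` (fst ?C \<inter> k))" by auto
    then show ?case using UN by auto
  next
    case (Basis V)
    then obtain c' W where c': "c' \<in> \<A>" "open W" and
      Veq: "V = {z \<in> fst (cotangent_chart \<A> c'). snd (cotangent_chart \<A> c') z \<in> W}"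
      unfolding cotangent_atlas_def by blast
    have "snd ?C ` (fst ?C \<inter> V) = (overlap c c' \<times> UNIV) \<inter> cotangent_transition c c' -` W"
    proof (intro equalityI subsetI)
      fix q assume "q \<in> snd ?C ` (fst ?C \<inter> V)"
      then obtain z where z: "z \<in> fst ?C" "z \<in> V" "q = snd ?C z" by auto
      then have "fst z \<in> fst c'" by (simp add: Veq fst_cotangent_chart)
      then show "q \<in> (overlap c c' \<times> UNIV) \<inter> cotangent_transition c c' -` W"
        using overlap_cotangent[OF c c'(1) z(1)] cotangent_transition_apply[OF c c'(1) z(1)] z
        by (simp add: Veq)
    next
      fix q assume q: "q \<in> (overlap c c' \<times> UNIV) \<inter> cotangent_transition c c' -` W"
      then have "q \<in> (snd c ` fst c) \<times> UNIV" by (auto simp: overlap_def)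
      then have "q \<in> snd ?C ` fst ?C" by (simp only: cotangent_chart_range[OF c])
      then obtain z where z: "z \<in> fst ?C" "q = snd ?C z" by (elim imageE)
      have "snd ?C z \<in> overlap c c' \<times> UNIV" using q unfolding z(2) by (rule IntD1)
      then have fz: "fst z \<in> fst c'" by (simp only: overlap_cotangent[OF c c'(1) z(1)])
      have "snd (cotangent_chart \<A> c') z \<in> W"
        using q unfolding z(2) by (simp add: cotangent_transition_apply[OF c c'(1) z(1) fz])
      moreover have "z \<in> fst (cotangent_chart \<A> c')" using z(1) fz by (simp add: fst_cotangent_chart)
      ultimately have "z \<in> V" by (simp add: Veq)
      then show "q \<in> snd ?C ` (fst ?C \<inter> V)" using z by blast
    qed
    then show ?case
      using continuous_open_preimage[OF C1_continuous_on[OF cotangent_transition_C1[OF c c'(1)]]] c'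
        open_Times[OF open_overlap[OF c c'(1)] open_UNIV] by simp
  qed
qed

lemma cotangent_chart_of:
  assumes c: "c \<in> \<A>"
  shows "chart_of (cotangent_topology \<A>) (cotangent_chart \<A> c)"
proof -
  let ?C = "cotangent_chart \<A> c"
  have "chart_of (cotangent_topology \<A>) (fst ?C, snd ?C)"
  proof (rule chart_ofI)
    show "open (snd ?C ` V)" if "openin (cotangent_topology \<A>) V" "V \<subseteq> fst ?C" for V
      using open_cotangent_image[OF c that(1)] that(2) by (simp add: Int_absorb1)
  qed (rule openin_cotangentI[OF c], assumption, rule cotangent_chart_inj[OF c])
  then show ?thesis by simp
qed

lemma topspace_cotangent: "topspace (cotangent_topology \<A>) = cotangent_bundle M \<A>"
proof -
  have "topspace (cotangent_topology \<A>) = (\<Union>C\<in>cotangent_atlas \<A>. fst C)"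
    unfolding cotangent_topology_def topology_generated_by_topspace
  proof (intro equalityI subsetI)
    fix z assume "z \<in> (\<Union>C\<in>cotangent_atlas \<A>. fst C)"
    then obtain C where C: "C \<in> cotangent_atlas \<A>" "z \<in> {z \<in> fst C. snd C z \<in> UNIV}" by blast
    then show "z \<in> \<Union> {{z \<in> fst C. snd C z \<in> W} | C W. C \<in> cotangent_atlas \<A> \<and> open W}"
      using open_UNIV by blast
  qed blast
  also have "\<dots> = (\<Union>c\<in>\<A>. fst (cotangent_chart \<A> c))" unfolding cotangent_atlas_def by blast
  also have "\<dots> = cotangent_bundle M \<A>"
    using mfd unfolding smooth_manifold_def cotangent_bundle_def cotangent_chart_def fst_conv by blast
  finally show ?thesis .
qed

text \<open>Covectors at different points are separated by the projection to \<open>M\<close>, covectors at the same point by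
  their coordinates in one chart.\<close>

lemma Hausdorff_cotangent: "Hausdorff_space (cotangent_topology \<A>)"
  unfolding Hausdorff_space_def topspace_cotangent
proof clarify
  fix x \<xi> y \<zeta>
  assume z: "(x, \<xi>) \<in> cotangent_bundle M \<A>" and z': "(y, \<zeta>) \<in> cotangent_bundle M \<A>"
    and ne: "\<not> (\<exists>U V. openin (cotangent_topology \<A>) U \<and> openin (cotangent_topology \<A>) V \<and>
       (x, \<xi>) \<in> U \<and> (y, \<zeta>) \<in> V \<and> disjnt U V)"
  obtain c c' where c: "c \<in> \<A>" "x \<in> fst c" "c' \<in> \<A>" "y \<in> fst c'"
    using z z' atlas_cover by (metis SigmaE2 cotangent_bundle_def)
  have "x = y"
  proof (rule ccontr)
    assume "x \<noteq> y"
    then obtain U U' where U: "openin M U" "openin M U'" "x \<in> U" "y \<in> U'" "disjnt U U'"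
    proof -
      have "Hausdorff_space M" using mfd by (simp add: smooth_manifold_def)
      moreover have "x \<in> topspace M" "y \<in> topspace M" using z z' by (auto simp: cotangent_bundle_def)
      ultimately show ?thesis using \<open>x \<noteq> y\<close> that unfolding Hausdorff_space_def by metis
    qed
    have lift: "openin (cotangent_topology \<A>) {z \<in> fst (cotangent_chart \<A> c). fst z \<in> U}"
      if "c \<in> \<A>" "openin M U" for c U
    proof -
      have "open ((snd c ` (fst c \<inter> U)) \<times> (UNIV :: 'e set))"
        by (intro open_Times chart_open_image[OF atlas_chart_of] that open_UNIV)
      from openin_cotangentI[OF that(1) this] show ?thesis
        by (rule back_subst[where P = "openin (cotangent_topology \<A>)"])
          (use that in \<open>simp add: fst_cotangent_chart snd_cotangent_chart chart_mem_image_iff mem_Times_iff cong: conj_cong\<close>)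
    qed
    have "(x, \<xi>) \<in> {z \<in> fst (cotangent_chart \<A> c). fst z \<in> U}"
      "(y, \<zeta>) \<in> {z \<in> fst (cotangent_chart \<A> c'). fst z \<in> U'}"
      using U c z z' by (auto simp: cotangent_bundle_def fst_cotangent_chart)
    moreover have "disjnt {z \<in> fst (cotangent_chart \<A> c). fst z \<in> U} {z \<in> fst (cotangent_chart \<A> c'). fst z \<in> U'}"
      using U(5) unfolding disjnt_iff by blast
    ultimately show False using ne lift[OF c(1) U(1)] lift[OF c(3) U(2)] by blast
  qed
  moreover have "\<xi> = \<zeta>"
  proof (rule ccontr)
    assume "\<xi> \<noteq> \<zeta>"
    have "\<xi> \<in> cotangent_space \<A> x" "\<zeta> \<in> cotangent_space \<A> x"
      using z z' \<open>x = y\<close> by (auto simp: cotangent_bundle_def)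
    then have "\<xi> = covector_of \<A> c x (\<xi> c)" "\<zeta> = covector_of \<A> c x (\<zeta> c)"
      by (simp_all only: covector_of_eq c(1,2))
    then have "\<xi> c \<noteq> \<zeta> c" using \<open>\<xi> \<noteq> \<zeta>\<close> by metis
    then obtain W W' where W: "open W" "open W'" "\<xi> c \<in> W" "\<zeta> c \<in> W'" "W \<inter> W' = {}" using hausdorff by metis
    let ?V = "\<lambda>W. {z \<in> fst (cotangent_chart \<A> c). snd (cotangent_chart \<A> c) z \<in> UNIV \<times> W}"
    have "openin (cotangent_topology \<A>) (?V W)" "openin (cotangent_topology \<A>) (?V W')"
      by (intro openin_cotangentI c open_Times open_UNIV W)+
    moreover have "(x, \<xi>) \<in> ?V W" "(y, \<zeta>) \<in> ?V W'"
      using \<open>\<xi> \<in> cotangent_space \<A> x\<close> \<open>\<zeta> \<in> cotangent_space \<A> x\<close> c(2) W(3,4) \<open>x = y\<close>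
      unfolding mem_Collect_eq fst_cotangent_chart snd_cotangent_chart mem_Times_iff by simp_all
    moreover have "disjnt (?V W) (?V W')"
      unfolding disjnt_iff
    proof (intro allI notI, elim conjE)
      fix z assume "z \<in> ?V W" "z \<in> ?V W'"
      then have "snd z c \<in> W" "snd z c \<in> W'" by (simp_all only: mem_Collect_eq snd_cotangent_chart mem_Times_iff snd_conv)
      then show False using W(5) by blast
    qed
    ultimately have "\<exists>U V. openin (cotangent_topology \<A>) U \<and> openin (cotangent_topology \<A>) V \<and>
       (x, \<xi>) \<in> U \<and> (y, \<zeta>) \<in> V \<and> disjnt U V" by (intro exI conjI)
    then show False using ne by (rule notE[rotated])
  qed
  ultimately show "x = y \<and> \<xi> = \<zeta>" ..
qed

end

section \<open>Charts of the cosphere bundle\<close>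

text \<open>The affine coordinate of the direction of the covector part: $w$ is scaled to $w/(w\cdot b)$ and
  the vector $b$ is subtracted. The adjoint of the isometry \<open>T\<close> is its inverse on the range.\<close>

definition direction_coord :: "('s::euclidean_space \<Rightarrow> 'e::euclidean_space \<times> 'e) \<Rightarrow> 'e \<Rightarrow> 'e \<times> 'e \<Rightarrow> 's" where
  "direction_coord T b = (\<lambda>z. adjoint T (fst z, inverse (snd z \<bullet> b) *\<^sub>R snd z - b))"

text \<open>One value of the sign \<open>\<sigma>\<close> selects a half of the set on which the affine coordinate is defined; it has
  to be fixed because opposite covectors have the same coordinate.\<close>

definition cosphere_chart ::
  "('m, 'e::euclidean_space) chart set \<Rightarrow> ('m \<times> ('m, 'e) covector) set \<Rightarrow> ('m, 'e) chart \<Rightarrow>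
   ('s::euclidean_space \<Rightarrow> 'e \<times> 'e) \<Rightarrow> 'e \<Rightarrow> real \<Rightarrow> ('m \<times> ('m, 'e) covector, 's) chart" where
  "cosphere_chart \<A> N c T b \<sigma> =
    ({z \<in> N. z \<in> fst (cotangent_chart \<A> c) \<and> \<sigma> * (snd z c \<bullet> b) > 0},
     \<lambda>z. direction_coord T b (snd (cotangent_chart \<A> c) z))"

lemma cotangent_space_scaleR:
  assumes \<xi>: "\<xi> \<in> cotangent_space \<A> x"
  shows "(\<lambda>c. t *\<^sub>R \<xi> c) \<in> cotangent_space \<A> x"
  unfolding cotangent_space_def mem_Collect_eq
proof (intro conjI ballI impI allI)
  fix c c' v assume "c \<in> \<A>" "c' \<in> \<A>" "x \<in> fst c" "x \<in> fst c'"
  then have "\<xi> c \<bullet> v = \<xi> c' \<bullet> frechet_derivative (transition c c') (at (snd c x)) v"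
    using \<xi> unfolding cotangent_space_def by blast
  then show "t *\<^sub>R \<xi> c \<bullet> v = t *\<^sub>R \<xi> c' \<bullet> frechet_derivative (transition c c') (at (snd c x)) v"
    by (simp only: inner_scaleR_left)
next
  fix c assume "c \<notin> \<A> \<or> x \<notin> fst c"
  then have "\<xi> c = 0" using \<xi> unfolding cotangent_space_def by blast
  then show "t *\<^sub>R \<xi> c = 0" by simp
qed

context
  fixes T :: "'s::euclidean_space \<Rightarrow> 'e::euclidean_space \<times> 'e" and b :: 'e
  assumes lin: "linear T" and iso: "\<And>s. norm (T s) = norm s" and rng: "range T = {z. snd z \<bullet> b = 0}"
    and b: "b \<in> Basis"
begin

lemma adjoint_left_inverse: "adjoint T (T s) = s"
proof -
  have "T s \<bullet> T s' = s \<bullet> s'" for s s'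
    unfolding dot_norm by (simp only: linear_add[OF lin, symmetric] iso)
  then have "s' \<bullet> adjoint T (T s) = s' \<bullet> s" for s' by (simp add: adjoint_works[OF lin] inner_commute)
  then show ?thesis by (metis vector_eq_ldot)
qed

lemma adjoint_right_inverse: "snd z \<bullet> b = 0 \<Longrightarrow> T (adjoint T z) = z"
  using rng adjoint_left_inverse by (metis (mono_tags, lifting) mem_Collect_eq rangeE)

lemma T_orth: "snd (T s) \<bullet> b = 0"
  using rng by blast

lemma b_inner_self: "b \<bullet> b = 1"
  using b by (simp add: inner_Basis)

lemma affine_direction_inner: "(b + snd (T s)) \<bullet> b = 1"
  by (simp add: inner_add_left T_orth b_inner_self)

lemma affine_direction_nonzero: "b + snd (T s) \<noteq> 0"
  using affine_direction_inner[of s] by auto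

lemma direction_coord_eqI:
  assumes "fst q = fst (T s)" "snd q = t *\<^sub>R (b + snd (T s))" "t \<noteq> 0"
  shows "direction_coord T b q = s"
proof -
  have "snd q \<bullet> b = t" by (simp add: assms affine_direction_inner)
  then have "(fst q, inverse (snd q \<bullet> b) *\<^sub>R snd q - b) = T s" using assms by (simp add: prod_eq_iff)
  then show ?thesis by (simp add: direction_coord_def adjoint_left_inverse)
qed

lemma T_direction_coord:
  assumes "snd q \<bullet> b \<noteq> 0"
  shows "fst (T (direction_coord T b q)) = fst q"
    and "snd q = (snd q \<bullet> b) *\<^sub>R (b + snd (T (direction_coord T b q)))"
proof -
  have "T (direction_coord T b q) = (fst q, inverse (snd q \<bullet> b) *\<^sub>R snd q - b)"
    unfolding direction_coord_def using assms
    by (intro adjoint_right_inverse) (simp add: inner_diff_left b_inner_self)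
  then show "fst (T (direction_coord T b q)) = fst q"
    "snd q = (snd q \<bullet> b) *\<^sub>R (b + snd (T (direction_coord T b q)))"
    using assms by simp_all
qed

lemma direction_coord_C1: "Ck_on 1 (direction_coord T b) {q. snd q \<bullet> b \<noteq> 0}"
proof -
  have i: "Ck_on 1 (\<lambda>q. inverse (snd q \<bullet> b)) {q. snd q \<bullet> b \<noteq> 0}"
    by (rule C1_inverse[OF C1_inner[OF C1_snd C1_const]]) simp
  have "Ck_on 1 (\<lambda>q. (fst q, inverse (snd q \<bullet> b) *\<^sub>R snd q + - b)) {q. snd q \<bullet> b \<noteq> 0}"
    by (intro C1_Pair C1_fst C1_add C1_scaleR i C1_snd C1_const)
  from C1_compose[OF this C1_linear[OF adjoint_linear[OF lin], of UNIV]] show ?thesis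
    unfolding direction_coord_def by simp
qed

context
  fixes M :: "'m topology" and \<A> :: "('m, 'e) chart set" and len :: "'m \<times> ('m, 'e) covector \<Rightarrow> real"
    and c :: "('m, 'e) chart" and \<sigma> :: real
  assumes mfd: "smooth_manifold M \<A>" and len: "length_function M \<A> len" and c: "c \<in> \<A>"
    and \<sigma>: "\<sigma> = 1 \<or> \<sigma> = -1"
begin

abbreviation (input) "\<C> \<equiv> cotangent_chart \<A> c"
abbreviation (input) "\<N> \<equiv> cosphere_bundle M \<A> len"
abbreviation (input) "\<K> \<equiv> cosphere_chart \<A> \<N> c T b \<sigma>"
abbreviation (input) "\<X> \<equiv> cotangent_topology \<A>"

definition "local_length q = len (chart_inv \<C> q)"

text \<open>The inverse of the chart, in the coordinates of the cotangent bundle: the direction $\sigma(b + y)$ is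
  normalized to length 1.\<close>

definition "sphere_lift s = (fst (T s), (\<sigma> * inverse (local_length (fst (T s), \<sigma> *\<^sub>R (b + snd (T s))))) *\<^sub>R (b + snd (T s)))"

abbreviation (input) "\<Omega> \<equiv> {s. fst (T s) \<in> snd c ` fst c}"

lemma bundle_chart_of: "chart_of \<X> \<C>"
  by (rule cotangent_chart_of[OF mfd c])

lemma bundle_chart_range: "snd \<C> ` fst \<C> = (snd c ` fst c) \<times> UNIV"
  by (rule cotangent_chart_range[OF mfd c])

lemma bundle_chart_inv:
  assumes "fst q \<in> snd c ` fst c"
  shows "chart_inv \<C> q \<in> fst \<C>" "snd \<C> (chart_inv \<C> q) = q" "chart_inv \<C> q \<in> cotangent_bundle M \<A>"
proof -
  have q: "q \<in> snd \<C> ` fst \<C>" using assms unfolding bundle_chart_range by (simp add: mem_Times_iff)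
  show "chart_inv \<C> q \<in> fst \<C>" by (rule chart_inv_in[OF bundle_chart_of q])
  show "snd \<C> (chart_inv \<C> q) = q" by (rule chart_inv_right[OF bundle_chart_of q])
  show "chart_inv \<C> q \<in> cotangent_bundle M \<A>"
    using chart_inv_in[OF bundle_chart_of q] chart_subset[OF bundle_chart_of] topspace_cotangent[OF mfd] by blast
qed

lemma bundle_chart_inv_nonzero:
  assumes "fst q \<in> snd c ` fst c" "snd q \<noteq> 0"
  shows "chart_inv \<C> q \<in> cotangent_bundle M \<A> - zero_section M"
proof -
  have "snd (chart_inv \<C> q) c = snd q" using bundle_chart_inv(2)[OF assms(1)] by (metis snd_conv snd_cotangent_chart)
  then have "snd (chart_inv \<C> q) \<noteq> zero_covector" using assms(2) by (auto simp: zero_covector_def)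
  then have "chart_inv \<C> q \<notin> zero_section M" unfolding zero_section_def by (metis SigmaE2 prod.collapse singletonD)
  then show ?thesis using bundle_chart_inv(3)[OF assms(1)] by simp
qed

lemma local_length_pos: "fst q \<in> snd c ` fst c \<Longrightarrow> snd q \<noteq> 0 \<Longrightarrow> local_length q > 0"
  using bundle_chart_inv_nonzero len unfolding local_length_def length_function_def by blast

lemma local_length_chart: "z \<in> fst \<C> \<Longrightarrow> local_length (snd \<C> z) = len z"
  by (simp add: local_length_def chart_inv_left[OF bundle_chart_of])

lemma local_length_scaleR:
  assumes p: "p \<in> snd c ` fst c" and t: "t \<ge> 0"
  shows "local_length (p, t *\<^sub>R w) = t * local_length (p, w)"
proof -
  obtain x \<xi> where z: "chart_inv \<C> (p, w) = (x, \<xi>)" by (cases "chart_inv \<C> (p, w)")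
  note f = bundle_chart_inv[of "(p, w)", unfolded fst_conv, OF p, unfolded z]
  have "(x, \<lambda>c. t *\<^sub>R \<xi> c) \<in> fst \<C>" using f(1) by (simp add: fst_cotangent_chart cotangent_space_scaleR)
  moreover have "snd \<C> (x, \<lambda>c. t *\<^sub>R \<xi> c) = (p, t *\<^sub>R w)" using f(2) by (simp add: snd_cotangent_chart)
  ultimately have "local_length (p, t *\<^sub>R w) = len (x, \<lambda>c. t *\<^sub>R \<xi> c)" using local_length_chart by metis
  also have "\<dots> = t * len (x, \<xi>)" using len f(3) t unfolding length_function_def by blast
  finally show ?thesis by (simp add: local_length_def z)
qed

lemma local_length_C1: "Ck_on 1 local_length ((snd c ` fst c) \<times> (UNIV - {0}))"
proof -
  have "\<C> \<in> cotangent_atlas \<A>" using c by (simp add: cotangent_atlas_def)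
  then have "Ck_on 1 (len \<circ> chart_inv \<C>) (snd \<C> ` (fst \<C> \<inter> (cotangent_bundle M \<A> - zero_section M)))"
    using len unfolding length_function_def Ck_function_def by blast
  then have "Ck_on 1 local_length (snd \<C> ` (fst \<C> \<inter> (cotangent_bundle M \<A> - zero_section M)))"
    by (simp only: local_length_def[abs_def] o_def)
  moreover have "(snd c ` fst c) \<times> (UNIV - {0}) \<subseteq> snd \<C> ` (fst \<C> \<inter> (cotangent_bundle M \<A> - zero_section M))"
  proof
    fix q assume "q \<in> (snd c ` fst c) \<times> (UNIV - {0::'e})"
    then have q: "fst q \<in> snd c ` fst c" "snd q \<noteq> 0" by auto
    then show "q \<in> snd \<C> ` (fst \<C> \<inter> (cotangent_bundle M \<A> - zero_section M))"
      using bundle_chart_inv[OF q(1)] bundle_chart_inv_nonzero[OF q] by (intro image_eqI[of _ _ "chart_inv \<C> q"]) auto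
  qed
  ultimately show ?thesis by (rule C1_subset)
qed

lemma open_coord_range: "open \<Omega>"
proof -
  have "open ((\<lambda>s. fst (T s)) -` (snd c ` fst c))"
    using lin by (intro open_vimage chart_open_range[OF atlas_chart_of[OF mfd c]] continuous_on_fst linear_continuous_on)
      (simp add: linear_conv_bounded_linear)
  then show ?thesis by (simp add: vimage_def)
qed

lemma sign_facts: "\<sigma> \<noteq> 0" "\<sigma> * \<sigma> = 1" using \<sigma> by auto

lemma signed_direction_nonzero: "\<sigma> *\<^sub>R (b + snd (T s)) \<noteq> 0"
  using affine_direction_nonzero sign_facts by simp

lemma sphere_lift_facts:
  assumes s: "s \<in> \<Omega>"
  shows "fst (sphere_lift s) = fst (T s)" "\<sigma> * (snd (sphere_lift s) \<bullet> b) > 0" "local_length (sphere_lift s) = 1" "direction_coord T b (sphere_lift s) = s"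
proof -
  let ?w = "\<sigma> *\<^sub>R (b + snd (T s))"
  have p: "fst (T s) \<in> snd c ` fst c" using s by simp
  define l where "l = local_length (fst (T s), ?w)"
  have l: "l > 0" unfolding l_def using p signed_direction_nonzero by (intro local_length_pos) simp_all
  have sphere_lift: "sphere_lift s = (fst (T s), inverse l *\<^sub>R ?w)" by (simp add: sphere_lift_def l_def mult.commute)
  show f: "fst (sphere_lift s) = fst (T s)" by (simp add: sphere_lift)
  have "snd (sphere_lift s) \<bullet> b = inverse l * \<sigma>" by (simp add: sphere_lift affine_direction_inner)
  then have "\<sigma> * (snd (sphere_lift s) \<bullet> b) = inverse l * (\<sigma> * \<sigma>)" by simp
  then show "\<sigma> * (snd (sphere_lift s) \<bullet> b) > 0" using l unfolding sign_facts by simp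
  show "local_length (sphere_lift s) = 1" unfolding sphere_lift using l p by (subst local_length_scaleR) (auto simp: l_def)
  show "direction_coord T b (sphere_lift s) = s"
    by (rule direction_coord_eqI[where t = "inverse l * \<sigma>"]) (use l sign_facts in \<open>auto simp: sphere_lift\<close>)
qed

text \<open>If $\beta = \sigma (w\cdot b)$ then $w = \beta\,\sigma(b + y)$; a covector of length 1 is recovered because, by
  homogeneity, $\beta$ is the reciprocal of the length of $\sigma(b + y)$.\<close>

lemma sphere_lift_direction_coord:
  assumes q: "fst q \<in> snd c ` fst c" "\<sigma> * (snd q \<bullet> b) > 0" "local_length q = 1"
  shows "direction_coord T b q \<in> \<Omega>" "sphere_lift (direction_coord T b q) = q"
proof -
  let ?s = "direction_coord T b q"
  have nz: "snd q \<bullet> b \<noteq> 0" using q(2) by auto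
  note T = T_direction_coord[OF nz]
  show s: "?s \<in> \<Omega>" using T(1) q(1) by simp
  let ?t = "\<sigma> * (snd q \<bullet> b)"
  let ?w = "\<sigma> *\<^sub>R (b + snd (T ?s))"
  have "?t *\<^sub>R ?w = (\<sigma> * \<sigma>) *\<^sub>R (snd q \<bullet> b) *\<^sub>R (b + snd (T ?s))" by (simp add: ac_simps)
  then have sq: "?t *\<^sub>R ?w = snd q" using T(2) sign_facts by simp
  have "1 = local_length (fst q, ?t *\<^sub>R ?w)" using q(3) unfolding sq by simp
  also have "\<dots> = ?t * local_length (fst q, ?w)" using q by (intro local_length_scaleR) auto
  finally have "inverse (local_length (fst q, ?w)) = ?t" using q(2) by (metis inverse_unique mult.commute)
  then have "sphere_lift ?s = (fst q, (\<sigma> * ?t) *\<^sub>R (b + snd (T ?s)))" by (simp add: sphere_lift_def T(1))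
  also have "(\<sigma> * ?t) *\<^sub>R (b + snd (T ?s)) = ?t *\<^sub>R ?w" by simp
  finally show "sphere_lift ?s = q" by (simp only: sq prod.collapse)
qed

lemma local_length_affine_C1: "Ck_on 1 (\<lambda>s. local_length (fst (T s), \<sigma> *\<^sub>R (b + snd (T s)))) \<Omega>"
proof -
  have "Ck_on 1 (\<lambda>s. fst (T s)) \<Omega>" "Ck_on 1 (\<lambda>s. snd (T s)) \<Omega>"
    by (rule C1_compose[OF C1_linear[OF lin] C1_fst UNIV_I], rule C1_compose[OF C1_linear[OF lin] C1_snd UNIV_I])
  then have q: "Ck_on 1 (\<lambda>s. (fst (T s), \<sigma> *\<^sub>R (b + snd (T s)))) \<Omega>"
    by (intro C1_Pair C1_scaleR C1_const C1_add)
  show ?thesis by (rule C1_compose[OF q local_length_C1]) (use signed_direction_nonzero in auto)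
qed

lemma sphere_lift_C1: "Ck_on 1 sphere_lift \<Omega>"
proof -
  have T1: "Ck_on 1 (\<lambda>s. fst (T s)) \<Omega>" "Ck_on 1 (\<lambda>s. snd (T s)) \<Omega>"
    by (rule C1_compose[OF C1_linear[OF lin] C1_fst UNIV_I], rule C1_compose[OF C1_linear[OF lin] C1_snd UNIV_I])
  have w: "Ck_on 1 (\<lambda>s. b + snd (T s)) \<Omega>" by (intro C1_add C1_const T1)
  from local_length_affine_C1 have i: "Ck_on 1 (\<lambda>s. inverse (local_length (fst (T s), \<sigma> *\<^sub>R (b + snd (T s))))) \<Omega>"
    by (rule C1_inverse) (metis (mono_tags, lifting) signed_direction_nonzero fst_conv snd_conv less_irrefl local_length_pos mem_Collect_eq)
  have "Ck_on 1 (\<lambda>s. \<sigma> *\<^sub>R inverse (local_length (fst (T s), \<sigma> *\<^sub>R (b + snd (T s))))) \<Omega>"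
    by (intro C1_scaleR C1_const i)
  then have "Ck_on 1 (\<lambda>s. \<sigma> * inverse (local_length (fst (T s), \<sigma> *\<^sub>R (b + snd (T s))))) \<Omega>" by (simp only: real_scaleR_def)
  then show ?thesis unfolding sphere_lift_def[abs_def] by (intro C1_Pair T1 C1_scaleR w)
qed

lemma cosphere_chart_dom: "z \<in> fst \<K> \<longleftrightarrow> z \<in> \<N> \<and> z \<in> fst \<C> \<and> \<sigma> * (snd z c \<bullet> b) > 0"
  by (simp add: cosphere_chart_def)

lemma cosphere_chart_apply: "snd \<K> z = direction_coord T b (snd \<C> z)"
  by (simp add: cosphere_chart_def)

lemma cosphere_chart_lift:
  assumes z: "z \<in> fst \<K>" shows "snd \<K> z \<in> \<Omega>" "sphere_lift (snd \<K> z) = snd \<C> z"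
proof -
  have zK: "z \<in> \<N>" "z \<in> fst \<C>" "\<sigma> * (snd z c \<bullet> b) > 0" using z unfolding cosphere_chart_dom by blast+
  then have "fst (snd \<C> z) \<in> snd c ` fst c" "\<sigma> * (snd (snd \<C> z) \<bullet> b) > 0"
    by (simp_all add: fst_cotangent_chart snd_cotangent_chart)
  moreover have "local_length (snd \<C> z) = 1" using zK by (simp add: local_length_chart cosphere_bundle_def)
  ultimately show "snd \<K> z \<in> \<Omega>" "sphere_lift (snd \<K> z) = snd \<C> z" unfolding cosphere_chart_apply by (rule sphere_lift_direction_coord)+
qed

lemma cosphere_chart_of_lift:
  assumes s: "s \<in> \<Omega>" shows "chart_inv \<C> (sphere_lift s) \<in> fst \<K>" "snd \<K> (chart_inv \<C> (sphere_lift s)) = s"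
proof -
  note f = sphere_lift_facts[OF s]
  have "fst (sphere_lift s) \<in> snd c ` fst c" using f(1) s by simp
  note i = bundle_chart_inv[OF this]
  have "len (chart_inv \<C> (sphere_lift s)) = 1" using f(3) by (simp add: local_length_def)
  moreover have "snd (chart_inv \<C> (sphere_lift s)) c = snd (sphere_lift s)" using i(2) by (metis snd_conv snd_cotangent_chart)
  moreover have "chart_inv \<C> (sphere_lift s) \<in> \<N>" using calculation i(3) by (simp add: cosphere_bundle_def)
  ultimately show "chart_inv \<C> (sphere_lift s) \<in> fst \<K>" unfolding cosphere_chart_dom using i(1) f(2) by simp
  show "snd \<K> (chart_inv \<C> (sphere_lift s)) = s" by (simp only: cosphere_chart_apply i(2) f(4))
qed

lemma cosphere_chart_range: "snd \<K> ` fst \<K> = \<Omega>"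
  using cosphere_chart_lift(1) cosphere_chart_of_lift by (metis (no_types, lifting) image_eqI image_subsetI subsetI subset_antisym)

lemma cosphere_chart_inj: "inj_on (snd \<K>) (fst \<K>)"
proof (rule inj_onI)
  fix z z' assume z: "z \<in> fst \<K>" "z' \<in> fst \<K>" "snd \<K> z = snd \<K> z'"
  then have "snd \<C> z = snd \<C> z'" using cosphere_chart_lift(2) by metis
  then show "z = z'" using z cosphere_chart_dom inj_onD[OF chart_inj[OF bundle_chart_of]] by blast
qed

lemma chart_inv_cosphere_chart:
  assumes s: "s \<in> \<Omega>" shows "chart_inv \<K> s = chart_inv \<C> (sphere_lift s)"
  using inv_into_f_f[OF cosphere_chart_inj cosphere_chart_of_lift(1)[OF s]] unfolding cosphere_chart_of_lift(2)[OF s] chart_inv_def[of \<K>] .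

text \<open>Both directions of continuity are read off from the cotangent chart, via \<open>direction_coord\<close> and
  \<open>sphere_lift\<close>.\<close>

lemma cosphere_chart_of: "chart_of (subtopology \<X> \<N>) \<K>"
proof -
  have "chart_of (subtopology \<X> \<N>) (fst \<K>, snd \<K>)"
  proof (rule chart_ofI[OF _ cosphere_chart_inj])
    fix W :: "'s set" assume W: "open W"
    define H where "H = {q :: 'e \<times> 'e. \<sigma> * (snd q \<bullet> b) > 0}"
    have oH: "open H" unfolding H_def by (intro open_Collect_less continuous_intros)
    have "Ck_on 1 (direction_coord T b) H"
      by (rule C1_subset[OF direction_coord_C1]) (auto simp: H_def)
    then have "open (H \<inter> direction_coord T b -` W)"
      by (intro continuous_open_preimage C1_continuous_on oH W)
    then have "openin \<X> {z \<in> fst \<C>. snd \<C> z \<in> H \<inter> direction_coord T b -` W}"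
      by (rule openin_cotangentI[OF mfd c])
    moreover have "{z \<in> fst \<K>. snd \<K> z \<in> W} = {z \<in> fst \<C>. snd \<C> z \<in> H \<inter> direction_coord T b -` W} \<inter> \<N>"
      by (auto simp: cosphere_chart_dom cosphere_chart_apply H_def snd_cotangent_chart)
    ultimately show "openin (subtopology \<X> \<N>) {z \<in> fst \<K>. snd \<K> z \<in> W}"
      by (auto simp: openin_subtopology)
  next
    fix V assume V: "openin (subtopology \<X> \<N>) V" "V \<subseteq> fst \<K>"
    then obtain V' where V': "openin \<X> V'" "V = V' \<inter> \<N>" by (auto simp: openin_subtopology)
    have "snd \<K> ` V = \<Omega> \<inter> sphere_lift -` (snd \<C> ` (fst \<C> \<inter> V'))"
    proof (intro equalityI subsetI)
      fix s assume "s \<in> snd \<K> ` V"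
      then obtain z where z: "z \<in> V" "s = snd \<K> z" by blast
      then have zK: "z \<in> fst \<K>" using V by blast
      then have "z \<in> fst \<C> \<inter> V'" using z V' cosphere_chart_dom by blast
      then show "s \<in> \<Omega> \<inter> sphere_lift -` (snd \<C> ` (fst \<C> \<inter> V'))" using cosphere_chart_lift[OF zK] z by auto
    next
      fix s assume s: "s \<in> \<Omega> \<inter> sphere_lift -` (snd \<C> ` (fst \<C> \<inter> V'))"
      then obtain z where z: "z \<in> fst \<C>" "z \<in> V'" "sphere_lift s = snd \<C> z" by blast
      then have "chart_inv \<C> (sphere_lift s) = z" by (simp add: chart_inv_left[OF bundle_chart_of])
      then have "z \<in> fst \<K>" "snd \<K> z = s" using cosphere_chart_of_lift s by blast+
      then show "s \<in> snd \<K> ` V" using z V' cosphere_chart_dom by blast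
    qed
    then show "open (snd \<K> ` V)"
      using continuous_open_preimage[OF C1_continuous_on[OF sphere_lift_C1] open_coord_range open_cotangent_image[OF mfd c V'(1)]] by simp
  qed
  then show ?thesis by simp
qed

lemma cosphere_chart_overlap:
  assumes c': "c' \<in> \<A>"
  shows "overlap \<K> (cotangent_chart \<A> c') = \<Omega> \<inter> {s. fst (T s) \<in> overlap c c'}"
proof (intro equalityI subsetI)
  fix s assume "s \<in> overlap \<K> (cotangent_chart \<A> c')"
  then obtain z where z: "z \<in> fst \<K>" "z \<in> fst (cotangent_chart \<A> c')" "s = snd \<K> z" by (auto simp: overlap_def)
  have "fst (T s) = fst (sphere_lift s)" using cosphere_chart_lift(1)[OF z(1)] z(3) by (simp add: sphere_lift_facts)
  also have "\<dots> = snd c (fst z)" using cosphere_chart_lift(2)[OF z(1)] z(3) by (simp add: snd_cotangent_chart)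
  finally have "fst (T s) \<in> overlap c c'" using z cosphere_chart_dom unfolding overlap_def fst_cotangent_chart by blast
  then show "s \<in> \<Omega> \<inter> {s. fst (T s) \<in> overlap c c'}" using cosphere_chart_lift(1)[OF z(1)] z(3) by simp
next
  fix s assume s: "s \<in> \<Omega> \<inter> {s. fst (T s) \<in> overlap c c'}"
  let ?z = "chart_inv \<C> (sphere_lift s)"
  have z: "?z \<in> fst \<K>" "snd \<K> ?z = s" using cosphere_chart_of_lift s by blast+
  then have zC: "?z \<in> fst \<C>" by (simp add: cosphere_chart_dom)
  have "snd \<C> ?z = sphere_lift s" using bundle_chart_inv(2)[of "sphere_lift s"] s sphere_lift_facts(1)[of s] by simp
  then have "snd \<C> ?z \<in> overlap c c' \<times> UNIV" using s sphere_lift_facts(1)[of s] by (simp add: mem_Times_iff)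
  then have "fst ?z \<in> fst c'" by (simp only: overlap_cotangent[OF mfd c c' zC])
  then have "?z \<in> fst (cotangent_chart \<A> c')" using zC by (simp add: fst_cotangent_chart)
  then show "s \<in> overlap \<K> (cotangent_chart \<A> c')" using z unfolding overlap_def by (metis IntI imageI)
qed

lemma cosphere_transition:
  assumes c': "c' \<in> \<A>" and s: "s \<in> overlap \<K> (cotangent_chart \<A> c')"
  shows "transition \<K> (cotangent_chart \<A> c') s = cotangent_transition c c' (sphere_lift s)"
    "cotangent_transition c' c (transition \<K> (cotangent_chart \<A> c') s) = sphere_lift s"
    "transition \<K> (cotangent_chart \<A> c') s \<in> overlap c' c \<times> UNIV"
proof -
  have s': "s \<in> \<Omega>" "fst (T s) \<in> overlap c c'" using s unfolding cosphere_chart_overlap[OF c'] by blast+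
  let ?z = "chart_inv \<C> (sphere_lift s)"
  have zC: "?z \<in> fst \<C>" using cosphere_chart_of_lift(1)[OF s'(1)] by (simp add: cosphere_chart_dom)
  have zpsi: "snd \<C> ?z = sphere_lift s" using bundle_chart_inv(2)[of "sphere_lift s"] s' sphere_lift_facts(1)[of s] by simp
  have "snd \<C> ?z \<in> overlap c c' \<times> UNIV" unfolding zpsi using s' sphere_lift_facts(1)[of s] by (simp add: mem_Times_iff)
  then have f: "fst ?z \<in> fst c'" by (simp only: overlap_cotangent[OF mfd c c' zC])
  have zC': "?z \<in> fst (cotangent_chart \<A> c')" using zC f by (simp add: fst_cotangent_chart)
  have fc: "fst ?z \<in> fst c" using zC by (simp add: fst_cotangent_chart)
  have tr: "transition \<K> (cotangent_chart \<A> c') s = snd (cotangent_chart \<A> c') ?z"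
    using s' by (simp add: transition_def chart_inv_cosphere_chart)
  show "transition \<K> (cotangent_chart \<A> c') s = cotangent_transition c c' (sphere_lift s)"
    unfolding tr using cotangent_transition_apply[OF mfd c c' zC f] by (simp only: zpsi)
  show "cotangent_transition c' c (transition \<K> (cotangent_chart \<A> c') s) = sphere_lift s"
    unfolding tr using cotangent_transition_apply[OF mfd c' c zC' fc] by (simp only: zpsi)
  show "transition \<K> (cotangent_chart \<A> c') s \<in> overlap c' c \<times> UNIV"
    unfolding tr using overlap_cotangent[OF mfd c' c zC'] fc by blast
qed

lemma open_cosphere_chart_overlap: "c' \<in> \<A> \<Longrightarrow> open (overlap \<K> (cotangent_chart \<A> c'))"
  unfolding overlap_def
proof (rule chart_open_image[OF cosphere_chart_of, of "fst (cotangent_chart \<A> c') \<inter> \<N>", THEN back_subst[where P = "open"]])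
  assume c': "c' \<in> \<A>"
  have "openin \<X> (fst (cotangent_chart \<A> c'))" using openin_cotangentI[OF mfd c' open_UNIV] by simp
  then show "openin (subtopology \<X> \<N>) (fst (cotangent_chart \<A> c') \<inter> \<N>)" by (auto simp: openin_subtopology)
  show "snd \<K> ` (fst \<K> \<inter> (fst (cotangent_chart \<A> c') \<inter> \<N>)) = snd \<K> ` (fst \<K> \<inter> fst (cotangent_chart \<A> c'))"
    by (rule arg_cong[where f = "image (snd \<K>)"]) (auto simp: cosphere_chart_dom)
qed

lemma cosphere_transition_C1:
  assumes c': "c' \<in> \<A>"
  shows "Ck_on 1 (transition \<K> (cotangent_chart \<A> c')) (overlap \<K> (cotangent_chart \<A> c'))"
proof (rule C1_cong[OF _ open_cosphere_chart_overlap[OF c'] cosphere_transition(1)[OF c', symmetric]])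
  have "Ck_on 1 sphere_lift (overlap \<K> (cotangent_chart \<A> c'))"
    by (rule C1_subset[OF sphere_lift_C1]) (simp add: cosphere_chart_overlap[OF c'])
  then show "Ck_on 1 (\<lambda>s. cotangent_transition c c' (sphere_lift s)) (overlap \<K> (cotangent_chart \<A> c'))"
    by (rule C1_compose[OF _ cotangent_transition_C1[OF mfd c c']])
      (auto simp: cosphere_chart_overlap[OF c'] mem_Times_iff sphere_lift_facts)
qed

text \<open>The inverse parametrization has a differentiable left inverse, so its derivative has a left inverse.\<close>

lemma cosphere_transition_immersion:
  assumes c': "c' \<in> \<A>" and s: "s \<in> overlap \<K> (cotangent_chart \<A> c')"
  shows "inj (frechet_derivative (transition \<K> (cotangent_chart \<A> c')) (at s))"
proof -
  let ?F = "transition \<K> (cotangent_chart \<A> c')"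
  let ?O = "overlap \<K> (cotangent_chart \<A> c')"
  have F: "(?F has_derivative frechet_derivative ?F (at s)) (at s)"
    by (rule C1_has_derivative[OF cosphere_transition_C1[OF c'] s])
  have G: "(cotangent_transition c' c has_derivative frechet_derivative (cotangent_transition c' c) (at (?F s))) (at (?F s))"
    by (rule C1_has_derivative[OF cotangent_transition_C1[OF mfd c' c] cosphere_transition(3)[OF c' s]])
  have s\<Omega>: "s' \<in> \<Omega>" if "s' \<in> ?O" for s' using that unfolding cosphere_chart_overlap[OF c'] by blast
  have "sphere_lift s \<in> {q. snd q \<bullet> b \<noteq> 0}" using sphere_lift_facts(2)[OF s\<Omega>[OF s]] by auto
  then have D: "(direction_coord T b has_derivative frechet_derivative (direction_coord T b) (at (sphere_lift s)))
      (at ((cotangent_transition c' c \<circ> ?F) s))"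
    using C1_has_derivative[OF direction_coord_C1] cosphere_transition(2)[OF c' s] by simp
  let ?L = "frechet_derivative (direction_coord T b) (at (sphere_lift s)) \<circ> (frechet_derivative (cotangent_transition c' c) (at (?F s)) \<circ> frechet_derivative ?F (at s))"
  have "(direction_coord T b \<circ> (cotangent_transition c' c \<circ> ?F) has_derivative ?L) (at s)"
    by (rule diff_chain_at[OF diff_chain_at[OF F G] D])
  then have "((\<lambda>s. s) has_derivative ?L) (at s)"
    by (rule has_derivative_transform_within_open[OF _ open_cosphere_chart_overlap[OF c'] s])
      (simp add: cosphere_transition(2)[OF c'] sphere_lift_facts(4)[OF s\<Omega>])
  then have "?L = (\<lambda>v. v)" using has_derivative_ident has_derivative_unique by blast
  then show ?thesis by (metis (no_types, lifting) comp_apply injI)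
qed

lemma cosphere_chart_is_submanifold_chart: "\<K> \<in> C1_submanifold_charts \<X> (cotangent_atlas \<A>) \<N>"
  unfolding C1_submanifold_charts_def cotangent_atlas_def
  using cosphere_chart_of cosphere_transition_C1 cosphere_transition_immersion by blast

end

end

section \<open>Normals of a DC aura\<close>

lemma convex_covectors_cotangent_space: "convex_covectors (cotangent_space \<A> x)"
  unfolding convex_covectors_def
proof (intro ballI allI impI)
  fix \<xi> \<zeta> and u v :: real assume *: "\<xi> \<in> cotangent_space \<A> x" "\<zeta> \<in> cotangent_space \<A> x"
  show "(\<lambda>c. u *\<^sub>R \<xi> c + v *\<^sub>R \<zeta> c) \<in> cotangent_space \<A> x"
    unfolding cotangent_space_def mem_Collect_eq
  proof (intro conjI ballI impI allI)
    fix c c' w assume c: "c \<in> \<A>" "c' \<in> \<A>" "x \<in> fst c" "x \<in> fst c'"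
    let ?D = "frechet_derivative (transition c c') (at (snd c x)) w"
    have "\<xi> c \<bullet> w = \<xi> c' \<bullet> ?D" "\<zeta> c \<bullet> w = \<zeta> c' \<bullet> ?D"
      using * c unfolding cotangent_space_def by blast+
    then show "(u *\<^sub>R \<xi> c + v *\<^sub>R \<zeta> c) \<bullet> w = (u *\<^sub>R \<xi> c' + v *\<^sub>R \<zeta> c') \<bullet> ?D"
      by (simp only: inner_add_left inner_scaleR_left)
  next
    fix c assume "c \<notin> \<A> \<or> x \<notin> fst c"
    then have "\<xi> c = 0" "\<zeta> c = 0" using * unfolding cotangent_space_def by blast+
    then show "u *\<^sub>R \<xi> c + v *\<^sub>R \<zeta> c = 0" by simp
  qed
qed

lemma clarke_differential_subset: "clarke_differential M \<A> f x \<subseteq> cotangent_space \<A> x"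
  unfolding clarke_differential_def
  by (rule hull_minimal) (auto intro: convex_covectors_cotangent_space)

lemma cotangent_limit_coordinates:
  assumes mfd: "smooth_manifold M \<A>" and c: "c \<in> \<A>" and z: "z \<in> fst (cotangent_chart \<A> c)"
    and lim: "limitin (cotangent_topology \<A>) zs z sequentially"
  shows "\<forall>\<^sub>F i in sequentially. zs i \<in> fst (cotangent_chart \<A> c)"
    "(\<lambda>i. snd (cotangent_chart \<A> c) (zs i)) \<longlonglongrightarrow> snd (cotangent_chart \<A> c) z"
proof -
  have ev: "\<forall>\<^sub>F i in sequentially. zs i \<in> fst (cotangent_chart \<A> c) \<and> snd (cotangent_chart \<A> c) (zs i) \<in> W"
    if "open W" "snd (cotangent_chart \<A> c) z \<in> W" for W
  proof -
    have "openin (cotangent_topology \<A>) {z \<in> fst (cotangent_chart \<A> c). snd (cotangent_chart \<A> c) z \<in> W}"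
      by (rule openin_cotangentI[OF mfd c that(1)])
    moreover have "z \<in> {z \<in> fst (cotangent_chart \<A> c). snd (cotangent_chart \<A> c) z \<in> W}" using z that by blast
    ultimately have "\<forall>\<^sub>F i in sequentially. zs i \<in> {z \<in> fst (cotangent_chart \<A> c). snd (cotangent_chart \<A> c) z \<in> W}"
      using lim unfolding limitin_def by blast
    then show ?thesis by (simp only: mem_Collect_eq)
  qed
  show "\<forall>\<^sub>F i in sequentially. zs i \<in> fst (cotangent_chart \<A> c)"
    using ev[OF open_UNIV UNIV_I] by (rule eventually_mono) blast
  show "(\<lambda>i. snd (cotangent_chart \<A> c) (zs i)) \<longlonglongrightarrow> snd (cotangent_chart \<A> c) z"
    unfolding tendsto_def using ev by (blast intro: eventually_mono)
qed

text \<open>The differences of subgradients form a convex set, so it suffices to consider limits of differentials,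
  and those can be computed in the chart.\<close>

lemma clarke_differential_subgradients:
  assumes mfd: "smooth_manifold M \<A>" and c: "c \<in> \<A>" "x \<in> fst c"
    and p: "convex_on N p" and q: "convex_on N q" and x: "snd c x \<in> interior N"
    and f: "\<And>y. y \<in> N \<Longrightarrow> (f \<circ> chart_inv c) y = p y - q y"
    and \<zeta>: "\<zeta> \<in> clarke_differential M \<A> f x"
  shows "\<exists>u\<in>subdiff N p (snd c x). \<exists>v\<in>subdiff N q (snd c x). \<zeta> c = u - v"
proof -
  let ?D = "{\<xi>. \<exists>u\<in>subdiff N p (snd c x). \<exists>v\<in>subdiff N q (snd c x). \<xi> c = u - v}"
  have cx: "convex_covectors ?D"
    unfolding convex_covectors_def
  proof (intro ballI allI impI)
    fix \<xi> \<zeta> and s t :: real assume 1: "\<xi> \<in> ?D" "\<zeta> \<in> ?D" and st: "0 \<le> s" "0 \<le> t" "s + t = 1"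
    from 1 obtain u v u' v' where uv: "u \<in> subdiff N p (snd c x)" "v \<in> subdiff N q (snd c x)" "\<xi> c = u - v"
      "u' \<in> subdiff N p (snd c x)" "v' \<in> subdiff N q (snd c x)" "\<zeta> c = u' - v'" by blast
    have "s *\<^sub>R u + t *\<^sub>R u' \<in> subdiff N p (snd c x)" "s *\<^sub>R v + t *\<^sub>R v' \<in> subdiff N q (snd c x)"
      using uv st by (auto intro: convexD[OF convex_approx_subdiff])
    moreover have "s *\<^sub>R \<xi> c + t *\<^sub>R \<zeta> c = (s *\<^sub>R u + t *\<^sub>R u') - (s *\<^sub>R v + t *\<^sub>R v')"
      by (simp add: uv algebra_simps)
    ultimately show "(\<lambda>c. s *\<^sub>R \<xi> c + t *\<^sub>R \<zeta> c) \<in> ?D" by blast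
  qed
  have "clarke_differential M \<A> f x \<subseteq> ?D"
    unfolding clarke_differential_def
  proof (rule hull_minimal[where S = convex_covectors, OF _ cx], clarify)
    fix \<xi> xs \<xi>s
    assume \<xi>: "\<xi> \<in> cotangent_space \<A> x" and d: "\<forall>i. has_differential M \<A> f (xs i) (\<xi>s i)"
      and lim: "limitin (cotangent_topology \<A>) (\<lambda>i. (xs i, \<xi>s i)) (x, \<xi>) sequentially"
    have "(x, \<xi>) \<in> fst (cotangent_chart \<A> c)" using c \<xi> by (simp add: fst_cotangent_chart)
    note L = cotangent_limit_coordinates[OF mfd c(1) this lim]
    obtain k where k: "\<And>i. i \<ge> k \<Longrightarrow> xs i \<in> fst c"
      using L(1) unfolding eventually_sequentially fst_cotangent_chart fst_conv by blast
    have L2: "(\<lambda>i. snd c (xs i)) \<longlonglongrightarrow> snd c x" "(\<lambda>i. \<xi>s i c) \<longlonglongrightarrow> \<xi> c"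
      using tendsto_fst[OF L(2)] tendsto_snd[OF L(2)] by (simp_all add: snd_cotangent_chart)
    show "\<exists>u\<in>subdiff N p (snd c x). \<exists>v\<in>subdiff N q (snd c x). \<xi> c = u - v"
    proof (rule gderiv_limit_subgradients[OF p q x f])
      show "(\<lambda>i. snd c (xs (i + k))) \<longlonglongrightarrow> snd c x" "(\<lambda>i. \<xi>s (i + k) c) \<longlonglongrightarrow> \<xi> c"
        by (rule LIMSEQ_ignore_initial_segment[OF L2(1)], rule LIMSEQ_ignore_initial_segment[OF L2(2)])
      fix i
      have "xs (i + k) \<in> fst c" by (rule k) simp
      then show "GDERIV (f \<circ> chart_inv c) (snd c (xs (i + k))) :> \<xi>s (i + k) c"
        using d c(1) unfolding has_differential_def by blast
    qed
  qed
  then show ?thesis using \<zeta> by blast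
qed

lemma DC_function_chart:
  assumes mfd: "smooth_manifold M \<A>" and f: "f \<in> DC_functions M \<A>" and c: "c \<in> \<A>" "x \<in> fst c"
  obtains N p q where "snd c x \<in> interior N" "N \<subseteq> snd c ` fst c" "convex_on N p" "convex_on N q"
    "\<And>y. y \<in> N \<Longrightarrow> (f \<circ> chart_inv c) y = p y - q y"
proof -
  have "DC_on (f \<circ> chart_inv c) (snd c ` fst c)"
    using f atlas_subset_C11_charts[OF mfd] c(1) unfolding DC_functions_def by blast
  then show ?thesis using that c(2) unfolding DC_on_def by (metis imageI)
qed

text \<open>A DC function is continuous, so its zero set is closed.\<close>

lemma DC_function_zero_on_frontier:
  assumes mfd: "smooth_manifold M \<A>" and f: "f \<in> DC_functions M \<A>" and c: "c \<in> \<A>" "x \<in> fst c"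
    and x: "x \<in> M frontier_of {y \<in> topspace M. f y = 0}"
  shows "f x = 0"
proof (rule ccontr)
  assume nz: "f x \<noteq> 0"
  obtain N p q where N: "snd c x \<in> interior N" "convex_on N p" "convex_on N q"
    and fpq: "\<And>y. y \<in> N \<Longrightarrow> (f \<circ> chart_inv c) y = p y - q y"
    using DC_function_chart[OF mfd f c] by metis
  note inv = chart_inv_left[OF atlas_chart_of[OF mfd c(1)]]
  have NI: "y \<in> interior N \<Longrightarrow> y \<in> N" for y using interior_subset by blast
  define W where "W = interior N \<inter> (\<lambda>y. p y - q y) -` (- {0})"
  have W: "open W" unfolding W_def
    by (intro continuous_open_preimage continuous_on_diff convex_isCont_interior(1) N) auto
  have fW: "f y \<noteq> 0" if "y \<in> fst c" "snd c y \<in> W" for y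
    using that fpq[of "snd c y"] NI by (auto simp: W_def inv)
  have "snd c x \<in> W" using N(1) fpq[of "snd c x"] NI nz c(2) by (auto simp: W_def inv)
  then have xV: "x \<in> {y \<in> fst c. snd c y \<in> W}" using c by simp
  define V where "V = {y \<in> fst c. snd c y \<in> W}"
  have V: "openin M V" unfolding V_def by (rule chart_open_preimage[OF atlas_chart_of[OF mfd c(1)] W])
  have "x \<in> M closure_of {y \<in> topspace M. f y = 0}" using x by (simp add: frontier_of_def)
  then have "\<forall>T. x \<in> T \<and> openin M T \<longrightarrow> (\<exists>y. y \<in> {y \<in> topspace M. f y = 0} \<and> y \<in> T)"
    unfolding in_closure_of by (rule conjunct2)
  then have "\<exists>y. y \<in> {y \<in> topspace M. f y = 0} \<and> y \<in> V" using V xV unfolding V_def[symmetric] by blast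
  then obtain y where "f y = 0" "y \<in> fst c" "snd c y \<in> W" unfolding V_def by blast
  then show False using fW by blast
qed

lemma nor_subset_cosphere_bundle:
  assumes len: "length_function M \<A> len" and \<epsilon>: "\<epsilon> > 0"
  shows "nor M \<A> len \<epsilon> f \<subseteq> cosphere_bundle M \<A> len"
proof
  fix z assume "z \<in> nor M \<A> len \<epsilon> f"
  then obtain x \<zeta> where z: "z = (x, \<lambda>c. \<zeta> c /\<^sub>R len (x, \<zeta>))" and l: "len (x, \<zeta>) \<ge> \<epsilon>"
    and \<zeta>: "\<zeta> \<in> clarke_differential M \<A> f x" and x: "x \<in> M frontier_of {y \<in> topspace M. f y = 0}"
    unfolding nor_def cosphere_projection_def by auto
  have xM: "x \<in> topspace M" by (rule subsetD[OF frontier_of_subset_topspace x])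
  have \<zeta>c: "\<zeta> \<in> cotangent_space \<A> x" by (rule subsetD[OF clarke_differential_subset \<zeta>])
  have b: "(x, \<zeta>) \<in> cotangent_bundle M \<A>" "z \<in> cotangent_bundle M \<A>"
    using xM \<zeta>c cotangent_space_scaleR[OF \<zeta>c] by (simp_all add: cotangent_bundle_def z)
  have "inverse (len (x, \<zeta>)) \<ge> 0" using l \<epsilon> by simp
  then have "len (x, \<lambda>c. inverse (len (x, \<zeta>)) *\<^sub>R \<zeta> c) = inverse (len (x, \<zeta>)) * len (x, \<zeta>)"
    using len b(1) unfolding length_function_def by blast
  then have "len z = 1" using l \<epsilon> by (simp add: z)
  then show "z \<in> cosphere_bundle M \<A> len" using b by (simp add: cosphere_bundle_def)
qed

text \<open>By homogeneity the zero covector has length 0.\<close>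

lemma cosphere_nonzero:
  assumes mfd: "smooth_manifold M \<A>" and len: "length_function M \<A> len"
    and z: "(x, \<xi>) \<in> cosphere_bundle M \<A> len" and c: "c \<in> \<A>" "x \<in> fst c"
  shows "\<xi> c \<noteq> 0"
proof
  assume 0: "\<xi> c = 0"
  have zb: "(x, \<xi>) \<in> cotangent_bundle M \<A>" and l: "len (x, \<xi>) = 1" using z by (auto simp: cosphere_bundle_def)
  then have \<xi>: "\<xi> \<in> cotangent_space \<A> x" by (simp add: cotangent_bundle_def)
  have "\<xi> = covector_of \<A> c x 0" using covector_of_eq[OF mfd \<xi> c] 0 by simp
  then have "\<xi> = (\<lambda>c. 0 *\<^sub>R \<xi> c)" by (auto simp: covector_of_def)
  moreover have "len (x, \<lambda>c. 0 *\<^sub>R \<xi> c) = 0 * len (x, \<xi>)"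
    using len zb unfolding length_function_def by blast
  ultimately show False using l by simp
qed

theorem theorem3p1:
  fixes M :: "'m topology"
    and \<A> :: "('m, 'e::euclidean_space) chart set"
    and g :: "('m, 'e) chart \<Rightarrow> 'm \<Rightarrow> 'e \<Rightarrow> 'e \<Rightarrow> real"
    and len :: "'m \<times> ('m, 'e) covector \<Rightarrow> real"
    and f :: "'m \<Rightarrow> real"
    and \<epsilon> :: real
  assumes "riemannian_manifold M \<A> g"
    and "length_function M \<A> len"
    and "DC_aura M \<A> f"
    and "\<epsilon> > 0"
    and "DIM('s::euclidean_space) = 2 * DIM('e) - 1"
  shows "nor M \<A> len \<epsilon> f \<subseteq> cosphere_bundle M \<A> len \<and>
    locally_finite_content
      (subtopology (cotangent_topology \<A>) (cosphere_bundle M \<A> len))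
      (C1_submanifold_charts (cotangent_topology \<A>) (cotangent_atlas \<A>) (cosphere_bundle M \<A> len)
        :: ('m \<times> ('m, 'e) covector, 's) chart set)
      (DIM('e) - 1) (nor M \<A> len \<epsilon> f)"
proof (rule conjI[OF nor_subset_cosphere_bundle[OF assms(2,4)]])
  have mfd: "smooth_manifold M \<A>" using assms(1) by (simp add: riemannian_manifold_def)
  note len = assms(2)
  have fDC: "f \<in> DC_functions M \<A>" and fpos: "\<And>x. x \<in> topspace M \<Longrightarrow> f x \<ge> 0"
    using assms(3) by (auto simp: DC_aura_def)
  let ?N = "cosphere_bundle M \<A> len"
  let ?Y = "subtopology (cotangent_topology \<A>) ?N"
  show "locally_finite_content ?Y (C1_submanifold_charts (cotangent_topology \<A>) (cotangent_atlas \<A>) ?N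
        :: ('m \<times> ('m, 'e) covector, 's) chart set) (DIM('e) - 1) (nor M \<A> len \<epsilon> f)"
    unfolding locally_finite_content_def
  proof
    fix z assume "z \<in> topspace ?Y"
    then have zN: "z \<in> ?N" by simp
    obtain x0 \<xi>0 where z: "z = (x0, \<xi>0)" by (cases z)
    have x0: "x0 \<in> topspace M" "\<xi>0 \<in> cotangent_space \<A> x0"
      using zN by (auto simp: z cosphere_bundle_def cotangent_bundle_def)
    obtain c where c: "c \<in> \<A>" "x0 \<in> fst c" using atlas_cover[OF mfd x0(1)] by blast
    have "\<xi>0 c \<noteq> 0" by (rule cosphere_nonzero[OF mfd len zN[unfolded z] c])
    then obtain b where b: "b \<in> Basis" "\<xi>0 c \<bullet> b \<noteq> 0" using euclidean_all_zero_iff by blast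
    define \<sigma> where "\<sigma> = sgn (\<xi>0 c \<bullet> b)"
    have \<sigma>: "\<sigma> = 1 \<or> \<sigma> = -1" "\<sigma> * (\<xi>0 c \<bullet> b) > 0" using b(2) by (auto simp: \<sigma>_def sgn_if)
    obtain T :: "'s \<Rightarrow> 'e \<times> 'e" where T: "linear T" "\<And>s. norm (T s) = norm s" "range T = {z. snd z \<bullet> b = 0}"
      and L: "distr lborel borel (\<lambda>(s, t). T s + (0, t *\<^sub>R b)) = lborel"
      using codimension_one_isometry[OF assms(5) b(1)] by metis
    note a = T b(1) mfd len c(1) \<sigma>(1)
    let ?C = "cotangent_chart \<A> c" and ?K = "cosphere_chart \<A> ?N c T b \<sigma>"
    define w where "w s = \<sigma> *\<^sub>R (b + snd (T s))" for s
    define lc where "lc = (local_length \<A> len c :: 'e \<times> 'e \<Rightarrow> real)"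
    have zK: "z \<in> fst ?K"
      using zN \<sigma>(2) c(2) x0 by (simp add: cosphere_chart_dom[OF a] z fst_cotangent_chart)
    define s0 where "s0 = snd ?K z"
    have KT: "fst (T (snd ?K y)) = snd c (fst y)" if "y \<in> fst ?K" for y
      using sphere_lift_facts(1)[OF a cosphere_chart_lift(1)[OF a that]] cosphere_chart_lift(2)[OF a that] by (simp add: snd_cotangent_chart)
    let ?\<Omega> = "{s. fst (T s) \<in> snd c ` fst c}"
    define p0 where "p0 = snd c x0"
    have Ts0: "fst (T s0) = p0" using KT[OF zK] by (simp add: s0_def p0_def z)
    obtain Nb p q where Nb: "p0 \<in> interior Nb" "Nb \<subseteq> snd c ` fst c" "convex_on Nb p" "convex_on Nb q"
      and fpq: "\<And>y. y \<in> Nb \<Longrightarrow> (f \<circ> chart_inv c) y = p y - q y"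
      using DC_function_chart[OF mfd fDC c] unfolding p0_def by metis
    obtain r0 where r0: "r0 > 0" "cball p0 r0 \<subseteq> interior Nb"
      using Nb(1) open_contains_cball open_interior by metis
    define \<rho> where "\<rho> = r0 / 2"
    have \<rho>: "\<rho> > 0" "cball p0 (2 * \<rho>) \<subseteq> interior Nb" using r0 by (auto simp: \<rho>_def)
    have BN: "cball p0 (2 * \<rho>) \<subseteq> Nb" using \<rho>(2) interior_subset by blast
    obtain pc where pc: "\<And>y. y \<in> cball p0 (2 * \<rho>) \<Longrightarrow> \<bar>p y\<bar> \<le> pc"
      by (rule compact_continuous_abs_bound[OF continuous_on_subset[OF convex_isCont_interior(1)[OF Nb(3)] \<rho>(2)] compact_cball])
        (rule that, assumption)
    have "s0 \<in> ?\<Omega>" unfolding s0_def by (rule cosphere_chart_lift(1)[OF a zK])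
    then obtain \<delta>0 where \<delta>0: "\<delta>0 > 0" "cball s0 \<delta>0 \<subseteq> ?\<Omega>"
      using open_coord_range[OF a] open_contains_cball by metis
    define \<delta> where "\<delta> = min \<delta>0 \<rho>"
    have \<delta>: "\<delta> > 0" "\<delta> \<le> \<rho>" "cball s0 \<delta> \<subseteq> ?\<Omega>" using \<delta>0 \<rho> by (auto simp: \<delta>_def)
    have lc_cont: "continuous_on ?\<Omega> (\<lambda>s. lc (fst (T s), w s))"
      unfolding lc_def w_def by (rule C1_continuous_on[OF local_length_affine_C1[OF a]])
    have lc_pos: "lc (fst (T s), w s) > 0" if "s \<in> ?\<Omega>" for s
      unfolding lc_def w_def using that signed_direction_nonzero[OF a] by (intro local_length_pos[OF a]) simp_all
    obtain \<Lambda> where \<Lambda>': "\<And>s. s \<in> cball s0 \<delta> \<Longrightarrow> \<bar>lc (fst (T s), w s)\<bar> \<le> \<Lambda>"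
      by (rule compact_continuous_abs_bound[OF continuous_on_subset[OF lc_cont \<delta>(3)] compact_cball])
        (rule that, assumption)
    have \<Lambda>: "lc (fst (T s), w s) \<le> \<Lambda>" if "s \<in> cball s0 \<delta>" for s using \<Lambda>'[OF that] by simp
    have "s0 \<in> cball s0 \<delta>" using \<delta>(1) by simp
    then have \<Lambda>pos: "\<Lambda> > 0" using \<Lambda> lc_pos \<delta>(3) by (meson less_le_trans subsetD)
    \<comment> \<open>if $\zeta = \tau\,w$ has length at least $\varepsilon$ and $w$ has length at most $\Lambda$, then $\tau \ge \varepsilon/\Lambda$\<close>
    define \<tau>0 where "\<tau>0 = \<epsilon> / \<Lambda>"
    have \<tau>0: "\<tau>0 > 0" using assms(4) \<Lambda>pos by (simp add: \<tau>0_def)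
    define V where "V = {y \<in> fst ?K. snd ?K y \<in> cball s0 \<delta>}"
    have Kch: "chart_of ?Y ?K" by (rule cosphere_chart_of[OF a])
    have Vcompact: "compactin ?Y V"
      unfolding V_def using \<delta>(3) by (intro chart_compact_preimage[OF Kch] compact_cball) (simp only: cosphere_chart_range[OF a])
    have "Hausdorff_space ?Y" by (intro Hausdorff_space_subtopology Hausdorff_cotangent[OF mfd])
    then have Vclosed: "?Y closure_of V = V" using compactin_imp_closedin[OF _ Vcompact] closure_of_closedin by blast
    have "openin ?Y {y \<in> fst ?K. snd ?K y \<in> ball s0 \<delta>}" by (rule chart_open_preimage[OF Kch open_ball])
    moreover have "{y \<in> fst ?K. snd ?K y \<in> ball s0 \<delta>} \<subseteq> V" using ball_subset_cball unfolding V_def by blast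
    ultimately have "{y \<in> fst ?K. snd ?K y \<in> ball s0 \<delta>} \<subseteq> ?Y interior_of V" by (rule interior_of_maximal[rotated])
    moreover have "z \<in> {y \<in> fst ?K. snd ?K y \<in> ball s0 \<delta>}" using zK \<delta>(1) by (simp add: s0_def)
    ultimately have Vint: "z \<in> ?Y interior_of V" by blast
    define S where "S = snd ?K ` (nor M \<A> len \<epsilon> f \<inter> V)"
    have S_near: "s \<in> cball s0 \<delta>" "fst (T s) \<in> cball p0 \<rho>" if "s \<in> S" for s
    proof -
      show s: "s \<in> cball s0 \<delta>" using that by (auto simp: S_def V_def)
      have "norm (fst (T (s - s0))) \<le> norm (T (s - s0))" using norm_fst_le[of "fst (T (s - s0))" "snd (T (s - s0))"] by simp
      also have "\<dots> \<le> \<rho>" using s \<delta>(2) by (simp add: T(2) dist_norm norm_minus_commute)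
      finally show "fst (T s) \<in> cball p0 \<rho>"
        by (simp add: linear_diff[OF T(1)] Ts0 dist_norm norm_minus_commute)
    qed
    have S_seg: "\<exists>u\<in>subdiff (cball p0 (2 * \<rho>)) p (fst (T s)). \<exists>v\<in>subdiff (cball p0 (2 * \<rho>)) p (fst (T s)).
        u - v = \<tau>0 *\<^sub>R (b + snd (T s))" if sS: "s \<in> S" for s
    proof -
      obtain y where y: "y \<in> nor M \<A> len \<epsilon> f" "y \<in> fst ?K" "s = snd ?K y" using sS by (auto simp: S_def V_def)
      obtain x \<zeta> where yx: "y = (x, \<lambda>c. \<zeta> c /\<^sub>R len (x, \<zeta>))" and l: "len (x, \<zeta>) \<ge> \<epsilon>"
        and \<zeta>: "\<zeta> \<in> clarke_differential M \<A> f x" and x: "x \<in> M frontier_of {y \<in> topspace M. f y = 0}"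
        using y(1) unfolding nor_def cosphere_projection_def by auto
      define l where "l = len (x, \<zeta>)"
      have lpos: "l > 0" using l assms(4) by (simp add: l_def)
      have yC: "y \<in> fst ?C" "\<sigma> * (snd y c \<bullet> b) > 0" using y(2) unfolding cosphere_chart_dom[OF a] by blast+
      have xc: "x \<in> fst c" using yC(1) by (simp add: yx fst_cotangent_chart)
      have P: "fst (T s) = snd c x" using KT[OF y(2)] y(3) by (simp add: yx)
      define \<beta> where "\<beta> = snd y c \<bullet> b"
      have "snd y c = \<beta> *\<^sub>R (b + snd (T s))"
      proof -
        have "snd (snd ?C y) \<bullet> b \<noteq> 0" using yC(2) by (auto simp: snd_cotangent_chart)
        from T_direction_coord(2)[OF T b(1) this] show ?thesis
          unfolding \<beta>_def y(3) cosphere_chart_apply[OF a] snd_cotangent_chart snd_conv .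
      qed
      moreover have "snd y c = inverse l *\<^sub>R \<zeta> c" by (simp add: yx l_def)
      ultimately have "l *\<^sub>R inverse l *\<^sub>R \<zeta> c = l *\<^sub>R \<beta> *\<^sub>R (b + snd (T s))" by simp
      then have \<zeta>l: "\<zeta> c = (l * \<beta>) *\<^sub>R (b + snd (T s))" using lpos by simp
      define \<tau> where "\<tau> = l * (\<sigma> * \<beta>)"
      have \<tau>pos: "\<tau> > 0" using lpos yC(2) by (simp add: \<tau>_def \<beta>_def)
      have "\<tau> *\<^sub>R w s = (l * \<beta> * (\<sigma> * \<sigma>)) *\<^sub>R (b + snd (T s))" by (simp add: \<tau>_def w_def ac_simps)
      then have \<zeta>w: "\<zeta> c = \<tau> *\<^sub>R w s" using \<zeta>l \<sigma>(1) by auto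
      have "\<zeta> \<in> cotangent_space \<A> x" by (rule subsetD[OF clarke_differential_subset \<zeta>])
      then have "(x, \<zeta>) \<in> fst ?C" using xc by (simp add: fst_cotangent_chart)
      then have "l = lc (snd ?C (x, \<zeta>))" unfolding lc_def l_def by (rule local_length_chart[OF a, symmetric])
      also have "snd ?C (x, \<zeta>) = (fst (T s), \<tau> *\<^sub>R w s)" by (simp add: snd_cotangent_chart P \<zeta>w)
      also have "lc (fst (T s), \<tau> *\<^sub>R w s) = \<tau> * lc (fst (T s), w s)"
        unfolding lc_def using xc \<tau>pos by (intro local_length_scaleR[OF a]) (auto simp: P)
      also have "\<dots> \<le> \<tau> * \<Lambda>" using \<Lambda>[OF S_near(1)[OF sS]] \<tau>pos by (intro mult_left_mono) auto
      finally have "\<epsilon> \<le> \<tau> * \<Lambda>" using l by (simp add: l_def)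
      then have \<tau>le: "\<tau>0 \<le> \<tau>" using \<Lambda>pos by (simp add: \<tau>0_def field_simps)
      have PN: "snd c x \<in> interior Nb" using S_near(2)[OF sS] \<rho> unfolding P by auto
      obtain u v where u: "u \<in> subdiff Nb p (snd c x)" and v: "v \<in> subdiff Nb q (snd c x)" and uv: "\<zeta> c = u - v"
        using clarke_differential_subgradients[OF mfd c(1) xc Nb(3,4) PN fpq \<zeta>] by blast
      have inv: "chart_inv c (snd c x) = x" by (rule chart_inv_left[OF atlas_chart_of[OF mfd c(1)] xc])
      have "f x = 0" by (rule DC_function_zero_on_frontier[OF mfd fDC c(1) xc x])
      moreover have "snd c x \<in> Nb" by (rule subsetD[OF interior_subset PN])
      ultimately have "q (snd c x) = p (snd c x)" using fpq[of "snd c x"] inv by simp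
      moreover have "q y \<le> p y" if y: "y \<in> Nb" for y
      proof -
        have "chart_inv c y \<in> fst c" using y Nb(2) by (intro chart_inv_in[OF atlas_chart_of[OF mfd c(1)]]) blast
        then have "chart_inv c y \<in> topspace M" using chart_subset[OF atlas_chart_of[OF mfd c(1)]] by blast
        then show ?thesis using fpos[of "chart_inv c y"] fpq[OF y] by simp
      qed
      ultimately have v': "v \<in> subdiff Nb p (snd c x)" using subdiff_le_at_contact[of Nb q p "snd c x"] v by blast
      define t where "t = \<tau>0 / \<tau>"
      have t: "0 \<le> t" "t \<le> 1" "t * \<tau> = \<tau>0" using \<tau>0 \<tau>pos \<tau>le by (auto simp: t_def)
      \<comment> \<open>shortening the segment from $v$ to $u$ makes it equal to $\tau_0 w$\<close>
      define u' where "u' = (1 - t) *\<^sub>R v + t *\<^sub>R u"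
      have u': "u' \<in> subdiff Nb p (snd c x)"
        unfolding u'_def using t u v' by (intro convexD[OF convex_approx_subdiff]) auto
      have "u' - v = t *\<^sub>R \<zeta> c" by (simp add: u'_def uv algebra_simps)
      then have d: "u' - v = \<tau>0 *\<^sub>R w s" by (simp add: \<zeta>w t)
      have sub: "subdiff Nb p (snd c x) \<subseteq> subdiff (cball p0 (2 * \<rho>)) p (snd c x)" by (rule subdiff_mono[OF BN])
      \<comment> \<open>for the negative sign the ends of the segment change roles\<close>
      from \<sigma>(1) show ?thesis
      proof
        assume "\<sigma> = 1"
        then have "u' - v = \<tau>0 *\<^sub>R (b + snd (T s))" using d by (simp add: w_def)
        then show ?thesis unfolding P using u' v' sub by blast
      next
        assume "\<sigma> = -1"
        then have "v - u' = \<tau>0 *\<^sub>R (b + snd (T s))" using d by (simp add: w_def algebra_simps)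
        then show ?thesis unfolding P using u' v' sub by blast
      qed
    qed
    have "cball x \<rho> \<subseteq> cball p0 (2 * \<rho>)" if "x \<in> cball p0 \<rho>" for x
      using that by (intro cball_subset_cball_iff[THEN iffD2]) (auto simp: dist_commute)
    from subdiff_directions_tube_bound[OF T L \<rho>(1) this bounded_cball pc \<tau>0 S_near(2) S_seg]
    obtain Cb where "Cb < \<infinity>"
      "\<And>r. 0 < r \<Longrightarrow> r \<le> 1 \<Longrightarrow> emeasure lborel (\<Union>s\<in>S. ball s r) \<le> ennreal (r ^ DIM('e)) * Cb"
      by metis
    then have "upper_content (DIM('e) - 1) S < \<infinity>" by (intro upper_content_finiteI[OF assms(5)]) auto
    then show "\<exists>V k. k \<in> (C1_submanifold_charts (cotangent_topology \<A>) (cotangent_atlas \<A>) ?N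
        :: ('m \<times> ('m, 'e) covector, 's) chart set) \<and> z \<in> ?Y interior_of V \<and>
      compactin ?Y (?Y closure_of V) \<and> ?Y closure_of V \<subseteq> fst k \<and>
      upper_content (DIM('e) - 1) (snd k ` (nor M \<A> len \<epsilon> f \<inter> V)) < \<infinity>"
      using cosphere_chart_is_submanifold_chart[OF a] Vint Vcompact unfolding S_def
      by (intro exI[of _ V] exI[of _ ?K]) (simp add: Vclosed, auto simp: V_def)
  qed
qed

end
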